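(* Let $\mathbf{K}_{\mathbf{x}}$ be a fixed $N_A\times N_A$ covariance matrix (Hermitian positive semidefinite). If the legitimate channel $\mathbf{H}$ is less noisy on average than the eavesdropper channel $\mathbf{G}$, then among all input distributions $p_{(u,\mathbf{x})}$ with $\mathrm{cov}[\mathbf{x}]=\mathbf{K}_{\mathbf{x}}$, the ergodic secrecy rate $\mathrm{ESR}$ is maximized by the non-precoded Gaussian input ($u\equiv\mathbf{x}$ with $\mathbf{x}$ circularly symmetric complex Gaussian of covariance $\mathbf{K}_{\mathbf{x}}$), and $$\max_{\substack{p_{(u,\mathbf{x})}\\ \mathrm{cov}[\mathbf{x}]=\mathbf{K}_{\mathbf{x}}}}\mathrm{ESR}=\mathbb{E}_{\mathbf{H},\mathbf{G}}\left[\log\left(\frac{\det(\mathbf{I}+\mathbf{H}\mathbf{K}_{\mathbf{x}}\mathbf{H}^\dagger)}{\det(\mathbf{I}+\mathbf{G}\mathbf{K}_{\mathbf{x}}\mathbf{G}^\dagger)}\right)\right].$$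
   Context: Channel model (MIMOME). Let $N_A,N_B,N_E\ge 1$ be integers. A message $u$, a random variable in an arbitrary set $\mathcal{U}$, is encoded into a random vector $\mathbf{x}\in\mathbb{C}^{N_A}$; the joint law $p_{(u,\mathbf{x})}$ is the input distribution (the set $\mathcal U$, the law of $u$ and the conditional law of $\mathbf{x}$ given $u$ are all free). The legitimate receiver observes $\mathbf{y}=\mathbf{H}\mathbf{x}+\mathbf{w}_B\in\mathbb{C}^{N_B}$ and the eavesdropper observes $\mathbf{z}=\mathbf{G}\mathbf{x}+\mathbf{w}_E\in\mathbb{C}^{N_E}$, where $\mathbf{H}\in\mathbb{C}^{N_B\times N_A}$ and $\mathbf{G}\in\mathbb{C}^{N_E\times N_A}$ are random matrices (with given distributions, the channel statistics) independent of $(u,\mathbf{x})$, and $\mathbf{w}_B,\mathbf{w}_E$ are circularly symmetric complex Gaussian noise vectors with identity covariance, independent of each other and of everything else. $\dagger$ is the conjugate transpose; $\log$ is base 2; $I(\cdot;\cdot)$ is Shannon mutual information in bits. Instantaneous quantities: $I(u;\mathbf{y})$ and $I(u;\mathbf{z})$ denote the mutual informations for the instantaneous channel states, i.e. $I(u;\mathbf{y}\mid\mathbf{H}=\mathbf{H}_0)$ evaluated at $\mathbf{H}_0=\mathbf{H}$ and $I(u;\mathbf{z}\mid\mathbf{G}=\mathbf{G}_0)$ evaluated at $\mathbf{G}_0=\mathbf{G}$; they are thus random variables, functions of $(\mathbf{H},\mathbf{G})$. The ergodic secrecy rate is $\mathrm{ESR}=\mathbb{E}_{\mathbf{H},\mathbf{G}}[I(u;\mathbf{y})-I(u;\mathbf{z})]$.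 Less noisy on average: $\mathbf{H}$ is less noisy on average than $\mathbf{G}$ if for every input distribution $p_{(u,\mathbf{x})}$ (every channel $u\to\mathbf{x}$), $\mathbb{E}_{\mathbf{H}}[I(u;\mathbf{y})]\ge\mathbb{E}_{\mathbf{G}}[I(u;\mathbf{z})]$. The notation $u\equiv\mathbf{x}$ means that $u$ is identified with $\mathbf{x}$ (no precoding).
   Formalization: Adds the assumption that E_G[log det(I+G K_x G†)] is finite; without it the stated expectation can be undefined (∞−∞), e.g. for i.i.d. scalar H, G with infinite E log(1+|H|²). *)

theory Defs
  imports "HOL-Probability.Probability"
begin

subsection \<open>Expectation with values in the extended reals\<close>

text \<open>
  The Bochner integral is \<open>0\<close> on non-integrable functions. The difference of the integrals of the
  positive and the negative part is used instead, so that infinite expectations stay infinite.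
  (\<open>e2ennreal\<close> sends negative numbers to \<open>0\<close>.) If both parts are infinite the value is not meaningful.
\<close>

definition extended_expectation :: "'w measure \<Rightarrow> ('w \<Rightarrow> ereal) \<Rightarrow> ereal" where
  "extended_expectation M f =
     enn2ereal (\<integral>\<^sup>+ \<omega>. e2ennreal (f \<omega>) \<partial>M) - enn2ereal (\<integral>\<^sup>+ \<omega>. e2ennreal (- f \<omega>) \<partial>M)"

lemma extended_expectation_integrable:
  assumes "integrable M f"
  shows "extended_expectation M (\<lambda>\<omega>. ereal (f \<omega>)) = ereal (\<integral>\<omega>. f \<omega> \<partial>M)"
proof -
  have e: "e2ennreal (ereal r) = ennreal r" for r
    by (simp add: ennreal.abs_eq e2ennreal_def ennreal_def)
  obtain r q where "0 \<le> r" "0 \<le> q"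
    "(\<integral>\<^sup>+ \<omega>. ennreal (f \<omega>) \<partial>M) = ennreal r" "(\<integral>\<^sup>+ \<omega>. ennreal (- f \<omega>) \<partial>M) = ennreal q"
    "integral\<^sup>L M f = r - q"
    using integrableE[OF assms] by metis
  then show ?thesis
    by (simp add: extended_expectation_def e uminus_ereal.simps(1) enn2ereal_ennreal)
qed


subsection \<open>Mutual information with values in the extended reals\<close>

text \<open>
  The library's \<open>KL_divergence\<close> and \<open>mutual_information\<close> are real-valued Bochner integrals, hence
  meaningful only when finite. The versions below integrate the same \<open>entropy_density\<close>, and give
  \<open>\<infinity>\<close> when absolute continuity or integrability fails. (The negative part of the integrand always
  has a finite integral for probability measures.)
\<close>

definition extended_KL_divergence :: "real \<Rightarrow> 'x measure \<Rightarrow> 'x measure \<Rightarrow> ereal" where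
  "extended_KL_divergence b P Q =
     (if absolutely_continuous P Q
      then extended_expectation Q (\<lambda>x. ereal (entropy_density b P Q x)) else \<infinity>)"

definition extended_mutual_information ::
    "real \<Rightarrow> 'w measure \<Rightarrow> 's measure \<Rightarrow> 't measure \<Rightarrow> ('w \<Rightarrow> 's) \<Rightarrow> ('w \<Rightarrow> 't) \<Rightarrow> ereal" where
  "extended_mutual_information b M S T X Y =
     extended_KL_divergence b (distr M S X \<Otimes>\<^sub>M distr M T Y)
       (distr M (S \<Otimes>\<^sub>M T) (\<lambda>\<omega>. (X \<omega>, Y \<omega>)))"

lemma (in prob_space) extended_mutual_information_eq:
  defines "PQ S T X Y \<equiv> distr M S X \<Otimes>\<^sub>M distr M T Y"
    and "J S T X Y \<equiv> distr M (S \<Otimes>\<^sub>M T) (\<lambda>\<omega>. (X \<omega>, Y \<omega>))"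
  assumes "absolutely_continuous (PQ S T X Y) (J S T X Y)"
    and "integrable (J S T X Y) (entropy_density b (PQ S T X Y) (J S T X Y))"
  shows "extended_mutual_information b M S T X Y = ereal (mutual_information b S T X Y)"
  using assms extended_expectation_integrable[OF assms(4)]
  by (simp add: extended_mutual_information_def extended_KL_divergence_def
      mutual_information_def KL_divergence_def)


subsection \<open>Complex matrices and circularly symmetric complex Gaussian vectors\<close>

definition conjugate_transpose :: "complex ^ 'n ^ 'm \<Rightarrow> complex ^ 'm ^ 'n"
    ("(_\<^sup>\<dagger>)" [1000] 999) where
  "A\<^sup>\<dagger> = (\<chi> i j. cnj (A $ j $ i))"

definition hermitian_psd :: "complex ^ 'n ^ 'n \<Rightarrow> bool" where
  "hermitian_psd K \<longleftrightarrow>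
     K\<^sup>\<dagger> = K \<and> (\<forall>v :: complex ^ 'n. 0 \<le> Re (\<Sum>i\<in>UNIV. cnj (v $ i) * (K *v v) $ i))"

text \<open>
  Identity covariance means that each complex component has variance \<open>1\<close>, that is, that its real
  and imaginary parts are independent with variance \<open>1/2\<close>.
\<close>

definition standard_complex_gaussian :: "(complex ^ 'n) measure" where
  "standard_complex_gaussian =
     density lborel (\<lambda>w. ennreal (exp (- (norm w)\<^sup>2) / pi ^ CARD('n)))"

text \<open>
  The zero-mean circularly symmetric Gaussian law with a possibly singular covariance \<open>K\<close>, as the
  law of \<open>A w\<close> with \<open>w\<close> standard and \<open>A A\<^sup>\<dagger> = K\<close>. Such an \<open>A\<close> exists if \<open>K\<close> is Hermitian positive
  semidefinite, and the law does not depend on its choice, because two square factors of \<open>K\<close> differ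
  by a unitary matrix on the right and the standard law is unitarily invariant.
\<close>

definition complex_gaussian :: "complex ^ 'n ^ 'n \<Rightarrow> (complex ^ 'n) measure" where
  "complex_gaussian K =
     distr standard_complex_gaussian borel
       (\<lambda>w. (SOME A :: complex ^ 'n ^ 'n. A ** A\<^sup>\<dagger> = K) *v w)"


subsection \<open>Input distributions\<close>

text \<open>
  A message set is a measurable space \<open>S\<close> on an arbitrary type, and an input distribution is the
  joint law of the message and the channel input.
\<close>

definition input_distribution :: "'u measure \<Rightarrow> ('u \<times> (complex ^ 'n)) measure \<Rightarrow> bool" where
  "input_distribution S p \<longleftrightarrow> prob_space p \<and> sets p = sets (S \<Otimes>\<^sub>M borel)"

definition has_input_covariance ::
    "('u \<times> (complex ^ 'n)) measure \<Rightarrow> complex ^ 'n ^ 'n \<Rightarrow> bool" where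
  "has_input_covariance p K \<longleftrightarrow>
     (\<forall>i. integrable p (\<lambda>(u, x). (cmod (x $ i))\<^sup>2)) \<and>
     (\<forall>i j. (\<integral>(u, x). (x $ i - (\<integral>(u', x'). x' $ i \<partial>p)) *
                       cnj (x $ j - (\<integral>(u', x'). x' $ j \<partial>p)) \<partial>p) = K $ i $ j)"

definition inputs_with_covariance ::
    "'u measure \<Rightarrow> complex ^ 'n ^ 'n \<Rightarrow> ('u \<times> (complex ^ 'n)) measure set" where
  "inputs_with_covariance S K = {p. input_distribution S p \<and> has_input_covariance p K}"

definition nonprecoded_gaussian_input ::
    "complex ^ 'n ^ 'n \<Rightarrow> ((complex ^ 'n) \<times> (complex ^ 'n)) measure" where
  "nonprecoded_gaussian_input K = distr (complex_gaussian K) (borel \<Otimes>\<^sub>M borel) (\<lambda>x. (x, x))"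


subsection \<open>Instantaneous information, channel comparison, and ergodic secrecy rate\<close>

text \<open>
  The information, in bits, between \<open>u\<close> and \<open>A x + w\<close> for a fixed channel matrix \<open>A\<close> and standard
  noise \<open>w\<close> independent of \<open>(u, x)\<close>. As the random channel matrix is independent of \<open>(u, x, w)\<close>,
  this is the mutual information conditional on the channel matrix being equal to \<open>A\<close>.
\<close>

definition instantaneous_information ::
    "'u measure \<Rightarrow> ('u \<times> (complex ^ 'n)) measure \<Rightarrow> complex ^ 'n ^ 'm \<Rightarrow> ereal" where
  "instantaneous_information S p A =
     extended_mutual_information 2 (p \<Otimes>\<^sub>M (standard_complex_gaussian :: (complex ^ 'm) measure))
       S borel (\<lambda>((u, x), w). u) (\<lambda>((u, x), w). A *v x + w)"

text \<open>
  Types cannot be quantified inside a formula, so the type from which the message sets are taken is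
  a parameter. All \<open>\<sigma>\<close>-algebras on this type are allowed.
\<close>

definition less_noisy_on_average ::
    "'u itself \<Rightarrow> 'w measure \<Rightarrow> ('w \<Rightarrow> complex ^ 'n ^ 'b) \<Rightarrow> ('w \<Rightarrow> complex ^ 'n ^ 'e) \<Rightarrow> bool" where
  "less_noisy_on_average _ M H G \<longleftrightarrow>
     (\<forall>(S :: 'u measure) p. input_distribution S p \<longrightarrow>
        extended_expectation M (\<lambda>\<omega>. instantaneous_information S p (H \<omega>)) \<ge>
        extended_expectation M (\<lambda>\<omega>. instantaneous_information S p (G \<omega>)))"

definition ergodic_secrecy_rate ::
    "'w measure \<Rightarrow> ('w \<Rightarrow> complex ^ 'n ^ 'b) \<Rightarrow> ('w \<Rightarrow> complex ^ 'n ^ 'e) \<Rightarrow>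
     'u measure \<Rightarrow> ('u \<times> (complex ^ 'n)) measure \<Rightarrow> ereal" where
  "ergodic_secrecy_rate M H G S p =
     extended_expectation M
       (\<lambda>\<omega>. instantaneous_information S p (H \<omega>) - instantaneous_information S p (G \<omega>))"

text \<open>
  For Hermitian positive semidefinite \<open>K\<close> the determinant of \<open>I + A K A\<^sup>\<dagger>\<close> is real and at least \<open>1\<close>,
  so taking the real part loses nothing.
\<close>

definition gram_det :: "complex ^ 'n ^ 'n \<Rightarrow> complex ^ 'n ^ 'm \<Rightarrow> real" where
  "gram_det K A = Re (det (mat 1 + A ** K ** A\<^sup>\<dagger>))"

end

theory Submission
  imports Defs
begin

text \<open>
  Let \<open>D\<^sub>A(P, Q)\<close> be the relative entropy between the output laws of the channel \<open>A\<close> for the input laws \<open>P\<close> and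
  \<open>Q\<close>, and let \<open>Q\<close> be the Gaussian law with the mean and covariance of \<open>x\<close>. The divergence of the noise
  around \<open>A x\<close> from the Gaussian output law is a quadratic function of \<open>x\<close>, so its expectation is the same for all
  inputs with covariance \<open>K\<close>, and equals \<open>C(A) = log det(I + A K A\<^sup>\<dagger>)\<close>. The chain rule for relative entropy turns this
  into \<open>C(A) = I(u; y) + I(x; y | u) + D\<^sub>A(P, Q)\<close> with nonnegative terms. So it suffices that the last two terms are
  on average at least as large for \<open>H\<close> as for \<open>G\<close>. For \<open>I(x; y | u)\<close> this is the hypothesis applied to the
  conditional laws of \<open>x\<close> given \<open>u\<close>. For \<open>D\<^sub>A(P, Q)\<close> apply it to a binary message that selects \<open>P\<close> with
  probability \<open>\<lambda>\<close> and \<open>Q\<close> otherwise: its information is \<open>\<lambda> D\<^sub>A(P, Q) + o(\<lambda>)\<close>.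
\<close>

section \<open>Complex matrices\<close>

text \<open>The message of a competing input may live in any measurable space, while the comparison
  hypothesis speaks of messages that are vectors in \<open>complex ^ 'a\<close>. Both uses respect
  this: once \<open>u\<close> is fixed, the message is the vector \<open>x\<close> itself, and the
  binary message takes two vectors as values. Fixing \<open>u\<close> calls for conditional laws of
  \<open>x\<close> over an arbitrary message space; they are constructed from the second countable
  topology of the input space. Expected informations may be infinite. The identities are therefore
  sums in \<open>ennreal\<close>, and expectations are subtracted only at the end, where
  integrability of the log determinant for \<open>G\<close> excludes infinity minus infinity. The
  remainder of the binary message is never estimated: for \<open>H\<close> the information is at
  most \<lambda> times the divergence, and for \<open>G\<close> Fatou's lemma gives the other
  direction as \<lambda> tends to 0. \<open>K\<close> may be singular, so the Gaussian input need
  not have a density; only \<open>I + A K A\<^sup>\<dagger>\<close> is inverted. The mean of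
  \<open>x\<close> is arbitrary, hence \<open>Q\<close> is shifted, but the log determinant does not
  see the shift.\<close>

definition outer :: "complex ^ 'm \<Rightarrow> complex ^ 'n \<Rightarrow> complex ^ 'n ^ 'm" where
  "outer u v = (\<chi> i j. u $ i * v $ j)"

definition cvec :: "complex ^ 'n \<Rightarrow> complex ^ 'n" where
  "cvec v = (\<chi> i. cnj (v $ i))"

definition herm :: "complex ^ 'n \<Rightarrow> complex ^ 'n \<Rightarrow> complex" where
  "herm v w = (\<Sum>i\<in>UNIV. cnj (v $ i) * w $ i)"

definition quad :: "complex ^ 'n ^ 'n \<Rightarrow> complex ^ 'n \<Rightarrow> real" where
  "quad K v = Re (herm v (K *v v))"

lemma hermitian_psd_iff_quad: "hermitian_psd K \<longleftrightarrow> K\<^sup>\<dagger> = K \<and> (\<forall>v. 0 \<le> quad K v)"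
  by (simp add: hermitian_psd_def quad_def herm_def)

lemma herm_add_left: "herm (u + v) w = herm u w + herm v w"
  and herm_add_right: "herm w (u + v) = herm w u + herm w v"
  and herm_diff_right: "herm w (u - v) = herm w u - herm w v"
  and herm_scale_left: "herm (c *s u) w = cnj c * herm u w"
  and herm_scale_right: "herm u (c *s w) = c * herm u w"
  and herm_commute: "herm v w = cnj (herm w v)"
  by (simp_all add: herm_def distrib_left distrib_right sum.distrib sum_distrib_left mult_ac
      left_diff_distrib right_diff_distrib sum_subtractf)

lemma norm_vec_sq: "(norm (v :: complex ^ 'n))\<^sup>2 = (\<Sum>i\<in>UNIV. (cmod (v $ i))\<^sup>2)"
  unfolding norm_vec_def L2_set_def by (simp add: real_sqrt_pow2 sum_nonneg)

lemma herm_self: "herm v v = of_real ((norm v)\<^sup>2)"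
  by (simp add: norm_vec_sq herm_def mult.commute[of "cnj _"] complex_norm_square flip: of_real_power)

lemma herm_adjoint: "herm v (A *v w) = herm (A\<^sup>\<dagger> *v v) w"
  unfolding herm_def matrix_vector_mult_def conjugate_transpose_def
  by (simp add: sum_distrib_left sum_distrib_right mult_ac) (rule sum.swap)

lemma conjugate_transpose_mult: "(A ** B)\<^sup>\<dagger> = B\<^sup>\<dagger> ** A\<^sup>\<dagger>"
  by (simp add: conjugate_transpose_def vec_eq_iff matrix_matrix_mult_def mult.commute)

lemma conjugate_transpose_add: "(A + B)\<^sup>\<dagger> = A\<^sup>\<dagger> + B\<^sup>\<dagger>"
  and conjugate_transpose_diff: "(A - B)\<^sup>\<dagger> = A\<^sup>\<dagger> - B\<^sup>\<dagger>"
  and conjugate_transpose_mat: "(mat 1 :: complex ^ 'n ^ 'n)\<^sup>\<dagger> = mat 1"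
  and conjugate_transpose_outer: "(outer u v)\<^sup>\<dagger> = outer (cvec v) (cvec u)"
  by (auto simp: conjugate_transpose_def vec_eq_iff outer_def cvec_def mat_def)

lemma cvec_cvec[simp]: "cvec (cvec v) = v"
  by (simp add: cvec_def vec_eq_iff)

text \<open>Hermitian symmetry makes the two cross terms conjugate to each other, so they combine
  into twice a real part. Completing the square in \<open>t\<close> along a direction
  \<open>w\<close> drives both the matrix factorization and the Gaussian integrals below.\<close>

lemma quad_expand:
  assumes "K\<^sup>\<dagger> = K"
  shows "quad K (v + t *s w) = quad K v + 2 * Re (cnj t * herm w (K *v v)) + (cmod t)\<^sup>2 * quad K w"
proof -
  have 1: "herm v (K *v w) = cnj (herm w (K *v v))"
    by (metis herm_adjoint herm_commute assms)
  have 2: "herm (v + t *s w) (K *v (v + t *s w)) =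
     herm v (K *v v) + t * herm v (K *v w) + cnj t * herm w (K *v v) + cnj t * t * herm w (K *v w)"
    by (simp add: matrix_vector_right_distrib vector_scalar_commute herm_add_left herm_add_right
        herm_scale_left herm_scale_right algebra_simps)
  show ?thesis
    unfolding quad_def 2 1 by (simp add: cmod_power2) (simp add: power2_eq_square algebra_simps)
qed

text \<open>Cramer's rule for the identity matrix, whose system is solved by \<open>v\<close>
  itself.\<close>

lemma det_update_identity_row:
  fixes v :: "'a::field ^ 'n"
  shows "det (\<chi> i. if i = k then v else axis i 1) = v $ k"
proof -
  have *: "row i (mat 1 :: 'a ^ 'n ^ 'n) = axis i 1" for i
    by (auto simp: row_def mat_def axis_def vec_eq_iff)
  have "(\<Sum>i\<in>UNIV. v $ i *s axis i 1) = v"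
    by (rule basis_expansion)
  with cramer_lemma_transpose[of k v "mat 1 :: 'a ^ 'n ^ 'n"] show ?thesis
    by (simp add: * cong: if_cong)
qed

text \<open>The matrix determinant lemma by multilinearity: rows of the identity are updated one at
  a time, and a determinant in which two rows are multiples of \<open>v\<close> vanishes.
  \<open>outer\<close> is bilinear, so no conjugate appears on the right.\<close>

lemma det_identity_plus_outer:
  fixes u v :: "complex ^ 'n"
  shows "det (mat 1 + outer u v) = 1 + (\<Sum>i\<in>UNIV. u $ i * v $ i)"
proof -
  define c where "c J i = (if i \<in> J then axis i 1 + u $ i *s v else axis i 1)" for J i
  \<comment> \<open>Once row \<open>k\<close> is \<open>v\<close>, adding multiples of
    \<open>v\<close> to the other rows leaves the determinant unchanged.\<close>
  have A: "det (\<chi> i. if i = k then v else c J i) = v $ k" if "finite J" "k \<notin> J" for J k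
    using that
  proof (induction J)
    case empty
    then show ?case by (simp add: c_def det_update_identity_row cong: if_cong)
  next
    case (insert j J)
    have "(\<chi> i. if i = k then v else c (insert j J) i) =
       (\<chi> i. if i = j then axis j 1 + u $ j *s v else (if i = k then v else c J i))"
      using insert by (auto simp: c_def vec_eq_iff)
    also have "det \<dots> = det (\<chi> i. if i = j then axis j 1 else (if i = k then v else c J i)) +
       det (\<chi> i. if i = j then u $ j *s v else (if i = k then v else c J i))"
      by (rule det_row_add)
    also have "det (\<chi> i. if i = j then u $ j *s v else (if i = k then v else c J i)) =
       u $ j * det (\<chi> i. if i = j then v else (if i = k then v else c J i))"
      by (rule det_row_mul)
    also have "det (\<chi> i. if i = j then v else (if i = k then v else c J i)) = 0"
      using insert by (intro det_identical_rows[of j k]) (auto simp: row_def vec_eq_iff)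
    also have "(\<chi> i. if i = j then axis j 1 else (if i = k then v else c J i)) =
        (\<chi> i. if i = k then v else c J i)"
      using insert by (auto simp: c_def vec_eq_iff)
    finally show ?case using insert by simp
  qed
  have B: "det (\<chi> i. c J i) = 1 + (\<Sum>i\<in>J. u $ i * v $ i)" if "finite J" for J
    using that
  proof (induction J)
    case empty
    have "(\<chi> i. c {} i) = mat 1"
      by (auto simp: c_def vec_eq_iff mat_def axis_def)
    then show ?case by simp
  next
    case (insert k J)
    have "(\<chi> i. c (insert k J) i) = (\<chi> i. if i = k then axis k 1 + u $ k *s v else c J i)"
      using insert by (auto simp: c_def vec_eq_iff)
    also have "det \<dots> = det (\<chi> i. if i = k then axis k 1 else c J i) +
       det (\<chi> i. if i = k then u $ k *s v else c J i)"
      by (rule det_row_add)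
    also have "det (\<chi> i. if i = k then u $ k *s v else c J i) =
       u $ k * det (\<chi> i. if i = k then v else c J i)"
      by (rule det_row_mul)
    also have "(\<chi> i. if i = k then axis k 1 else c J i) = (\<chi> i. c J i)"
      using insert by (auto simp: c_def vec_eq_iff)
    finally show ?case using insert A by simp
  qed
  have "mat 1 + outer u v = (\<chi> i. c UNIV i)"
    by (auto simp: c_def vec_eq_iff mat_def axis_def outer_def)
  with B[of UNIV] show ?thesis by simp
qed

section \<open>Factorization of positive semidefinite matrices\<close>

lemma quad_axis: "quad K (axis k 1) = Re (K $ k $ k)"
  and herm_axis: "herm (axis k 1) v = v $ k"
  for K :: "complex ^ 'n ^ 'n"
proof -
  show *: "herm (axis k 1) v = v $ k" for v :: "complex ^ 'n"
    by (simp add: herm_def axis_def if_distrib if_distribR cong: if_cong)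
  have "(K *v axis k 1) $ k = K $ k $ k"
    by (simp add: matrix_vector_mult_def axis_def if_distrib cong: if_cong)
  then show "quad K (axis k 1) = Re (K $ k $ k)"
    by (simp add: quad_def *)
qed

text \<open>Cholesky elimination. \<open>I\<close> holds the pivots still to be treated; rows
  outside it are already zero. A positive pivot splits off one rank-one term and leaves a Schur
  complement, while a zero pivot forces its whole row to vanish.\<close>

lemma hermitian_psd_factor_columns:
  fixes K :: "complex ^ 'n ^ 'n"
  assumes "finite I" "hermitian_psd K" "\<And>i j. i \<notin> I \<Longrightarrow> K $ i $ j = 0"
  shows "\<exists>c :: 'n \<Rightarrow> complex ^ 'n. \<forall>a b. K $ a $ b = (\<Sum>i\<in>I. c i $ a * cnj (c i $ b) :: complex)"
  using assms
proof (induction I arbitrary: K)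
  case empty
  then show ?case by simp
next
  case (insert k I)
  have herm: "K\<^sup>\<dagger> = K" and psd: "0 \<le> quad K v" for v
    using insert.prems by (auto simp: hermitian_psd_iff_quad)
  have cn: "cnj (K $ i $ j) = K $ j $ i" for i j
    using herm by (metis (no_types, lifting) conjugate_transpose_def vec_lambda_beta)
  have Kkk: "K $ k $ k = of_real (Re (K $ k $ k))"
    by (metis cn complex_is_Real_iff cnj.sel(2) equal_neg_zero of_real_Re)
  have Re0: "0 \<le> Re (K $ k $ k)"
    using psd[of "axis k 1"] by (simp add: quad_axis)
  show ?case
  proof (cases "Re (K $ k $ k) = 0")
    case True
    have row0: "K $ k $ j = 0" for j
    proof (rule ccontr)
      assume nz: "K $ k $ j \<noteq> 0"
      define r where "r = quad K (axis j 1)"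
      \<comment> \<open>With a zero pivot the form is affine in \<open>s\<close>: its value is
        \<open>r\<close> plus \<open>2 * s\<close> times the squared modulus of
        \<open>K $ k $ j\<close>. This \<open>s\<close> makes it -1.\<close>
      define s where "s = - (r + 1) / (2 * (cmod (K $ k $ j))\<^sup>2)"
      have Kj: "(K *v axis j 1) $ k = K $ k $ j"
        by (simp add: matrix_vector_mult_def axis_def if_distrib cong: if_cong)
      have "quad K (axis j 1 + (of_real s * K $ k $ j) *s axis k 1) =
        r + 2 * Re (cnj (of_real s * K $ k $ j) * K $ k $ j)"
        by (simp add: quad_expand[OF herm] quad_axis True herm_axis Kj r_def)
      also have "cnj (of_real s * K $ k $ j) * K $ k $ j = of_real (s * (cmod (K $ k $ j))\<^sup>2)"
        by (simp add: complex_norm_square[unfolded of_real_power] mult_ac)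
      also have "r + 2 * Re (complex_of_real (s * (cmod (K $ k $ j))\<^sup>2)) = -1"
        using nz by (simp add: s_def field_simps del: of_real_power)
      finally show False using psd by (metis neg_0_le_iff_le not_one_le_zero)
    qed
    then have "K $ i $ j = 0" if "i \<notin> I" for i j
      using insert.prems(2)[of i j] that by (cases "i = k") auto
    with insert.IH[of K] insert.prems obtain c where
      c: "\<forall>a b. K $ a $ b = (\<Sum>i\<in>I. c i $ a * cnj (c i $ b))" by blast
    show ?thesis
      using insert.hyps
      by (intro exI[of _ "c(k := 0)"] allI) (auto simp: c intro!: sum.cong)
  next
    case False
    then have pos: "0 < Re (K $ k $ k)" using Re0 by simp
    define \<kappa> where "\<kappa> = Re (K $ k $ k)"
    define col where "col = (\<chi> a. K $ a $ k / of_real (sqrt \<kappa>))"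
    \<comment> \<open>The Schur complement of the pivot; \<open>col\<close> is the Cholesky
      column.\<close>
    define K' where "K' = K - outer col (cvec col)"
    have sq: "complex_of_real (sqrt \<kappa>) * complex_of_real (sqrt \<kappa>) = of_real \<kappa>"
      using pos by (simp add: \<kappa>_def flip: of_real_mult)
    have K'_entry: "K' $ a $ b = K $ a $ b - K $ a $ k * K $ k $ b / of_real \<kappa>" for a b
      by (simp add: K'_def col_def outer_def cvec_def cn sq)
    have 1: "K'\<^sup>\<dagger> = K'"
      by (simp add: K'_def conjugate_transpose_diff conjugate_transpose_outer herm)
    have 2: "0 \<le> quad K' v" for v
    proof -
      define \<beta> where "\<beta> = (K *v v) $ k"
      \<comment> \<open>The minimizer of \<open>quad K\<close> on the line through \<open>v\<close>
        along \<open>axis k 1\<close>. The minimum is \<open>quad K' v\<close>, which is therefore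
        nonnegative.\<close>
      define t where "t = - \<beta> / of_real \<kappa>"
      have "herm v (outer col (cvec col) *v v) = herm v col * herm col v"
        unfolding sum_distrib_right herm_def
        by (simp add: outer_def cvec_def matrix_vector_mult_def sum_distrib_left mult_ac)
      moreover have "herm col v = \<beta> / of_real (sqrt \<kappa>)"
        by (simp add: herm_def col_def \<beta>_def matrix_vector_mult_def cn sum_divide_distrib)
      ultimately have "herm v (outer col (cvec col) *v v) = cnj \<beta> * \<beta> / of_real \<kappa>"
        by (subst (asm) herm_commute[of v]) (simp add: sq)
      also have "\<dots> = of_real ((cmod \<beta>)\<^sup>2 / \<kappa>)"
        by (metis complex_norm_square mult.commute of_real_divide of_real_power)
      finally have a: "quad K' v = quad K v - (cmod \<beta>)\<^sup>2 / \<kappa>"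
        by (simp add: quad_def K'_def matrix_vector_mult_diff_rdistrib herm_diff_right del: of_real_power)
      have "cnj t * \<beta> = - (cnj \<beta> * \<beta>) / of_real \<kappa>" by (simp add: t_def)
      also have "\<dots> = of_real (- (cmod \<beta>)\<^sup>2 / \<kappa>)"
        by (metis complex_norm_square mult.commute of_real_divide of_real_minus of_real_power)
      finally have b: "Re (cnj t * \<beta>) = - (cmod \<beta>)\<^sup>2 / \<kappa>"
        by (metis Re_complex_of_real)
      have "(cmod t)\<^sup>2 * \<kappa> = (cmod \<beta>)\<^sup>2 / \<kappa>"
        using pos by (simp add: t_def norm_divide power_divide \<kappa>_def power2_eq_square)
      then have "quad K (v + t *s axis k 1) = quad K v - (cmod \<beta>)\<^sup>2 / \<kappa>"
        unfolding quad_expand[OF herm] herm_axis quad_axis \<beta>_def[symmetric] \<kappa>_def[symmetric] b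
        by simp
      then show ?thesis using a psd by metis
    qed
    have 3: "K' $ i $ j = 0" if "i \<notin> I" for i j
    proof (cases "i = k")
      case True
      have "of_real \<kappa> = K $ k $ k" using Kkk by (simp add: \<kappa>_def)
      then show ?thesis using True pos Kkk by (auto simp: K'_entry \<kappa>_def)
    next
      case False
      then have "K $ i $ j = 0" "K $ i $ k = 0" using that insert.prems(2) by auto
      then show ?thesis by (simp add: K'_entry)
    qed
    from insert.IH[of K'] 1 2 3 obtain c where
      c: "\<forall>a b. K' $ a $ b = (\<Sum>i\<in>I. c i $ a * cnj (c i $ b))"
      by (auto simp: hermitian_psd_iff_quad)
    have "K $ a $ b = col $ a * cnj (col $ b) + K' $ a $ b" for a b
      by (simp add: K'_def outer_def cvec_def)
    then show ?thesis
      using insert.hyps c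
      by (intro exI[of _ "c(k := col)"] allI) (auto intro!: sum.cong)
  qed
qed

lemma hermitian_psd_factor:
  assumes "hermitian_psd (K :: complex ^ 'n ^ 'n)"
  shows "\<exists>A :: complex ^ 'n ^ 'n. A ** A\<^sup>\<dagger> = K"
proof -
  obtain c :: "'n \<Rightarrow> complex ^ 'n" where "\<forall>a b. K $ a $ b = (\<Sum>i\<in>UNIV. c i $ a * cnj (c i $ b))"
    using hermitian_psd_factor_columns[OF finite[of "UNIV :: 'n set"] assms] by blast
  then show ?thesis
    by (intro exI[of _ "\<chi> a i. c i $ a"])
      (simp add: matrix_matrix_mult_def conjugate_transpose_def vec_eq_iff)
qed

section \<open>Gaussian integrals\<close>

definition complex_normal :: "complex measure" where
  "complex_normal = density lborel (\<lambda>t. ennreal (exp (- (cmod t)\<^sup>2) / pi))"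

lemma sets_complex_normal[simp, measurable_cong]: "sets complex_normal = sets borel"
  and space_complex_normal[simp]: "space complex_normal = UNIV"
  by (simp_all add: complex_normal_def)

text \<open>The real basis of the plane consists of 1 and the imaginary unit, so Lebesgue measure
  factors over real and imaginary parts; \<open>h\<close> assigns the two factors to the two basis
  vectors.\<close>

lemma nn_integral_complex_prod:
  fixes f g :: "real \<Rightarrow> real"
  assumes [measurable]: "f \<in> borel_measurable borel" "g \<in> borel_measurable borel"
    and nn: "\<And>x. 0 \<le> f x" "\<And>x. 0 \<le> g x"
  shows "(\<integral>\<^sup>+ t. ennreal (f (Re t) * g (Im t)) \<partial>lborel) =
    (\<integral>\<^sup>+ x. ennreal (f x) \<partial>lborel) * (\<integral>\<^sup>+ x. ennreal (g x) \<partial>lborel)"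
proof -
  define h :: "complex \<Rightarrow> real \<Rightarrow> ennreal" where "h b x = (if b = 1 then ennreal (f x) else ennreal (g x))" for b x
  have ne: "\<i> \<noteq> 1" "1 \<noteq> \<i>" by (auto simp: complex_eq_iff)
  have "(\<integral>\<^sup>+ t. ennreal (f (Re t) * g (Im t)) \<partial>lborel) = (\<integral>\<^sup>+ t. (\<Prod>b\<in>Basis. h b (t \<bullet> b)) \<partial>lborel)"
    by (intro nn_integral_cong) (simp add: Basis_complex_def h_def inner_complex_def ne ennreal_mult nn)
  also have "\<dots> = (\<Prod>b\<in>Basis. \<integral>\<^sup>+ x. h b x \<partial>lborel)"
    by (rule nn_integral_lborel_prod) (auto simp: h_def[abs_def])
  finally show ?thesis
    by (simp add: Basis_complex_def h_def ne)
qed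

lemma exp_square_eq_normal_density:
  assumes "s > 0"
  shows "exp (- s * (x - a)\<^sup>2) = sqrt (pi / s) * normal_density a (sqrt (1 / (2 * s))) x"
proof -
  have "2 * pi * (sqrt (1 / (2 * s)))\<^sup>2 = pi / s" "2 * (sqrt (1 / (2 * s)))\<^sup>2 = 1 / s"
    using assms by (simp_all add: real_sqrt_pow2)
  then show ?thesis
    using assms by (simp add: normal_density_def)
qed

lemma nn_integral_exp_square:
  assumes "s > 0"
  shows "(\<integral>\<^sup>+ x. ennreal (exp (- s * (x - a)\<^sup>2)) \<partial>lborel) = ennreal (sqrt (pi / s))"
  unfolding exp_square_eq_normal_density[OF assms]
  using assms by (subst nn_integral_eq_integral) auto

lemma nn_integral_exp_cmod_square:
  assumes "s > 0"
  shows "(\<integral>\<^sup>+ t. ennreal (exp (- s * (cmod (t - a))\<^sup>2)) \<partial>lborel) = ennreal (pi / s)"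
proof -
  have "exp (- s * (cmod (t - a))\<^sup>2) = exp (- s * (Re t - Re a)\<^sup>2) * exp (- s * (Im t - Im a)\<^sup>2)" for t
    by (simp add: cmod_def real_sqrt_pow2 distrib_left flip: exp_add)
  then have "(\<integral>\<^sup>+ t. ennreal (exp (- s * (cmod (t - a))\<^sup>2)) \<partial>lborel) =
     ennreal (sqrt (pi / s)) * ennreal (sqrt (pi / s))"
    using nn_integral_complex_prod[of "\<lambda>x. exp (- s * (x - Re a)\<^sup>2)" "\<lambda>x. exp (- s * (x - Im a)\<^sup>2)"]
    by (simp add: nn_integral_exp_square[OF assms, simplified])
  also have "\<dots> = ennreal (pi / s)"
    using assms by (simp flip: ennreal_mult)
  finally show ?thesis .
qed

lemma prob_space_complex_normal: "prob_space complex_normal"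
proof
  have "(\<integral>\<^sup>+ t. ennreal (exp (- (cmod t)\<^sup>2) / pi) \<partial>lborel) =
      (\<integral>\<^sup>+ t. ennreal (1 / pi) * ennreal (exp (- 1 * (cmod (t - 0))\<^sup>2)) \<partial>lborel)"
    by (intro nn_integral_cong) (simp flip: ennreal_mult)
  also have "\<dots> = ennreal (1 / pi) * ennreal (pi / 1)"
    by (subst nn_integral_cmult) (simp_all only: nn_integral_exp_cmod_square zero_less_one, measurable)
  also have "\<dots> = 1" by (simp flip: ennreal_mult)
  finally show "emeasure complex_normal (space complex_normal) = 1"
    by (simp add: complex_normal_def emeasure_density)
qed

interpretation complex_normal: prob_space complex_normal
  by (rule prob_space_complex_normal)

lemma nn_integral_complex_normal_square: "(\<integral>\<^sup>+ t. ennreal ((cmod t)\<^sup>2) \<partial>complex_normal) = 1"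
proof -
  \<comment> \<open>The normal density of variance 1/2, which is
    \<open>exp (- x * x) / sqrt pi\<close>. The real and the imaginary part each contribute this 1/2
    to the second moment.\<close>
  define n where "n = normal_density 0 (sqrt (1 / 2))"
  have [measurable]: "n \<in> borel_measurable borel" by (simp add: n_def)
  have nn: "0 \<le> n x" for x by (simp add: n_def)
  have n: "exp (- x\<^sup>2) = sqrt pi * n x" for x
    using exp_square_eq_normal_density[of 1 x 0] by (simp add: n_def)
  have e: "exp (- (cmod t)\<^sup>2) / pi = n (Re t) * n (Im t)" for t
  proof -
    have "exp (- (cmod t)\<^sup>2) = exp (- (Re t)\<^sup>2) * exp (- (Im t)\<^sup>2)"
      by (simp add: cmod_power2 flip: exp_add)
    also have "\<dots> = sqrt pi * sqrt pi * (n (Re t) * n (Im t))"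
      by (simp only: n mult_ac)
    finally show ?thesis by simp
  qed
  have 0: "(\<integral>\<^sup>+ x. ennreal (n x) \<partial>lborel) = 1"
    unfolding n_def by (subst nn_integral_eq_integral) auto
  have hbi: "has_bochner_integral lborel (\<lambda>x. n x * x\<^sup>2) (1 / 2)"
    using normal_moment_even[of "sqrt (1 / 2)" 0 1] by (simp add: n_def)
  have 2: "(\<integral>\<^sup>+ x. ennreal (n x * x\<^sup>2) \<partial>lborel) = ennreal (1 / 2)"
  proof -
    have "integrable lborel (\<lambda>x. n x * x\<^sup>2)" "(\<integral>x. n x * x\<^sup>2 \<partial>lborel) = 1 / 2"
      using hbi by (simp_all only: has_bochner_integral_iff)
    moreover have "(\<integral>\<^sup>+ x. ennreal (n x * x\<^sup>2) \<partial>lborel) = ennreal (\<integral>x. n x * x\<^sup>2 \<partial>lborel)"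
      using calculation(1) by (intro nn_integral_eq_integral) (auto simp: nn)
    ultimately show ?thesis by (simp only:)
  qed
  have "(\<integral>\<^sup>+ t. ennreal ((cmod t)\<^sup>2) \<partial>complex_normal) =
     (\<integral>\<^sup>+ t. ennreal (n (Re t) * n (Im t)) * ennreal ((cmod t)\<^sup>2) \<partial>lborel)"
    unfolding complex_normal_def by (subst nn_integral_density) (auto simp: e)
  also have "\<dots> = (\<integral>\<^sup>+ t. ennreal (n (Re t) * (Re t)\<^sup>2 * n (Im t)) + ennreal (n (Re t) * (n (Im t) * (Im t)\<^sup>2)) \<partial>lborel)"
    by (intro nn_integral_cong)
      (simp add: nn cmod_def real_sqrt_pow2 algebra_simps flip: ennreal_mult ennreal_plus)
  also have "\<dots> = ennreal (1 / 2) + ennreal (1 / 2)"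
    using nn_integral_complex_prod[of "\<lambda>x. n x * x\<^sup>2" n] nn_integral_complex_prod[of n "\<lambda>x. n x * x\<^sup>2"]
    by (subst nn_integral_add) (auto simp: nn 0 2)
  also have "\<dots> = 1" by (subst ennreal_plus[symmetric]) simp_all
  finally show ?thesis .
qed

lemma complex_normal_moments:
  shows integrable_complex_normal_square: "integrable complex_normal (\<lambda>t. t * cnj t)"
    and integral_complex_normal_square: "(\<integral>t. t * cnj t \<partial>complex_normal) = 1"
    and integrable_complex_normal: "integrable complex_normal (\<lambda>t. t)"
    and integral_complex_normal: "(\<integral>t. t \<partial>complex_normal) = 0"
proof -
  have [measurable]: "(\<lambda>t. (cmod t)\<^sup>2) \<in> borel_measurable complex_normal" by measurable
  have i: "integrable complex_normal (\<lambda>t. (cmod t)\<^sup>2)"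
    by (rule integrableI_nonneg) (auto simp: nn_integral_complex_normal_square)
  have v: "(\<integral>t. (cmod t)\<^sup>2 \<partial>complex_normal) = 1"
    by (subst integral_eq_nn_integral) (auto simp: nn_integral_complex_normal_square)
  have eq: "(\<lambda>t. t * cnj t) = (\<lambda>t. of_real ((cmod t)\<^sup>2))"
    by (simp only: complex_norm_square)
  show "integrable complex_normal (\<lambda>t. t * cnj t)"
    unfolding eq by (rule integrable_of_real[OF i])
  show "(\<integral>t. t * cnj t \<partial>complex_normal) = 1"
    unfolding eq by (subst integral_of_real) (use i v in auto)
  have "cmod t \<le> 1 + (cmod t)\<^sup>2" for t
    by (smt (verit) one_le_power power2_eq_square mult_left_le_one_le norm_ge_zero self_le_power zero_le_power2 pos2)
  then show int: "integrable complex_normal (\<lambda>t. t)"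
    by (intro Bochner_Integration.integrable_bound[of complex_normal "\<lambda>t. 1 + (cmod t)\<^sup>2" "\<lambda>t. t"])
      (auto intro!: i Bochner_Integration.integrable_add complex_normal.integrable_const
        simp: add_nonneg_nonneg abs_of_nonneg)
  \<comment> \<open>Lebesgue measure and the density are invariant under negation, so the mean
    equals its own negative.\<close>
  have L: "lborel = distr lborel borel (\<lambda>x::complex. - x)"
    using lborel_affine[of "-1" "0::complex"] by (simp add: density_1)
  have "complex_normal = distr complex_normal borel uminus"
  proof -
    have "distr complex_normal borel uminus = density (distr lborel borel uminus) (\<lambda>t. ennreal (exp (- (cmod t)\<^sup>2) / pi))"
      unfolding complex_normal_def by (subst density_distr) auto
    then show ?thesis using L by (simp add: complex_normal_def)
  qed
  then have "(\<integral>t. t \<partial>complex_normal) = (\<integral>t. t \<partial>distr complex_normal borel uminus)" by simp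
  also have "\<dots> = (\<integral>t. - t \<partial>complex_normal)"
    by (rule integral_distr) measurable
  finally show "(\<integral>t. t \<partial>complex_normal) = 0" by simp
qed

section \<open>Measurability of vector and matrix operations\<close>

lemma borel_measurable_vec_nth[measurable (raw)]:
  fixes f :: "'w \<Rightarrow> 'b::real_normed_vector ^ 'n"
  assumes [measurable]: "f \<in> borel_measurable M"
  shows "(\<lambda>x. f x $ i) \<in> borel_measurable M"
proof -
  have "continuous_on UNIV (\<lambda>v::'b ^ 'n. v $ i)" by (intro continuous_intros)
  then have [measurable]: "(\<lambda>v::'b ^ 'n. v $ i) \<in> borel_measurable borel"
    by (rule borel_measurable_continuous_onI)
  show ?thesis by measurable
qed

lemma borel_measurable_cnj[measurable (raw)]:
  "f \<in> borel_measurable M \<Longrightarrow> (\<lambda>x. cnj (f x)) \<in> borel_measurable M"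
  by (rule borel_measurable_continuous_on[of cnj, OF continuous_on_cnj[OF continuous_on_id]])

lemma borel_measurable_vec_lambda[measurable (raw)]:
  fixes f :: "'w \<Rightarrow> 'n::finite \<Rightarrow> 'b::euclidean_space"
  assumes [measurable]: "\<And>i. (\<lambda>x. f x i) \<in> borel_measurable M"
  shows "(\<lambda>x. \<chi> i. f x i) \<in> borel_measurable M"
proof -
  have "(\<lambda>x. \<Sum>i\<in>UNIV. axis i (f x i)) \<in> borel_measurable M"
  proof (intro borel_measurable_sum)
    fix i :: 'n
    have "linear (\<lambda>x::'b. axis i x :: 'b ^ 'n)"
      by (intro linearI) (auto simp: axis_def vec_eq_iff)
    then have "continuous_on UNIV (\<lambda>x::'b. axis i x :: 'b ^ 'n)"
      by (intro linear_continuous_on) (simp add: linear_conv_bounded_linear)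
    then have [measurable]: "(\<lambda>x::'b. axis i x :: 'b ^ 'n) \<in> borel_measurable borel"
      by (rule borel_measurable_continuous_onI)
    show "(\<lambda>x. axis i (f x i) :: 'b ^ 'n) \<in> borel_measurable M"
      by measurable
  qed
  moreover have "(\<Sum>i\<in>UNIV. axis i (f x i) :: 'b ^ 'n) = (\<chi> i. f x i)" for x
    by (auto simp: vec_eq_iff axis_def)
  ultimately show ?thesis by simp
qed

lemma borel_measurable_matrix_vector_mult[measurable (raw)]:
  fixes f :: "'w \<Rightarrow> complex ^ 'n ^ 'm"
  assumes [measurable]: "f \<in> borel_measurable M" "g \<in> borel_measurable M"
  shows "(\<lambda>x. f x *v g x) \<in> borel_measurable M"
  unfolding matrix_vector_mult_def by measurable

lemma borel_measurable_vector_scalar_mult[measurable (raw)]: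
  fixes f :: "'w \<Rightarrow> complex"
  assumes [measurable]: "f \<in> borel_measurable M" "g \<in> borel_measurable M"
  shows "(\<lambda>x. f x *s g x) \<in> borel_measurable M"
  unfolding vector_scalar_mult_def by measurable

lemma borel_measurable_quad[measurable (raw)]:
  assumes [measurable]: "f \<in> borel_measurable M"
  shows "(\<lambda>x. quad R (f x)) \<in> borel_measurable M"
  unfolding quad_def herm_def by measurable

section \<open>The standard Gaussian vector as a vector of independent coordinates\<close>

lemma measurable_vec_lambda:
  "(\<lambda>f. \<chi> i. f i) \<in> measurable (Pi\<^sub>M (UNIV :: 'n::finite set) (\<lambda>_. borel :: complex measure)) borel"
  by measurable

text \<open>Lebesgue measure is determined by boxes. The canonical basis of
  \<open>complex ^ 'n\<close> consists of the vectors \<open>axis i b\<close>, so both membership in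
  a box and its volume split over the coordinates.\<close>

lemma lborel_vec_eq_PiM:
  "(lborel :: (complex ^ 'n) measure) = distr (Pi\<^sub>M UNIV (\<lambda>_. lborel)) borel (\<lambda>f. \<chi> i. f i)"
proof (rule lborel_eqI)
  interpret product_sigma_finite "\<lambda>_::'n. lborel :: complex measure" ..
  have [measurable]: "(\<lambda>f. \<chi> i. f i) \<in> measurable (Pi\<^sub>M (UNIV :: 'n set) (\<lambda>_. lborel :: complex measure)) borel"
    using measurable_vec_lambda by (simp cong: measurable_cong_sets sets_PiM_cong)
  fix l u :: "complex ^ 'n"
  assume le: "\<And>b. b \<in> Basis \<Longrightarrow> l \<bullet> b \<le> u \<bullet> b"
  have B: "axis i b \<in> Basis" if "b \<in> Basis" for i and b :: complex
    using that by (auto simp: Basis_vec_def)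
  have box: "x \<in> box l u \<longleftrightarrow> (\<forall>i. x $ i \<in> box (l $ i) (u $ i))" for x
    unfolding mem_box by (auto simp: Basis_vec_def inner_axis)
  have inj: "inj_on (\<lambda>(i, b). axis i b :: complex ^ 'n) (UNIV \<times> Basis)"
    by (auto simp: inj_on_def axis_eq_axis nonzero_Basis)
  have Bs: "(Basis :: (complex ^ 'n) set) = (\<lambda>(i, b). axis i b) ` (UNIV \<times> Basis)"
    by (auto simp: Basis_vec_def)
  have "emeasure (distr (Pi\<^sub>M UNIV (\<lambda>_. lborel)) borel (\<lambda>f. \<chi> i. f i)) (box l u) =
    emeasure (Pi\<^sub>M UNIV (\<lambda>_. lborel)) (Pi\<^sub>E UNIV (\<lambda>i. box (l $ i) (u $ i)))"
    by (subst emeasure_distr) (auto intro!: arg_cong2[where f=emeasure] simp: box space_PiM PiE_def Pi_def)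
  also have "\<dots> = (\<Prod>i\<in>UNIV. emeasure lborel (box (l $ i) (u $ i)))"
    by (rule emeasure_PiM) (auto simp: finite_UNIV)
  also have "\<dots> = (\<Prod>i\<in>UNIV. ennreal (\<Prod>b\<in>Basis. (u $ i - l $ i) \<bullet> b))"
    using le[OF B] by (intro prod.cong refl emeasure_lborel_box) (simp add: inner_axis)
  also have "\<dots> = ennreal (\<Prod>i\<in>UNIV. \<Prod>b\<in>Basis. (u $ i - l $ i) \<bullet> b)"
    using le[OF B] by (intro prod_ennreal prod_nonneg) (auto simp add: inner_axis inner_diff_left)
  also have "(\<Prod>i\<in>UNIV. \<Prod>b\<in>Basis. (u $ i - l $ i) \<bullet> b) = (\<Prod>b\<in>Basis. (u - l) \<bullet> b)"
    unfolding Bs prod.reindex[OF inj] by (simp add: prod.cartesian_product split_def inner_axis)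
  finally show "emeasure (distr (Pi\<^sub>M UNIV (\<lambda>_. lborel)) borel (\<lambda>f. \<chi> i. f i)) (box l u) = (\<Prod>b\<in>Basis. (u - l) \<bullet> b)" .
qed simp

text \<open>The squared norm is a sum over coordinates, so the density is a product. Independence of
  the coordinates then yields the moments and lets Gaussian integrals be done one coordinate at a
  time.\<close>

lemma standard_complex_gaussian_eq_PiM:
  "(standard_complex_gaussian :: (complex ^ 'n) measure) =
     distr (Pi\<^sub>M UNIV (\<lambda>_. complex_normal)) borel (\<lambda>f. \<chi> i. f i)"
proof -
  interpret L: product_sigma_finite "\<lambda>_::'n. lborel :: complex measure" ..
  interpret N: product_sigma_finite "\<lambda>_::'n. complex_normal" ..
  have [measurable]: "(\<lambda>f. \<chi> i. f i) \<in> measurable (Pi\<^sub>M (UNIV :: 'n set) (\<lambda>_. lborel :: complex measure)) borel"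
    using measurable_vec_lambda by (simp cong: measurable_cong_sets sets_PiM_cong)
  define e where "e t = ennreal (exp (- (cmod t)\<^sup>2) / pi)" for t
  have [measurable]: "e \<in> borel_measurable borel" by (simp add: e_def[abs_def])
  have prod: "ennreal (exp (- (norm w)\<^sup>2) / pi ^ CARD('n)) = (\<Prod>i\<in>UNIV. e (w $ i))" for w :: "complex ^ 'n"
    by (simp add: norm_vec_sq e_def prod_ennreal prod_dividef exp_sum flip: sum_negf)
  have "density (Pi\<^sub>M UNIV (\<lambda>_::'n. lborel)) (\<lambda>f. \<Prod>i\<in>UNIV. e (f i)) = Pi\<^sub>M UNIV (\<lambda>_. complex_normal)"
  proof (rule N.PiM_eqI)
    show "sets (density (Pi\<^sub>M UNIV (\<lambda>_. lborel)) (\<lambda>f. \<Prod>i\<in>UNIV. e (f i))) = sets (Pi\<^sub>M UNIV (\<lambda>_::'n. complex_normal))"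
      by (simp cong: sets_PiM_cong)
  next
    fix A :: "'n \<Rightarrow> complex set" assume A: "\<And>i. i \<in> UNIV \<Longrightarrow> A i \<in> sets complex_normal"
    then have A'[measurable]: "A i \<in> sets borel" for i by simp
    have "emeasure (density (Pi\<^sub>M UNIV (\<lambda>_. lborel)) (\<lambda>f. \<Prod>i\<in>UNIV. e (f i))) (Pi\<^sub>E UNIV A) =
       (\<integral>\<^sup>+ f. (\<Prod>i\<in>UNIV. e (f i)) * indicator (Pi\<^sub>E UNIV A) f \<partial>Pi\<^sub>M UNIV (\<lambda>_. lborel))"
      by (subst emeasure_density) (auto intro!: sets_PiM_I_finite)
    also have "\<dots> = (\<integral>\<^sup>+ f. (\<Prod>i\<in>UNIV. e (f i) * indicator (A i) (f i)) \<partial>Pi\<^sub>M UNIV (\<lambda>_. lborel))"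
      by (intro nn_integral_cong) (auto simp: prod.distrib indicator_def PiE_def Pi_def)
    also have "\<dots> = (\<Prod>i\<in>UNIV. \<integral>\<^sup>+ t. e t * indicator (A i) t \<partial>lborel)"
      by (rule L.product_nn_integral_prod) auto
    also have "\<dots> = (\<Prod>i\<in>UNIV. emeasure complex_normal (A i))"
      by (simp add: complex_normal_def e_def emeasure_density)
    finally show "emeasure (density (Pi\<^sub>M UNIV (\<lambda>_. lborel)) (\<lambda>f. \<Prod>i\<in>UNIV. e (f i))) (Pi\<^sub>E UNIV A) =
      (\<Prod>i\<in>UNIV. emeasure complex_normal (A i))" .
  qed simp
  then show ?thesis
    unfolding standard_complex_gaussian_def prod lborel_vec_eq_PiM
    by (subst density_distr) (simp_all add: density_distr)
qed

lemma sets_standard_complex_gaussian[simp, measurable_cong]: "sets standard_complex_gaussian = sets borel"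
  and space_standard_complex_gaussian[simp]: "space standard_complex_gaussian = UNIV"
  by (simp_all add: standard_complex_gaussian_def)

lemma prob_space_standard_complex_gaussian: "prob_space (standard_complex_gaussian :: (complex ^ 'n) measure)"
proof -
  interpret product_prob_space "\<lambda>_::'n. complex_normal" UNIV ..
  have [measurable]: "(\<lambda>f. \<chi> i. f i) \<in> measurable (Pi\<^sub>M (UNIV :: 'n set) (\<lambda>_. complex_normal)) borel"
    using measurable_vec_lambda by (simp cong: measurable_cong_sets sets_PiM_cong)
  show ?thesis
    unfolding standard_complex_gaussian_eq_PiM by (rule P.prob_space_distr) measurable
qed

interpretation standard_complex_gaussian: prob_space "standard_complex_gaussian :: (complex ^ 'n) measure"
  by (rule prob_space_standard_complex_gaussian)

lemma standard_complex_gaussian_moments: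
  fixes i j :: "'n::finite"
  shows integrable_standard_complex_gaussian: "integrable standard_complex_gaussian (\<lambda>w. w $ i)"
    and integral_standard_complex_gaussian: "(\<integral>w. w $ i \<partial>standard_complex_gaussian) = 0"
    and integrable_standard_complex_gaussian_mult: "integrable standard_complex_gaussian (\<lambda>w. w $ i * cnj (w $ j))"
    and integral_standard_complex_gaussian_mult:
      "(\<integral>w. w $ i * cnj (w $ j) \<partial>standard_complex_gaussian) = of_bool (i = j)"
proof -
  interpret N: product_sigma_finite "\<lambda>_::'n. complex_normal" ..
  note C = complex_normal_moments
  have [measurable]: "(\<lambda>f. \<chi> i. f i) \<in> measurable (Pi\<^sub>M (UNIV :: 'n set) (\<lambda>_. complex_normal)) borel"
    using measurable_vec_lambda by (simp cong: measurable_cong_sets sets_PiM_cong)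
  have C': "integrable complex_normal cnj" "(\<integral>t. cnj t \<partial>complex_normal) = 0"
    using C by (auto simp: integrable_cnj)
  have one: "complex_normal.prob UNIV = 1"
    using complex_normal.prob_space by simp
  \<comment> \<open>\<open>f\<close> and \<open>g\<close> equal 1 at every coordinate not involved,
    so that their products over all coordinates are \<open>x i\<close> and
    \<open>x i * cnj (x j)\<close> and the integral of a product over independent coordinates
    applies. In \<open>g\<close> the only nontrivial factor has mean 1 if \<open>i = j\<close>;
    otherwise two factors of mean 0 occur.\<close>
  define f where "f k t = (if k = i then t else 1)" for k and t :: complex
  define g where "g k t = (if k = i then t else 1) * (if k = j then cnj t else 1)" for k and t :: complex
  have f: "integrable complex_normal (f k)" "(\<integral>t. f k t \<partial>complex_normal) = (if k = i then 0 else 1)" for k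
    using C one by (cases "k = i"; simp add: f_def[abs_def])+
  have g: "integrable complex_normal (g k)"
    "(\<integral>t. g k t \<partial>complex_normal) = (if k = i \<and> i \<noteq> j \<or> k = j \<and> i \<noteq> j then 0 else 1)" for k
    using C C' one by (cases "k = i"; cases "k = j"; simp add: g_def[abs_def])+
  have fp: "(\<Prod>k\<in>UNIV. f k (x k)) = x i" for x
    by (simp add: f_def)
  have gp: "(\<Prod>k\<in>UNIV. g k (x k)) = x i * cnj (x j)" for x
    by (simp add: g_def prod.distrib)
  have fI: "integrable (Pi\<^sub>M UNIV (\<lambda>_. complex_normal)) (\<lambda>x. x i)"
    "(\<integral>x. x i \<partial>Pi\<^sub>M UNIV (\<lambda>_. complex_normal)) = 0"
    using N.product_integrable_prod[of UNIV f] N.product_integral_prod[of UNIV f] f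
    by (simp_all add: fp prod_zero_iff)
  have gI: "integrable (Pi\<^sub>M UNIV (\<lambda>_. complex_normal)) (\<lambda>x. x i * cnj (x j))"
    "(\<integral>x. x i * cnj (x j) \<partial>Pi\<^sub>M UNIV (\<lambda>_. complex_normal)) = of_bool (i = j)"
    using N.product_integrable_prod[of UNIV g] N.product_integral_prod[of UNIV g] g
    by (auto simp: gp intro!: prod_zero)
  show "integrable standard_complex_gaussian (\<lambda>w. w $ i)"
    "(\<integral>w. w $ i \<partial>standard_complex_gaussian) = 0"
    "integrable standard_complex_gaussian (\<lambda>w. w $ i * cnj (w $ j))"
    "(\<integral>w. w $ i * cnj (w $ j) \<partial>standard_complex_gaussian) = of_bool (i = j)"
    unfolding standard_complex_gaussian_eq_PiM
    using fI gI by (subst integrable_distr_eq integral_distr; simp)+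
qed

section \<open>The output density of a Gaussian input\<close>

definition gaussian_density :: "complex ^ 'n \<Rightarrow> real" where
  "gaussian_density w = exp (- (norm w)\<^sup>2) / pi ^ CARD('n)"

lemma gaussian_density_pos: "0 < gaussian_density w"
  by (simp add: gaussian_density_def)

lemma gaussian_density_nonneg[simp]: "0 \<le> gaussian_density w"
  by (simp add: gaussian_density_def)

lemma borel_measurable_gaussian_density[measurable]: "gaussian_density \<in> borel_measurable borel"
  by (simp add: gaussian_density_def[abs_def])

lemma standard_complex_gaussian_density:
  "standard_complex_gaussian = density lborel (\<lambda>w. ennreal (gaussian_density w))"
  by (simp add: standard_complex_gaussian_def gaussian_density_def)

lemma outer_mult_vec: "outer u v *v w = herm (cvec v) w *s u"
  by (simp add: outer_def cvec_def herm_def matrix_vector_mult_def vec_eq_iff sum_distrib_left sum_distrib_right mult_ac)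

lemma mult_outer: "A ** outer u v = outer (A *v u) v"
  by (simp add: outer_def matrix_vector_mult_def matrix_matrix_mult_def vec_eq_iff sum_distrib_left mult_ac)

lemma outer_mult: "outer u v ** A = outer u (transpose A *v v)"
  by (simp add: outer_def matrix_vector_mult_def matrix_matrix_mult_def transpose_def vec_eq_iff sum_distrib_left mult_ac)

lemma matrix_diff_rdistrib: "(A - B) ** C = A ** C - B ** (C :: complex ^ 'k ^ 'n)"
  by (simp add: matrix_matrix_mult_def vec_eq_iff left_diff_distrib sum_subtractf)

text \<open>The induction adds one rank-one term to the covariance; the Sherman--Morrison formula and the
  matrix determinant lemma describe the effect on its inverse and determinant.\<close>

lemma gaussian_superposition:
  fixes c :: "'n::finite \<Rightarrow> complex ^ 'm"
  assumes "finite I"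
  shows "\<exists>R \<delta>. R\<^sup>\<dagger> = R \<and> (\<forall>v. 0 \<le> quad R v) \<and>
    R ** (mat 1 + (\<Sum>i\<in>I. outer (c i) (cvec (c i)))) = mat 1 \<and>
    det (mat 1 + (\<Sum>i\<in>I. outer (c i) (cvec (c i)))) = complex_of_real \<delta> \<and> 0 < \<delta> \<and>
    (\<forall>y. (\<integral>\<^sup>+ f. ennreal (gaussian_density (y - (\<Sum>i\<in>I. f i *s c i))) \<partial>Pi\<^sub>M I (\<lambda>_. complex_normal)) =
      ennreal (exp (- quad R y) / (pi ^ CARD('m) * \<delta>)))"
  using assms
proof (induction I)
  case empty
  have "quad (mat 1) v = (norm v)\<^sup>2" for v :: "complex ^ 'm"
    by (simp add: quad_def herm_self del: of_real_power)
  moreover have "(\<integral>\<^sup>+ f. ennreal (gaussian_density y) \<partial>Pi\<^sub>M {} (\<lambda>_::'n. complex_normal)) =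
      ennreal (gaussian_density y)" for y :: "complex ^ 'm"
  proof -
    interpret product_prob_space "\<lambda>_::'n. complex_normal" "{}" ..
    show ?thesis by (simp add: P.emeasure_space_1)
  qed
  ultimately show ?case
    by (intro exI[of _ "mat 1"] exI[of _ 1])
      (auto simp: conjugate_transpose_mat gaussian_density_def)
next
  case (insert k I)
  define S where "S = mat 1 + (\<Sum>i\<in>I. outer (c i) (cvec (c i)))"
  from insert.IH obtain R \<delta> where
    RH: "R\<^sup>\<dagger> = R" and psd: "\<And>v. 0 \<le> quad R v" and RS: "R ** S = mat 1" and
    detS: "det S = of_real \<delta>" and pos: "0 < \<delta>" and
    IH: "\<And>y. (\<integral>\<^sup>+ f. ennreal (gaussian_density (y - (\<Sum>i\<in>I. f i *s c i))) \<partial>Pi\<^sub>M I (\<lambda>_. complex_normal)) =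
      ennreal (exp (- quad R y) / (pi ^ CARD('m) * \<delta>))"
    unfolding S_def by blast
  interpret N: product_sigma_finite "\<lambda>_::'n. complex_normal" ..
  \<comment> \<open>One number in three roles: the Sherman--Morrison denominator, the factor by
    which the determinant grows, and the coefficient of the new variable's square in the
    exponent.\<close>
  define s where "s = 1 + quad R (c k)"
  have s: "0 < s" using psd[of "c k"] by (simp add: s_def)
  define r where "r = R *v c k"
  define R' where "R' = R - outer (of_real (1 / s) *s r) (cvec r)"
  define S' where "S' = S + outer (c k) (cvec (c k))"
  have SH: "S\<^sup>\<dagger> = S"
  proof -
    have "(\<Sum>i\<in>I. outer (c i) (cvec (c i)))\<^sup>\<dagger> = (\<Sum>i\<in>I. outer (c i) (cvec (c i)))"
      by (simp add: conjugate_transpose_def vec_eq_iff outer_def cvec_def mult.commute)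
    then show ?thesis by (simp add: S_def conjugate_transpose_add conjugate_transpose_mat)
  qed
  have SR: "S ** R = mat 1"
    using RS by (rule matrix_left_right_inverse[THEN iffD1])
  have S': "mat 1 + (\<Sum>i\<in>insert k I. outer (c i) (cvec (c i))) = S'"
    using insert.hyps by (simp add: S'_def S_def add_ac)
  have herm_cr: "herm (c k) r = of_real (s - 1)"
  proof -
    have "cnj (herm (c k) r) = herm (c k) r"
      by (metis RH herm_adjoint herm_commute r_def)
    then have "herm (c k) r \<in> \<real>" by (simp add: Reals_cnj_iff)
    moreover have "Re (herm (c k) r) = s - 1" by (simp add: s_def quad_def r_def)
    ultimately show ?thesis by (metis of_real_Re)
  qed
  have herm_r: "herm r y = herm (c k) (R *v y)" for y
    by (simp add: r_def herm_adjoint RH)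
  have 1: "R'\<^sup>\<dagger> = R'"
    by (simp add: R'_def conjugate_transpose_diff RH)
      (simp add: conjugate_transpose_def outer_def cvec_def vec_eq_iff)
  have quadR': "quad R' y = quad R y - (cmod (herm (c k) (R *v y)))\<^sup>2 / s" for y
  proof -
    have "herm y (outer (of_real (1 / s) *s r) (cvec r) *v y) = of_real (1 / s) * (herm r y * herm y r)"
      by (simp add: outer_mult_vec herm_scale_right)
    also have "herm r y * herm y r = of_real ((cmod (herm r y))\<^sup>2)"
      by (metis complex_norm_square herm_commute)
    finally show ?thesis
      by (simp add: quad_def R'_def matrix_vector_mult_diff_rdistrib herm_diff_right herm_r del: of_real_power)
  qed
  \<comment> \<open>Completing the square in the new coordinate \<open>t\<close>. What remains at
    the minimizing \<open>t\<close> is the form of the Sherman--Morrison inverse \<open>R'\<close>,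
    which is therefore positive semidefinite.\<close>
  have key: "(cmod t)\<^sup>2 + quad R (y - t *s c k) =
      s * (cmod (t - herm (c k) (R *v y) / of_real s))\<^sup>2 + quad R' y" for t y
  proof -
    define \<beta> where "\<beta> = herm (c k) (R *v y)"
    have "y - t *s c k = y + (- t) *s c k" by (simp add: vec_eq_iff)
    then have "quad R (y - t *s c k) = quad R y - 2 * Re (cnj t * \<beta>) + (cmod t)\<^sup>2 * quad R (c k)"
      unfolding \<beta>_def by (simp only: quad_expand[OF RH]) simp
    moreover have "s * (cmod (t - \<beta> / of_real s))\<^sup>2 = s * (cmod t)\<^sup>2 - 2 * Re (cnj t * \<beta>) + (cmod \<beta>)\<^sup>2 / s"
    proof -
      have "s * (cmod (t - \<beta> / of_real s))\<^sup>2 = s * ((Re t - Re \<beta> / s)\<^sup>2 + (Im t - Im \<beta> / s)\<^sup>2)"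
        by (simp add: cmod_power2)
      also have "\<dots> = s * (Re t)\<^sup>2 + s * (Im t)\<^sup>2 - 2 * (Re t * Re \<beta> + Im t * Im \<beta>) + ((Re \<beta>)\<^sup>2 + (Im \<beta>)\<^sup>2) / s"
        using s by (simp add: field_simps power2_eq_square)
      finally show ?thesis by (simp add: cmod_power2 algebra_simps)
    qed
    ultimately show ?thesis
      by (simp add: quadR' \<beta>_def s_def algebra_simps)
  qed
  have 2: "0 \<le> quad R' y" for y
    using key[of "herm (c k) (R *v y) / of_real s" y] psd
    by (metis add.left_neutral add_nonneg_nonneg cancel_comm_monoid_add_class.diff_cancel mult_zero_right
        norm_zero power_zero_numeral zero_le_power2)
  have 3: "R' ** S' = mat 1"
  proof -
    have a: "R ** outer (c k) (cvec (c k)) = outer r (cvec (c k))"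
      by (simp add: mult_outer r_def)
    \<comment> \<open>Right multiplication acts on the second factor of \<open>outer\<close> through
      the transpose of \<open>S\<close>, which for Hermitian \<open>S\<close> is the entrywise
      conjugate.\<close>
    have tr: "transpose S *v cvec r = cvec (c k)"
    proof -
      have "S *v r = c k" by (simp add: r_def matrix_vector_mul_assoc SR)
      moreover have "transpose S *v cvec r = cvec (S *v r)"
        by (subst (1) SH[symmetric])
          (simp add: transpose_def conjugate_transpose_def cvec_def matrix_vector_mult_def)
      ultimately show ?thesis by simp
    qed
    have b: "outer (of_real (1 / s) *s r) (cvec r) ** S = outer (of_real (1 / s) *s r) (cvec (c k))"
      unfolding outer_mult tr ..
    have "outer (of_real (1 / s) *s r) (cvec r) *v c k = (herm r (c k) / of_real s) *s r"
      by (simp add: outer_mult_vec vec_eq_iff)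
    also have "herm r (c k) = of_real (s - 1)"
      unfolding herm_r using herm_cr by (simp only: r_def)
    finally have d: "outer (of_real (1 / s) *s r) (cvec r) ** outer (c k) (cvec (c k)) =
        outer ((of_real (s - 1) / of_real s) *s r) (cvec (c k))"
      by (simp add: mult_outer)
    have "R' ** S' = R ** S + R ** outer (c k) (cvec (c k)) - outer (of_real (1 / s) *s r) (cvec r) ** S
        - outer (of_real (1 / s) *s r) (cvec r) ** outer (c k) (cvec (c k))"
      by (simp add: R'_def S'_def matrix_diff_rdistrib matrix_add_ldistrib)
    also have "\<dots> = mat 1"
      unfolding RS a b d using s by (simp add: vec_eq_iff outer_def field_simps)
    finally show ?thesis .
  qed
  have 4: "det S' = of_real (\<delta> * s)"
  proof -
    have "S ** (mat 1 + outer r (cvec (c k))) = S'"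
      by (simp add: S'_def matrix_add_ldistrib mult_outer r_def matrix_vector_mul_assoc SR)
    then have "det S' = det S * (1 + (\<Sum>i\<in>UNIV. r $ i * cvec (c k) $ i))"
      by (metis det_identity_plus_outer det_mul)
    also have "(\<Sum>i\<in>UNIV. r $ i * cvec (c k) $ i) = herm (c k) r"
      by (simp add: herm_def cvec_def mult.commute)
    finally show ?thesis by (simp add: herm_cr detS)
  qed
  have 5: "(\<integral>\<^sup>+ f. ennreal (gaussian_density (y - (\<Sum>i\<in>insert k I. f i *s c i))) \<partial>Pi\<^sub>M (insert k I) (\<lambda>_. complex_normal)) =
      ennreal (exp (- quad R' y) / (pi ^ CARD('m) * (\<delta> * s)))" for y
  proof -
    define \<beta> where "\<beta> = herm (c k) (R *v y) / of_real s"
    have "(\<integral>\<^sup>+ f. ennreal (gaussian_density (y - (\<Sum>i\<in>insert k I. f i *s c i))) \<partial>Pi\<^sub>M (insert k I) (\<lambda>_. complex_normal)) =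
      (\<integral>\<^sup>+ t. \<integral>\<^sup>+ f. ennreal (gaussian_density (y - (\<Sum>i\<in>insert k I. (f(k := t)) i *s c i))) \<partial>Pi\<^sub>M I (\<lambda>_. complex_normal) \<partial>complex_normal)"
      using insert.hyps by (intro N.product_nn_integral_insert_rev) measurable
    also have "\<dots> = (\<integral>\<^sup>+ t. \<integral>\<^sup>+ f. ennreal (gaussian_density ((y - t *s c k) - (\<Sum>i\<in>I. f i *s c i))) \<partial>Pi\<^sub>M I (\<lambda>_. complex_normal) \<partial>complex_normal)"
    proof (intro nn_integral_cong arg_cong[where f=ennreal] arg_cong[where f=gaussian_density])
      fix t f
      have "(\<Sum>i\<in>I. (f(k := t)) i *s c i) = (\<Sum>i\<in>I. f i *s c i)"
        using insert.hyps by (intro sum.cong) auto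
      then show "y - (\<Sum>i\<in>insert k I. (f(k := t)) i *s c i) = y - t *s c k - (\<Sum>i\<in>I. f i *s c i)"
        using insert.hyps by (simp add: algebra_simps)
    qed
    also have "\<dots> = (\<integral>\<^sup>+ t. ennreal (exp (- quad R (y - t *s c k)) / (pi ^ CARD('m) * \<delta>)) \<partial>complex_normal)"
      by (simp add: IH)
    also have "\<dots> = (\<integral>\<^sup>+ t. ennreal (exp (- (cmod t)\<^sup>2) / pi) * ennreal (exp (- quad R (y - t *s c k)) / (pi ^ CARD('m) * \<delta>)) \<partial>lborel)"
      unfolding complex_normal_def by (rule nn_integral_density) measurable
    also have "\<dots> = (\<integral>\<^sup>+ t. ennreal (exp (- quad R' y) / (pi * (pi ^ CARD('m) * \<delta>))) *
         ennreal (exp (- s * (cmod (t - \<beta>))\<^sup>2)) \<partial>lborel)"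
    proof (intro nn_integral_cong)
      fix t
      have "exp (- (cmod t)\<^sup>2) * exp (- quad R (y - t *s c k)) = exp (- quad R' y) * exp (- s * (cmod (t - \<beta>))\<^sup>2)"
        using key[of t y] by (simp add: \<beta>_def flip: exp_add)
      then have "(exp (- (cmod t)\<^sup>2) / pi) * (exp (- quad R (y - t *s c k)) / (pi ^ CARD('m) * \<delta>)) =
         (exp (- quad R' y) / (pi * (pi ^ CARD('m) * \<delta>))) * exp (- s * (cmod (t - \<beta>))\<^sup>2)"
        by (metis (no_types, lifting) times_divide_times_eq times_divide_eq_left)
      then show "ennreal (exp (- (cmod t)\<^sup>2) / pi) * ennreal (exp (- quad R (y - t *s c k)) / (pi ^ CARD('m) * \<delta>)) =
          ennreal (exp (- quad R' y) / (pi * (pi ^ CARD('m) * \<delta>))) * ennreal (exp (- s * (cmod (t - \<beta>))\<^sup>2))"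
        using pos by (simp flip: ennreal_mult)
    qed
    \<comment> \<open>The factor \<open>pi\<close> from this integral cancels the normalization of
      \<open>complex_normal\<close>, so the power of \<open>pi\<close> remains that of the noise,
      while \<delta> picks up the factor \<open>s\<close>.\<close>
    also have "\<dots> = ennreal (exp (- quad R' y) / (pi * (pi ^ CARD('m) * \<delta>))) * ennreal (pi / s)"
      by (subst nn_integral_cmult) (measurable, simp only: nn_integral_exp_cmod_square[OF s])
    also have "\<dots> = ennreal (exp (- quad R' y) / (pi ^ CARD('m) * (\<delta> * s)))"
      using pos s by (simp flip: ennreal_mult)
    finally show ?thesis .
  qed
  show ?case
    unfolding S' using 1 2 3 4 5 pos s
    by (intro exI[of _ R'] exI[of _ "\<delta> * s"]) simp
qed

lemma some_hermitian_psd_factor: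
  assumes "hermitian_psd K"
  shows "(SOME A :: complex ^ 'n ^ 'n. A ** A\<^sup>\<dagger> = K) ** (SOME A. A ** A\<^sup>\<dagger> = K)\<^sup>\<dagger> = K"
  using hermitian_psd_factor[OF assms] by (rule someI_ex)

lemma sets_complex_gaussian[simp, measurable_cong]: "sets (complex_gaussian K) = sets borel"
  and space_complex_gaussian[simp]: "space (complex_gaussian K) = UNIV"
  by (simp_all add: complex_gaussian_def)

lemma prob_space_complex_gaussian: "prob_space (complex_gaussian K)"
  unfolding complex_gaussian_def by (rule standard_complex_gaussian.prob_space_distr) measurable

text \<open>The output is the noise plus independent complex normals times the columns of
  \<open>A ** B\<close>, whose rank-one terms add up to \<open>A ** K ** A\<^sup>\<dagger>\<close>.
  The integral over \<open>x\<close> is the output density at \<open>y\<close>; a singular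
  \<open>K\<close> causes no degeneracy, since the noise contributes the identity.\<close>

lemma complex_gaussian_output_density:
  fixes K :: "complex ^ 'n ^ 'n" and A :: "complex ^ 'n ^ 'm"
  assumes "hermitian_psd K"
  shows "\<exists>R. R\<^sup>\<dagger> = R \<and> R ** (mat 1 + A ** K ** A\<^sup>\<dagger>) = mat 1 \<and> 0 < gram_det K A \<and>
    (\<forall>y. (\<integral>\<^sup>+ x. ennreal (gaussian_density (y - A *v x)) \<partial>complex_gaussian K) =
      ennreal (exp (- quad R y) / (pi ^ CARD('m) * gram_det K A)))"
proof -
  define B where "B = (SOME A :: complex ^ 'n ^ 'n. A ** A\<^sup>\<dagger> = K)"
  have B: "B ** B\<^sup>\<dagger> = K"
    using some_hermitian_psd_factor[OF assms] by (simp add: B_def)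
  define c where "c = (\<lambda>i. column i (A ** B))"
  have "(\<Sum>i\<in>UNIV. outer (c i) (cvec (c i))) = (A ** B) ** (A ** B)\<^sup>\<dagger>"
    by (simp add: vec_eq_iff outer_def cvec_def c_def column_def matrix_matrix_mult_def[of "A ** B"] conjugate_transpose_def)
  also have "\<dots> = A ** K ** A\<^sup>\<dagger>"
    by (simp add: conjugate_transpose_mult matrix_mul_assoc flip: B)
  finally have S: "(\<Sum>i\<in>UNIV. outer (c i) (cvec (c i))) = A ** K ** A\<^sup>\<dagger>" .
  obtain R \<delta> where R: "R\<^sup>\<dagger> = R" "R ** (mat 1 + A ** K ** A\<^sup>\<dagger>) = mat 1"
    "det (mat 1 + A ** K ** A\<^sup>\<dagger>) = of_real \<delta>" "0 < \<delta>" and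
    I: "\<And>y. (\<integral>\<^sup>+ f. ennreal (gaussian_density (y - (\<Sum>i\<in>UNIV. f i *s c i))) \<partial>Pi\<^sub>M UNIV (\<lambda>_. complex_normal)) =
      ennreal (exp (- quad R y) / (pi ^ CARD('m) * \<delta>))"
    using gaussian_superposition[of UNIV c] unfolding S by auto
  have [measurable]: "(\<lambda>f. \<chi> i. f i) \<in> measurable (Pi\<^sub>M (UNIV :: 'n set) (\<lambda>_. complex_normal)) borel"
    by measurable
  have \<delta>: "gram_det K A = \<delta>"
    by (simp add: gram_det_def R)
  have "(\<integral>\<^sup>+ x. ennreal (gaussian_density (y - A *v x)) \<partial>complex_gaussian K) =
     (\<integral>\<^sup>+ f. ennreal (gaussian_density (y - A *v (B *v (\<chi> i. f i)))) \<partial>Pi\<^sub>M UNIV (\<lambda>_. complex_normal))" for y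
    unfolding complex_gaussian_def B_def[symmetric] standard_complex_gaussian_eq_PiM
    by (simp add: nn_integral_distr)
  moreover have "A *v (B *v (\<chi> i. f i)) = (\<Sum>i\<in>UNIV. f i *s c i)" for f
    by (simp add: matrix_vector_mul_assoc c_def) (simp add: matrix_vector_mult_def column_def vec_eq_iff mult.commute)
  ultimately show ?thesis
    using R I by (intro exI[of _ R]) (simp add: \<delta>)
qed

section \<open>Second moments under linear maps\<close>

lemma integral_quad:
  fixes Q :: "'x measure" and v :: "'x \<Rightarrow> complex ^ 'n"
  assumes int: "\<And>a b. integrable Q (\<lambda>x. v x $ a * cnj (v x $ b))"
    and V: "\<And>a b. (\<integral>x. v x $ a * cnj (v x $ b) \<partial>Q) = V $ a $ b"
  shows "integrable Q (\<lambda>x. quad R (v x))" "(\<integral>x. quad R (v x) \<partial>Q) = Re (trace (R ** V))"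
proof -
  have *: "quad R (v x) = Re (\<Sum>a\<in>UNIV. \<Sum>b\<in>UNIV. R $ a $ b * (v x $ b * cnj (v x $ a)))" for x
    by (simp add: quad_def herm_def matrix_vector_mult_def sum_distrib_left mult_ac)
  have i: "integrable Q (\<lambda>x. \<Sum>a\<in>UNIV. \<Sum>b\<in>UNIV. R $ a $ b * (v x $ b * cnj (v x $ a)))"
    by (intro Bochner_Integration.integrable_sum integrable_mult_right int)
  then show "integrable Q (\<lambda>x. quad R (v x))"
    unfolding * by (rule integrable_Re)
  have "(\<integral>x. quad R (v x) \<partial>Q) = Re (\<integral>x. (\<Sum>a\<in>UNIV. \<Sum>b\<in>UNIV. R $ a $ b * (v x $ b * cnj (v x $ a))) \<partial>Q)"
    unfolding * using i by (rule integral_Re)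
  also have "(\<integral>x. (\<Sum>a\<in>UNIV. \<Sum>b\<in>UNIV. R $ a $ b * (v x $ b * cnj (v x $ a))) \<partial>Q) =
      (\<Sum>a\<in>UNIV. \<Sum>b\<in>UNIV. R $ a $ b * V $ b $ a)"
    by (simp add: Bochner_Integration.integral_sum Bochner_Integration.integrable_sum int V)
  finally show "(\<integral>x. quad R (v x) \<partial>Q) = Re (trace (R ** V))"
    by (simp add: trace_def matrix_matrix_mult_def)
qed

lemma moments_linear_image:
  fixes v :: "'x \<Rightarrow> complex ^ 'n" and A :: "complex ^ 'n ^ 'm"
  assumes int: "\<And>a b. integrable Q (\<lambda>x. v x $ a * cnj (v x $ b))"
    and V: "\<And>a b. (\<integral>x. v x $ a * cnj (v x $ b) \<partial>Q) = V $ a $ b"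
  shows "integrable Q (\<lambda>x. (A *v v x) $ i * cnj ((A *v v x) $ j))"
    and "(\<integral>x. (A *v v x) $ i * cnj ((A *v v x) $ j) \<partial>Q) = (A ** V ** A\<^sup>\<dagger>) $ i $ j"
proof -
  have *: "(A *v v x) $ i * cnj ((A *v v x) $ j) =
     (\<Sum>l\<in>UNIV. \<Sum>k\<in>UNIV. (A $ i $ k * cnj (A $ j $ l)) * (v x $ k * cnj (v x $ l)))" for x
    by (subst sum.swap) (simp add: matrix_vector_mult_def sum_product mult_ac)
  show "integrable Q (\<lambda>x. (A *v v x) $ i * cnj ((A *v v x) $ j))"
    unfolding * by (intro Bochner_Integration.integrable_sum integrable_mult_right int)
  show "(\<integral>x. (A *v v x) $ i * cnj ((A *v v x) $ j) \<partial>Q) = (A ** V ** A\<^sup>\<dagger>) $ i $ j"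
    unfolding * by (simp add: Bochner_Integration.integral_sum Bochner_Integration.integrable_sum int V)
      (simp add: matrix_matrix_mult_def conjugate_transpose_def sum_distrib_left mult_ac)
qed

lemma complex_gaussian_moments:
  fixes K :: "complex ^ 'n ^ 'n"
  assumes "hermitian_psd K"
  shows integral_complex_gaussian: "(\<integral>x. x $ i \<partial>complex_gaussian K) = 0"
    and integrable_complex_gaussian_mult: "integrable (complex_gaussian K) (\<lambda>x. x $ i * cnj (x $ j))"
    and integral_complex_gaussian_mult: "(\<integral>x. x $ i * cnj (x $ j) \<partial>complex_gaussian K) = K $ i $ j"
proof -
  define B where "B = (SOME A :: complex ^ 'n ^ 'n. A ** A\<^sup>\<dagger> = K)"
  have B: "B ** B\<^sup>\<dagger> = K"
    using some_hermitian_psd_factor[OF assms] by (simp add: B_def)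
  have V: "(\<integral>w. w $ a * cnj (w $ b) \<partial>standard_complex_gaussian) = (mat 1 :: complex ^ 'n ^ 'n) $ a $ b" for a b :: 'n
    by (simp add: integral_standard_complex_gaussian_mult mat_def)
  note M = moments_linear_image[where Q=standard_complex_gaussian and v="\<lambda>w. w",
      OF integrable_standard_complex_gaussian_mult V, of B]
  show "(\<integral>x. x $ i \<partial>complex_gaussian K) = 0"
    unfolding complex_gaussian_def B_def[symmetric]
    by (subst integral_distr) (simp_all add: matrix_vector_mult_def standard_complex_gaussian_moments)
  show "integrable (complex_gaussian K) (\<lambda>x. x $ i * cnj (x $ j))"
    unfolding complex_gaussian_def B_def[symmetric]
    by (subst integrable_distr_eq) (simp_all add: M)
  show "(\<integral>x. x $ i * cnj (x $ j) \<partial>complex_gaussian K) = K $ i $ j"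
    unfolding complex_gaussian_def B_def[symmetric]
    by (subst integral_distr) (simp_all add: M B)
qed

section \<open>Relative entropy\<close>

text \<open>The summand \<open>- a + b\<close> integrates to \<open>0\<close> for densities and makes the term nonnegative. Divergences are
  then nonnegative integrals, and the identities between them need no integrability conditions.\<close>

definition kl_term :: "real \<Rightarrow> real \<Rightarrow> real" where
  "kl_term a b = (a * ln (a / b) - a + b) / ln 2"

lemma borel_measurable_kl_term[measurable (raw)]:
  assumes [measurable]: "f \<in> borel_measurable M" "g \<in> borel_measurable M"
  shows "(\<lambda>x. kl_term (f x) (g x)) \<in> borel_measurable M"
  unfolding kl_term_def by measurable

lemma kl_term_nonneg:
  assumes "0 < a" "0 < b" shows "0 \<le> kl_term a b"
proof -
  have "a * ln (b / a) \<le> a * (b / a - 1)"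
    using assms by (intro mult_left_mono ln_le_minus_one) auto
  moreover have "ln (b / a) = - ln (a / b)" using assms by (simp add: ln_div)
  moreover have "a * (b / a - 1) = b - a" using assms by (simp add: field_simps)
  ultimately have "0 \<le> a * ln (a / b) - a + b" by simp
  then show ?thesis unfolding kl_term_def by simp
qed

lemma kl_term_self[simp]: "0 < a \<Longrightarrow> kl_term a a = 0"
  by (simp add: kl_term_def)

lemma kl_term_scale: "0 < g \<Longrightarrow> g * kl_term (f / g) 1 = kl_term f g"
  by (simp add: kl_term_def field_simps)

text \<open>Changing the reference from \<open>m\<close> to \<open>b\<close> adds a term affine in
  \<open>a\<close>, whose mean depends on the mean of \<open>a\<close> alone. This is the source of
  the compensation identity.\<close>

lemma kl_term_shift:
  assumes "0 < a" "0 < m" "0 < b"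
  shows "kl_term a b = kl_term a m + (a * ln (m / b) + b - m) / ln 2"
  using assms by (simp add: kl_term_def ln_div field_simps)

text \<open>The chi-square bound on relative entropy. For a bounded first argument and a fixed
  second one it bounds the term itself, which supplies the integrability in the next proof.\<close>

lemma kl_term_le_square:
  assumes "0 < a" "0 < b" shows "kl_term a b \<le> (a - b)\<^sup>2 / b / ln 2"
proof -
  have "a * ln (a / b) \<le> a * (a / b - 1)"
    using assms by (intro mult_left_mono ln_le_minus_one) auto
  also have "a * (a / b - 1) = (a - b)\<^sup>2 / b + a - b"
    using assms by (simp add: field_simps power2_eq_square)
  finally show ?thesis unfolding kl_term_def by (intro divide_right_mono) auto
qed

text \<open>With \<open>m\<close> the mean of \<open>X\<close>, the affine correction in
  \<open>kl_term_shift\<close> integrates to \<open>kl_term m b\<close>. The bound \<open>c\<close>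
  makes all integrals finite, so the identity is proved for real integrals and then read in
  \<open>ennreal\<close>.\<close>

lemma nn_integral_kl_term_mean:
  fixes X :: "'u \<Rightarrow> real"
  assumes "prob_space \<mu>" and X[measurable]: "X \<in> borel_measurable \<mu>"
    and pos: "\<And>u. u \<in> space \<mu> \<Longrightarrow> 0 < X u" and le: "\<And>u. u \<in> space \<mu> \<Longrightarrow> X u \<le> c"
    and m: "(\<integral>u. X u \<partial>\<mu>) = m" "0 < m" and b: "0 < b"
  shows "(\<integral>\<^sup>+ u. ennreal (kl_term (X u) b) \<partial>\<mu>) = (\<integral>\<^sup>+ u. ennreal (kl_term (X u) m) \<partial>\<mu>) + ennreal (kl_term m b)"
proof -
  interpret prob_space \<mu> by fact
  have iX: "integrable \<mu> X"
    by (rule integrable_const_bound[where B=c]) (use pos le in \<open>auto intro!: AE_I2 simp: less_imp_le abs_of_pos\<close>)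
  have "norm (kl_term (X u) m) \<le> (c + m)\<^sup>2 / m / ln 2" if "u \<in> space \<mu>" for u
  proof -
    have "\<bar>X u - m\<bar> \<le> c + m" using pos[OF that] le[OF that] m by auto
    then have "(X u - m)\<^sup>2 \<le> (c + m)\<^sup>2"
      using abs_le_square_iff by fastforce
    then have "(X u - m)\<^sup>2 / m / ln 2 \<le> (c + m)\<^sup>2 / m / ln 2"
      using m by (intro divide_right_mono) auto
    with kl_term_le_square[OF pos[OF that] m(2)] kl_term_nonneg[OF pos[OF that] m(2)] show ?thesis by simp
  qed
  then have i: "integrable \<mu> (\<lambda>u. kl_term (X u) m)"
    by (intro integrable_const_bound[where B="(c + m)\<^sup>2 / m / ln 2"] AE_I2) auto
  have lin: "integrable \<mu> (\<lambda>u. (X u * ln (m / b) + b - m) / ln 2)"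
    using iX by simp
  have e: "kl_term (X u) b = kl_term (X u) m + (X u * ln (m / b) + b - m) / ln 2" if "u \<in> space \<mu>" for u
    using kl_term_shift pos[OF that] m b by blast
  have ib: "integrable \<mu> (\<lambda>u. kl_term (X u) b)"
    using Bochner_Integration.integrable_add[OF i lin] e by (simp cong: Bochner_Integration.integrable_cong)
  have "(\<integral>u. kl_term (X u) b \<partial>\<mu>) = (\<integral>u. kl_term (X u) m + (X u * ln (m / b) + b - m) / ln 2 \<partial>\<mu>)"
    by (rule Bochner_Integration.integral_cong) (use e in auto)
  also have "\<dots> = (\<integral>u. kl_term (X u) m \<partial>\<mu>) + (\<integral>u. (X u * ln (m / b) + b - m) / ln 2 \<partial>\<mu>)"
    by (rule Bochner_Integration.integral_add[OF i lin])
  also have "(\<integral>u. (X u * ln (m / b) + b - m) / ln 2 \<partial>\<mu>) = (m * ln (m / b) + b - m) / ln 2"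
    using iX m by (simp add: prob_space)
  finally have "(\<integral>u. kl_term (X u) b \<partial>\<mu>) = (\<integral>u. kl_term (X u) m \<partial>\<mu>) + kl_term m b"
    by (simp add: kl_term_def)
  moreover have "(\<integral>\<^sup>+ u. ennreal (kl_term (X u) b) \<partial>\<mu>) = ennreal (\<integral>u. kl_term (X u) b \<partial>\<mu>)"
    using ib b pos by (intro nn_integral_eq_integral AE_I2 kl_term_nonneg) auto
  moreover have "(\<integral>\<^sup>+ u. ennreal (kl_term (X u) m) \<partial>\<mu>) = ennreal (\<integral>u. kl_term (X u) m \<partial>\<mu>)"
    using i m pos by (intro nn_integral_eq_integral AE_I2 kl_term_nonneg) auto
  moreover have "0 \<le> (\<integral>u. kl_term (X u) m \<partial>\<mu>)"
    using m pos by (intro integral_nonneg_AE AE_I2 kl_term_nonneg) auto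
  ultimately show ?thesis
    using kl_term_nonneg[OF m(2) b] by simp
qed

lemma e2ennreal_ereal: "e2ennreal (ereal r) = ennreal r"
  by (simp add: ennreal.abs_eq e2ennreal_def ennreal_def)

text \<open>Both \<open>r\<close> and 1 integrate to 1, so adding \<open>1 - r\<close> to
  \<open>r * ln r\<close> does not change the integral. It makes the integrand nonnegative, and the
  divergence becomes one integral in \<open>ennreal\<close>, possibly infinite.\<close>

lemma extended_KL_divergence_density:
  fixes r :: "'x \<Rightarrow> real"
  assumes "prob_space P" and r[measurable]: "r \<in> borel_measurable P"
    and pos: "\<And>x. x \<in> space P \<Longrightarrow> 0 < r x" and one: "(\<integral>\<^sup>+ x. ennreal (r x) \<partial>P) = 1"
  shows "extended_KL_divergence 2 P (density P (\<lambda>x. ennreal (r x))) =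
    enn2ereal (\<integral>\<^sup>+ x. ennreal (kl_term (r x) 1) \<partial>P)"
proof -
  interpret prob_space P by fact
  define J where "J = density P (\<lambda>x. ennreal (r x))"
  have ac: "absolutely_continuous P J"
    unfolding J_def by (rule absolutely_continuousI_density) measurable
  have "AE x in P. RN_deriv P J x = ennreal (r x)"
    unfolding J_def by (rule AE_symmetric, rule RN_deriv_unique) auto
  then have AE: "AE x in J. entropy_density 2 P J x = log 2 (r x)"
    unfolding J_def by (subst AE_density) (auto simp: entropy_density_def less_imp_le pos)
  define a where "a = (\<integral>\<^sup>+ x. ennreal (r x * log 2 (r x)) \<partial>P)"
  define b where "b = (\<integral>\<^sup>+ x. ennreal (- (r x * log 2 (r x))) \<partial>P)"
  define D where "D = (\<integral>\<^sup>+ x. ennreal (kl_term (r x) 1) \<partial>P)"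
  \<comment> \<open>Used with \<open>s\<close> equal to 1 and to -1, for the positive and the
    negative part of the integrand.\<close>
  have I: "(\<integral>\<^sup>+ x. e2ennreal (ereal (s * entropy_density 2 P J x)) \<partial>J) =
      (\<integral>\<^sup>+ x. ennreal (s * (r x * log 2 (r x))) \<partial>P)" for s :: real
  proof -
    have "(\<integral>\<^sup>+ x. e2ennreal (ereal (s * entropy_density 2 P J x)) \<partial>J) = (\<integral>\<^sup>+ x. ennreal (s * log 2 (r x)) \<partial>J)"
      using AE by (intro nn_integral_cong_AE) (auto simp: e2ennreal_ereal)
    also have "\<dots> = (\<integral>\<^sup>+ x. ennreal (r x) * ennreal (s * log 2 (r x)) \<partial>P)"
      unfolding J_def by (rule nn_integral_density) measurable
    also have "\<dots> = (\<integral>\<^sup>+ x. ennreal (s * (r x * log 2 (r x))) \<partial>P)"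
      using pos by (intro nn_integral_cong) (auto simp: less_imp_le mult_ac simp flip: ennreal_mult')
    finally show ?thesis .
  qed
  have lhs: "extended_KL_divergence 2 P J = enn2ereal a - enn2ereal b"
    using ac I[of 1] I[of "-1"] by (simp add: extended_KL_divergence_def extended_expectation_def a_def b_def)
  \<comment> \<open>The negative part of \<open>t * log 2 t\<close> is bounded. Hence the difference
    of the two parts is meaningful even if the divergence is infinite.\<close>
  have bnd: "- (t * log 2 t) \<le> 1 / ln 2" if "0 < t" for t :: real
  proof -
    have "0 \<le> kl_term t 1" using that by (simp add: kl_term_nonneg)
    then have "- (t * ln t) \<le> 1 - t"
      using that by (simp add: kl_term_def zero_le_divide_iff)
    then have "- (t * ln t) \<le> 1" using that by simp
    then have "- (t * ln t) / ln 2 \<le> 1 / ln 2" by (intro divide_right_mono) auto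
    then show ?thesis by (simp add: log_def)
  qed
  have "b \<le> (\<integral>\<^sup>+ x. ennreal (1 / ln 2) \<partial>P)"
    unfolding b_def using bnd pos by (intro nn_integral_mono ennreal_leI) auto
  also have "\<dots> = ennreal (1 / ln 2)" by (simp add: emeasure_space_1)
  finally have b: "b < \<infinity>" by (rule le_less_trans) simp
  \<comment> \<open>The relation between \<open>kl_term\<close> and \<open>t * log 2 t\<close>,
    arranged as an equality of sums of nonnegative terms: it survives the truncation by
    \<open>ennreal\<close>, and after integration the finite constant \<open>1 / ln 2\<close>
    cancels.\<close>
  have "ennreal (kl_term t 1) + ennreal (t / ln 2) + ennreal (- (t * log 2 t)) =
     ennreal (t * log 2 t) + ennreal (1 / ln 2)" if t: "0 < t" for t
  proof -
    have R: "kl_term t 1 = t * log 2 t - t / ln 2 + 1 / ln 2"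
      by (simp add: kl_term_def log_def diff_divide_distrib add_divide_distrib)
    have R0: "0 \<le> kl_term t 1" using t by (simp add: kl_term_nonneg)
    show ?thesis
    proof (cases "0 \<le> t * log 2 t")
      case True
      then have "ennreal (- (t * log 2 t)) = 0" by (simp add: ennreal_neg)
      moreover have "kl_term t 1 + t / ln 2 = t * log 2 t + 1 / ln 2" using R by simp
      ultimately show ?thesis using t R0 True by (simp flip: ennreal_plus)
    next
      case False
      then have "ennreal (t * log 2 t) = 0" by (simp add: ennreal_neg)
      moreover have "kl_term t 1 + t / ln 2 + - (t * log 2 t) = 1 / ln 2" using R by simp
      ultimately show ?thesis using t R0 False by (simp flip: ennreal_plus)
    qed
  qed
  then have "(\<integral>\<^sup>+ x. ennreal (kl_term (r x) 1) + ennreal (r x / ln 2) + ennreal (- (r x * log 2 (r x))) \<partial>P) =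
      (\<integral>\<^sup>+ x. ennreal (r x * log 2 (r x)) + ennreal (1 / ln 2) \<partial>P)"
    using pos by (intro nn_integral_cong) auto
  moreover have "(\<integral>\<^sup>+ x. ennreal (r x / ln 2) \<partial>P) = ennreal (1 / ln 2)"
  proof -
    have "(\<integral>\<^sup>+ x. ennreal (r x / ln 2) \<partial>P) = (\<integral>\<^sup>+ x. ennreal (1 / ln 2) * ennreal (r x) \<partial>P)"
      using pos by (intro nn_integral_cong) (auto simp: less_imp_le simp flip: ennreal_mult)
    also have "\<dots> = ennreal (1 / ln 2)"
      by (subst nn_integral_cmult) (auto simp: one)
    finally show ?thesis .
  qed
  ultimately have "D + ennreal (1 / ln 2) + b = a + ennreal (1 / ln 2)"
    by (simp add: nn_integral_add D_def a_def b_def emeasure_space_1)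
  then have "ennreal (1 / ln 2) + (D + b) = ennreal (1 / ln 2) + a"
    by (simp add: add_ac)
  then have a: "D + b = a"
    by (subst (asm) ennreal_add_left_cancel) auto
  have "enn2ereal a - enn2ereal b = enn2ereal D"
    using b unfolding a[symmetric] plus_ennreal.rep_eq
    by (cases b) (auto simp: enn2ereal_ennreal ereal_add_diff_cancel)
  then show ?thesis using lhs by (simp add: J_def D_def)
qed

section \<open>Output densities and mutual information\<close>

text \<open>Because of the noise, the output has this Lebesgue density for every input law, discrete
  and singular ones included. It is positive everywhere and bounded uniformly in channel and law, so
  no convention for vanishing densities enters the divergences.\<close>

definition output_density :: "complex ^ 'n ^ 'm \<Rightarrow> (complex ^ 'n) measure \<Rightarrow> complex ^ 'm \<Rightarrow> real" where
  "output_density A P y = (\<integral>x. gaussian_density (y - A *v x) \<partial>P)"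

abbreviation laws :: "(complex ^ 'n) measure measure" where
  "laws \<equiv> prob_algebra borel"

lemma lawsD:
  assumes "P \<in> space laws"
  shows "prob_space P" "sets P = sets borel" "space P = UNIV"
  using assms sets_eq_imp_space_eq[of P borel] by (auto simp: space_prob_algebra)

lemma gaussian_density_le: "gaussian_density (w :: complex ^ 'm) \<le> 1 / pi ^ CARD('m)"
  unfolding gaussian_density_def by (intro divide_right_mono) auto

lemma integrable_gaussian_density:
  assumes "P \<in> space laws"
  shows "integrable P (\<lambda>x. gaussian_density (y - A *v x))"
proof -
  interpret prob_space P using assms by (rule lawsD)
  note [measurable_cong] = lawsD(2)[OF assms]
  show ?thesis
    by (rule integrable_const_bound[OF AE_I2, where B="1 / pi ^ CARD('b)"])
      (use gaussian_density_le in auto)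
qed

lemma output_density_pos:
  assumes "P \<in> space laws"
  shows "0 < output_density A P y"
proof -
  interpret prob_space P using assms by (rule lawsD)
  have "(\<integral>x. 0 \<partial>P) < output_density A P y"
    unfolding output_density_def
    by (rule integral_less_AE_space)
      (auto simp: integrable_gaussian_density[OF assms] gaussian_density_pos emeasure_space_1)
  then show ?thesis by simp
qed

lemma output_density_le:
  fixes A :: "complex ^ 'n ^ 'm"
  assumes "P \<in> space laws"
  shows "output_density A P y \<le> 1 / pi ^ CARD('m)"
proof -
  interpret prob_space P using assms by (rule lawsD)
  have "output_density A P y \<le> (\<integral>x. 1 / pi ^ CARD('m) \<partial>P)"
    unfolding output_density_def
    by (rule integral_mono) (auto simp: integrable_gaussian_density[OF assms] gaussian_density_le)
  then show ?thesis by (simp add: prob_space)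
qed

lemma ennreal_output_density:
  assumes "P \<in> space laws"
  shows "ennreal (output_density A P y) = (\<integral>\<^sup>+ x. ennreal (gaussian_density (y - A *v x)) \<partial>P)"
  unfolding output_density_def
  by (rule nn_integral_eq_integral[symmetric]) (auto simp: integrable_gaussian_density[OF assms])

text \<open>Joint in channel, law and output, because later the channel is random, the law is a
  conditional law, and the integrals over all of them are exchanged.\<close>

lemma measurable_output_density[measurable (raw)]:
  assumes [measurable]: "A \<in> borel_measurable M" "P \<in> measurable M laws" "y \<in> borel_measurable M"
  shows "(\<lambda>x. output_density (A x) (P x) (y x)) \<in> borel_measurable M"
proof -
  have "(\<lambda>x. \<integral>\<^sup>+ v. ennreal (gaussian_density (y x - A x *v v)) \<partial>P x) \<in> borel_measurable M"
  proof (rule nn_integral_measurable_subprob_algebra2[where N=borel])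
    show "(\<lambda>(x, v). ennreal (gaussian_density (y x - A x *v v))) \<in> borel_measurable (M \<Otimes>\<^sub>M borel)"
      by measurable
    show "P \<in> measurable M (subprob_algebra borel)"
      by (rule measurable_prob_algebraD) fact
  qed
  then have "(\<lambda>x. enn2real (\<integral>\<^sup>+ v. ennreal (gaussian_density (y x - A x *v v)) \<partial>P x)) \<in> borel_measurable M"
    by measurable
  moreover have "enn2real (\<integral>\<^sup>+ v. ennreal (gaussian_density (y x - A x *v v)) \<partial>P x) = output_density (A x) (P x) (y x)"
    if "x \<in> space M" for x
  proof -
    have "P x \<in> space laws" using assms(2) that by (rule measurable_space)
    then show ?thesis
      by (simp add: output_density_pos less_imp_le flip: ennreal_output_density)
  qed
  ultimately show ?thesis by (subst (asm) measurable_cong)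
qed

lemma output_density_return:
  "output_density A (return borel x) y = gaussian_density (y - A *v x)"
  unfolding output_density_def by (rule integral_return) auto

lemma nn_integral_lborel_shift:
  assumes [measurable]: "f \<in> borel_measurable borel"
  shows "(\<integral>\<^sup>+ y. f (c + y) \<partial>lborel) = (\<integral>\<^sup>+ y. f y \<partial>(lborel :: 'a::euclidean_space measure))"
proof -
  have "(\<integral>\<^sup>+ y. f y \<partial>lborel) = (\<integral>\<^sup>+ y. f y \<partial>distr lborel borel ((+) c))"
    by (simp add: lborel_distr_plus)
  also have "\<dots> = (\<integral>\<^sup>+ y. f (c + y) \<partial>lborel)"
    by (rule nn_integral_distr) auto
  finally show ?thesis ..
qed

lemma nn_integral_standard_complex_gaussian_shift:
  assumes [measurable]: "f \<in> borel_measurable borel"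
  shows "(\<integral>\<^sup>+ w. f (c + w) \<partial>standard_complex_gaussian) = (\<integral>\<^sup>+ y. ennreal (gaussian_density (y - c)) * f y \<partial>lborel)"
proof -
  have "(\<integral>\<^sup>+ w. f (c + w) \<partial>standard_complex_gaussian) = (\<integral>\<^sup>+ w. ennreal (gaussian_density w) * f (c + w) \<partial>lborel)"
    unfolding standard_complex_gaussian_density by (rule nn_integral_density) measurable
  also have "\<dots> = (\<integral>\<^sup>+ y. ennreal (gaussian_density (y - c)) * f y \<partial>lborel)"
    using nn_integral_lborel_shift[of "\<lambda>y. ennreal (gaussian_density (y - c)) * f y" c] by simp
  finally show ?thesis .
qed

lemma nn_integral_output_density:
  fixes A :: "complex ^ 'n ^ 'm"
  assumes "P \<in> space laws" and [measurable]: "f \<in> borel_measurable borel"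
  shows "(\<integral>\<^sup>+ y. ennreal (output_density A P y) * f y \<partial>lborel) =
    (\<integral>\<^sup>+ x. \<integral>\<^sup>+ y. ennreal (gaussian_density (y - A *v x)) * f y \<partial>lborel \<partial>P)"
proof -
  interpret P: prob_space P using assms(1) by (rule lawsD)
  note [measurable_cong] = lawsD(2)[OF assms(1)]
  interpret pair_sigma_finite P "lborel :: (complex ^ 'm) measure" ..
  have "(\<integral>\<^sup>+ y. ennreal (output_density A P y) * f y \<partial>lborel) =
     (\<integral>\<^sup>+ y. \<integral>\<^sup>+ x. ennreal (gaussian_density (y - A *v x)) * f y \<partial>P \<partial>lborel)"
    by (simp add: ennreal_output_density[OF assms(1)] nn_integral_multc)
  also have "\<dots> = (\<integral>\<^sup>+ x. \<integral>\<^sup>+ y. ennreal (gaussian_density (y - A *v x)) * f y \<partial>lborel \<partial>P)"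
    by (rule Fubini') measurable
  finally show ?thesis .
qed

lemma nn_integral_gaussian_density_shift: "(\<integral>\<^sup>+ y. ennreal (gaussian_density (y - c)) \<partial>lborel) = 1"
  for c :: "complex ^ 'm"
  using nn_integral_standard_complex_gaussian_shift[of "\<lambda>_. 1" c]
    standard_complex_gaussian.emeasure_space_1[where 'n='m] by simp

lemma nn_integral_output_density_1:
  assumes "P \<in> space laws"
  shows "(\<integral>\<^sup>+ y. ennreal (output_density A P y) \<partial>lborel) = 1"
proof -
  interpret P: prob_space P using assms(1) by (rule lawsD)
  show ?thesis
    using nn_integral_output_density[OF assms, of "\<lambda>_. 1" A]
    by (simp add: nn_integral_gaussian_density_shift P.emeasure_space_1)
qed

section \<open>Divergences between output laws\<close>

definition output_divergence :: "complex ^ 'n ^ 'm \<Rightarrow> (complex ^ 'n) measure \<Rightarrow> (complex ^ 'n) measure \<Rightarrow> ennreal" where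
  "output_divergence A P Q = (\<integral>\<^sup>+ y. ennreal (kl_term (output_density A P y) (output_density A Q y)) \<partial>lborel)"

lemma measurable_output_divergence[measurable (raw)]:
  fixes A :: "'w \<Rightarrow> complex ^ 'n ^ 'm"
  assumes [measurable]: "A \<in> borel_measurable M" "P \<in> measurable M laws" "Q \<in> measurable M laws"
  shows "(\<lambda>x. output_divergence (A x) (P x) (Q x)) \<in> borel_measurable M"
  unfolding output_divergence_def by measurable

lemma output_divergence_self[simp]:
  "P \<in> space laws \<Longrightarrow> output_divergence A P P = 0"
  by (simp add: output_divergence_def output_density_pos)

lemma bind_in_laws:
  assumes "prob_space \<mu>" "k \<in> measurable \<mu> laws"
  shows "\<mu> \<bind> k \<in> space laws"
proof -
  have "\<mu> \<in> space (prob_algebra \<mu>)" using assms by (simp add: space_prob_algebra)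
  then show ?thesis
    using measurable_bind_prob_space[of "\<lambda>_. \<mu>" "count_space UNIV" \<mu> k borel] assms(2)
    by (auto dest: measurable_space)
qed

lemma output_density_bind:
  fixes A :: "complex ^ 'n ^ 'm"
  assumes "prob_space \<mu>" and k[measurable]: "k \<in> measurable \<mu> laws"
  shows "output_density A (\<mu> \<bind> k) y = (\<integral>u. output_density A (k u) y \<partial>\<mu>)"
proof -
  interpret prob_space \<mu> by fact
  have kl: "k u \<in> space laws" if "u \<in> space \<mu>" for u
    using k that by (rule measurable_space)
  have i: "integrable \<mu> (\<lambda>u. output_density A (k u) y)"
    by (rule integrable_const_bound[OF AE_I2, where B="1 / pi ^ CARD('m)"])
      (auto simp: output_density_le kl less_imp_le[OF output_density_pos])
  have "ennreal (output_density A (\<mu> \<bind> k) y) = (\<integral>\<^sup>+ u. \<integral>\<^sup>+ x. ennreal (gaussian_density (y - A *v x)) \<partial>k u \<partial>\<mu>)"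
    unfolding ennreal_output_density[OF bind_in_laws[OF assms]]
    by (rule nn_integral_bind[where B=borel]) (auto intro: measurable_prob_algebraD)
  also have "\<dots> = (\<integral>\<^sup>+ u. ennreal (output_density A (k u) y) \<partial>\<mu>)"
    by (intro nn_integral_cong) (simp add: ennreal_output_density kl)
  also have "\<dots> = ennreal (\<integral>u. output_density A (k u) y \<partial>\<mu>)"
    using i by (intro nn_integral_eq_integral AE_I2) (auto simp: less_imp_le[OF output_density_pos] kl)
  finally show ?thesis
    by (subst (asm) ennreal_inj)
      (auto intro!: integral_nonneg_AE AE_I2 simp: kl less_imp_le[OF output_density_pos] bind_in_laws assms)
qed

text \<open>At each output \<open>y\<close> the integrands of the two integrals over \<open>u\<close> differ by an affine function of the
  density of \<open>y\<close> given \<open>u\<close>, whose mean over \<open>u\<close> is the density for the mixture.\<close>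

lemma output_divergence_compensation:
  fixes A :: "complex ^ 'n ^ 'm"
  assumes "prob_space \<mu>" and k[measurable]: "k \<in> measurable \<mu> laws" and Q: "Q \<in> space laws"
  shows "(\<integral>\<^sup>+ u. output_divergence A (k u) Q \<partial>\<mu>) =
    (\<integral>\<^sup>+ u. output_divergence A (k u) (\<mu> \<bind> k) \<partial>\<mu>) + output_divergence A (\<mu> \<bind> k) Q"
proof -
  interpret prob_space \<mu> by fact
  interpret pair_sigma_finite \<mu> "lborel :: (complex ^ 'm) measure" ..
  have kl: "k u \<in> space laws" if "u \<in> space \<mu>" for u
    using k that by (rule measurable_space)
  have bl[measurable]: "\<mu> \<bind> k \<in> space laws" by (rule bind_in_laws) fact+
  note Q[measurable]
  have sw: "(\<integral>\<^sup>+ u. output_divergence A (k u) Q' \<partial>\<mu>) =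
     (\<integral>\<^sup>+ y. \<integral>\<^sup>+ u. ennreal (kl_term (output_density A (k u) y) (output_density A Q' y)) \<partial>\<mu> \<partial>lborel)"
    if [measurable]: "Q' \<in> space laws" for Q'
    unfolding output_divergence_def by (rule Fubini'[symmetric]) measurable
  have "(\<integral>\<^sup>+ u. output_divergence A (k u) Q \<partial>\<mu>) =
     (\<integral>\<^sup>+ y. (\<integral>\<^sup>+ u. ennreal (kl_term (output_density A (k u) y) (output_density A (\<mu> \<bind> k) y)) \<partial>\<mu>) +
        ennreal (kl_term (output_density A (\<mu> \<bind> k) y) (output_density A Q y)) \<partial>lborel)"
    unfolding sw[OF Q]
  proof (intro nn_integral_cong nn_integral_kl_term_mean[where c="1 / pi ^ CARD('m)"])
    show "(\<lambda>u. output_density A (k u) y) \<in> borel_measurable \<mu>" for y by measurable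
    show "(\<integral>u. output_density A (k u) y \<partial>\<mu>) = output_density A (\<mu> \<bind> k) y" for y
      by (rule output_density_bind[symmetric]) fact+
  qed (use kl Q bl assms(1) in \<open>simp_all add: output_density_pos output_density_le\<close>)
  also have "\<dots> = (\<integral>\<^sup>+ y. (\<integral>\<^sup>+ u. ennreal (kl_term (output_density A (k u) y) (output_density A (\<mu> \<bind> k) y)) \<partial>\<mu>) \<partial>lborel)
      + output_divergence A (\<mu> \<bind> k) Q"
    unfolding output_divergence_def by (rule nn_integral_add) measurable
  finally show ?thesis by (simp add: sw[OF bl])
qed

text \<open>The law of a pair whose first component has law \<mu> and whose second is drawn from the
  kernel \<open>k\<close>. Every input distribution is brought to this form by
  \<open>disintegration\<close>.\<close>

definition joint_law :: "'u measure \<Rightarrow> ('u \<Rightarrow> 'x::topological_space measure) \<Rightarrow> ('u \<times> 'x) measure" where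
  "joint_law \<mu> k = \<mu> \<bind> (\<lambda>u. distr (k u) (\<mu> \<Otimes>\<^sub>M borel) (Pair u))"

context
  fixes \<mu> :: "'u measure" and k :: "'u \<Rightarrow> 'x::topological_space measure"
  assumes \<mu>: "prob_space \<mu>" and k[measurable]: "k \<in> measurable \<mu> (prob_algebra borel)"
begin

interpretation prob_space \<mu> by (rule \<mu>)

lemma joint_law_kernel: "(\<lambda>u. distr (k u) (\<mu> \<Otimes>\<^sub>M borel) (Pair u)) \<in> measurable \<mu> (prob_algebra (\<mu> \<Otimes>\<^sub>M borel))"
  by (rule measurable_distr_prob_space2[where M=borel]) measurable

lemma joint_law_space: "joint_law \<mu> k \<in> space (prob_algebra (\<mu> \<Otimes>\<^sub>M borel))"
proof -
  have "\<mu> \<in> space (prob_algebra \<mu>)" using \<mu> by (simp add: space_prob_algebra)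
  then show ?thesis
    unfolding joint_law_def
    using measurable_bind_prob_space[of "\<lambda>_. \<mu>" "count_space UNIV" \<mu> _ "\<mu> \<Otimes>\<^sub>M borel", OF _ joint_law_kernel]
    by (auto dest: measurable_space)
qed

lemma prob_space_joint_law: "prob_space (joint_law \<mu> k)"
  and sets_joint_law: "sets (joint_law \<mu> k) = sets (\<mu> \<Otimes>\<^sub>M borel)"
  using joint_law_space by (auto simp: space_prob_algebra)

lemma nn_integral_joint_law:
  assumes [measurable]: "f \<in> borel_measurable (\<mu> \<Otimes>\<^sub>M borel)"
  shows "(\<integral>\<^sup>+ z. f z \<partial>joint_law \<mu> k) = (\<integral>\<^sup>+ u. \<integral>\<^sup>+ x. f (u, x) \<partial>k u \<partial>\<mu>)"
proof -
  have "(\<integral>\<^sup>+ z. f z \<partial>joint_law \<mu> k) = (\<integral>\<^sup>+ u. \<integral>\<^sup>+ z. f z \<partial>distr (k u) (\<mu> \<Otimes>\<^sub>M borel) (Pair u) \<partial>\<mu>)"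
    unfolding joint_law_def
    by (rule nn_integral_bind[OF _ measurable_prob_algebraD[OF joint_law_kernel]]) measurable
  also have "\<dots> = (\<integral>\<^sup>+ u. \<integral>\<^sup>+ x. f (u, x) \<partial>k u \<partial>\<mu>)"
  proof (intro nn_integral_cong nn_integral_distr)
    fix u assume u: "u \<in> space \<mu>"
    then have "sets (k u) = sets borel"
      using measurable_space[OF k] by (simp add: space_prob_algebra)
    then show "Pair u \<in> measurable (k u) (\<mu> \<Otimes>\<^sub>M borel)"
      using u by (simp cong: measurable_cong_sets)
  qed measurable
  finally show ?thesis .
qed

end

text \<open>With respect to the product of \<mu> and Lebesgue measure, message and output have the
  joint density \<open>f u y\<close>, and the product of their marginals has the density
  \<open>g y\<close>. The information is thus the mean over \<open>u\<close> of the divergence of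
  the output law given \<open>u\<close> from that of the mixture.\<close>

lemma instantaneous_information_joint_law:
  fixes A :: "complex ^ 'n ^ 'm" and \<mu> :: "'u measure"
  assumes \<mu>: "prob_space \<mu>" and S: "sets \<mu> = sets S" and k[measurable]: "k \<in> measurable \<mu> laws"
  shows "instantaneous_information S (joint_law \<mu> k) A =
    enn2ereal (\<integral>\<^sup>+ u. output_divergence A (k u) (\<mu> \<bind> k) \<partial>\<mu>)"
proof -
  interpret \<mu>: prob_space \<mu> by fact
  define p where "p = joint_law \<mu> k"
  have sets_p[measurable_cong]: "sets p = sets (\<mu> \<Otimes>\<^sub>M borel)"
    unfolding p_def by (rule sets_joint_law) fact+
  interpret p: prob_space p
    unfolding p_def by (rule prob_space_joint_law) fact+
  define N where "N = (standard_complex_gaussian :: (complex ^ 'm) measure)"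
  have sets_N[measurable_cong]: "sets N = sets borel" by (simp add: N_def)
  interpret N: prob_space N unfolding N_def by (rule prob_space_standard_complex_gaussian)
  define X :: "('u \<times> (complex ^ 'n)) \<times> (complex ^ 'm) \<Rightarrow> 'u" where "X = (\<lambda>z. fst (fst z))"
  define Y :: "('u \<times> (complex ^ 'n)) \<times> (complex ^ 'm) \<Rightarrow> complex ^ 'm"
    where "Y = (\<lambda>z. A *v snd (fst z) + snd z)"
  have [measurable]: "X \<in> measurable (p \<Otimes>\<^sub>M N) \<mu>" "Y \<in> borel_measurable (p \<Otimes>\<^sub>M N)"
    unfolding X_def Y_def by measurable
  interpret pair_sigma_finite \<mu> "lborel :: (complex ^ 'm) measure" ..
  have kl: "k u \<in> space laws" if "u \<in> space \<mu>" for u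
    using k that by (rule measurable_space)
  have bl[measurable]: "\<mu> \<bind> k \<in> space laws" by (rule bind_in_laws) fact+
  define f where "f u y = output_density A (k u) y" for u y
  define g where "g y = output_density A (\<mu> \<bind> k) y" for y
  have [measurable]: "(\<lambda>z. f (fst z) (snd z)) \<in> borel_measurable (\<mu> \<Otimes>\<^sub>M borel)" "g \<in> borel_measurable borel"
    unfolding f_def g_def by measurable
  have fpos: "0 < f u y" if "u \<in> space \<mu>" for u y
    unfolding f_def using that by (intro output_density_pos kl)
  have gpos: "0 < g y" for y unfolding g_def by (intro output_density_pos bl)
  \<comment> \<open>Noise and input are integrated out once for all test functions \<open>h\<close>;
    the joint law and both marginals are read off from this.\<close>
  have main: "(\<integral>\<^sup>+ z. h (X z, Y z) \<partial>(p \<Otimes>\<^sub>M N)) = (\<integral>\<^sup>+ u. \<integral>\<^sup>+ y. ennreal (f u y) * h (u, y) \<partial>lborel \<partial>\<mu>)"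
    if h[measurable]: "h \<in> borel_measurable (\<mu> \<Otimes>\<^sub>M borel)" for h
  proof -
    have "(\<integral>\<^sup>+ z. h (X z, Y z) \<partial>(p \<Otimes>\<^sub>M N)) = (\<integral>\<^sup>+ z. \<integral>\<^sup>+ w. h (fst z, A *v snd z + w) \<partial>N \<partial>p)"
      by (subst N.nn_integral_fst[symmetric]) (simp_all add: X_def Y_def)
    also have "\<dots> = (\<integral>\<^sup>+ u. \<integral>\<^sup>+ x. \<integral>\<^sup>+ w. h (u, A *v x + w) \<partial>N \<partial>k u \<partial>\<mu>)"
      unfolding p_def by (subst nn_integral_joint_law[OF \<mu> k]) simp_all
    also have "\<dots> = (\<integral>\<^sup>+ u. \<integral>\<^sup>+ y. ennreal (f u y) * h (u, y) \<partial>lborel \<partial>\<mu>)"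
    proof (intro nn_integral_cong)
      fix u assume u: "u \<in> space \<mu>"
      have [measurable]: "(\<lambda>y. h (u, y)) \<in> borel_measurable borel"
        using u by measurable
      show "(\<integral>\<^sup>+ x. \<integral>\<^sup>+ w. h (u, A *v x + w) \<partial>N \<partial>k u) = (\<integral>\<^sup>+ y. ennreal (f u y) * h (u, y) \<partial>lborel)"
        unfolding N_def f_def
        by (simp add: nn_integral_output_density[OF kl[OF u]] nn_integral_standard_complex_gaussian_shift[of "\<lambda>y. h (u, y)"])
    qed
    finally show ?thesis .
  qed
  define J where "J = distr (p \<Otimes>\<^sub>M N) (\<mu> \<Otimes>\<^sub>M borel) (\<lambda>z. (X z, Y z))"
  have J: "J = density (\<mu> \<Otimes>\<^sub>M lborel) (\<lambda>z. ennreal (f (fst z) (snd z)))"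
  proof (rule measure_eqI)
    show "sets J = sets (density (\<mu> \<Otimes>\<^sub>M lborel) (\<lambda>z. ennreal (f (fst z) (snd z))))"
      by (auto simp: J_def intro!: sets_pair_measure_cong)
    fix E assume "E \<in> sets J"
    then have E[measurable]: "E \<in> sets (\<mu> \<Otimes>\<^sub>M borel)" by (simp add: J_def)
    have "emeasure J E = (\<integral>\<^sup>+ z. indicator E z \<partial>J)"
      using \<open>E \<in> sets J\<close> by simp
    also have "\<dots> = (\<integral>\<^sup>+ z. indicator E (X z, Y z) \<partial>(p \<Otimes>\<^sub>M N))"
      unfolding J_def by (rule nn_integral_distr) measurable
    also have "\<dots> = (\<integral>\<^sup>+ u. \<integral>\<^sup>+ y. ennreal (f u y) * indicator E (u, y) \<partial>lborel \<partial>\<mu>)"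
      by (rule main) measurable
    also have "\<dots> = (\<integral>\<^sup>+ z. ennreal (f (fst z) (snd z)) * indicator E z \<partial>(\<mu> \<Otimes>\<^sub>M lborel))"
      by (subst lborel.nn_integral_fst[symmetric]) simp_all
    also have "\<dots> = emeasure (density (\<mu> \<Otimes>\<^sub>M lborel) (\<lambda>z. ennreal (f (fst z) (snd z)))) E"
      by (subst emeasure_density) simp_all
    finally show "emeasure J E = \<dots>" .
  qed
  have PX: "distr (p \<Otimes>\<^sub>M N) \<mu> X = \<mu>"
  proof (rule measure_eqI)
    fix B assume "B \<in> sets (distr (p \<Otimes>\<^sub>M N) \<mu> X)"
    then have B[measurable]: "B \<in> sets \<mu>" by simp
    have "emeasure (distr (p \<Otimes>\<^sub>M N) \<mu> X) B = (\<integral>\<^sup>+ z. indicator B (X z) \<partial>(p \<Otimes>\<^sub>M N))"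
      by (subst nn_integral_distr[symmetric, of X _ \<mu>]) simp_all
    also have "\<dots> = (\<integral>\<^sup>+ u. \<integral>\<^sup>+ y. ennreal (f u y) * indicator B u \<partial>lborel \<partial>\<mu>)"
      using main[of "\<lambda>z. indicator B (fst z)"] by simp
    also have "\<dots> = (\<integral>\<^sup>+ u. indicator B u \<partial>\<mu>)"
      by (intro nn_integral_cong) (simp add: f_def nn_integral_multc nn_integral_output_density_1 kl)
    finally show "emeasure (distr (p \<Otimes>\<^sub>M N) \<mu> X) B = emeasure \<mu> B" by simp
  qed simp
  have PY: "distr (p \<Otimes>\<^sub>M N) borel Y = density lborel (\<lambda>y. ennreal (g y))"
  proof (rule measure_eqI)
    fix B assume "B \<in> sets (distr (p \<Otimes>\<^sub>M N) borel Y)"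
    then have B[measurable]: "B \<in> sets borel" by simp
    have "emeasure (distr (p \<Otimes>\<^sub>M N) borel Y) B = (\<integral>\<^sup>+ z. indicator B (Y z) \<partial>(p \<Otimes>\<^sub>M N))"
      by (subst nn_integral_distr[symmetric, of Y _ borel]) simp_all
    also have "\<dots> = (\<integral>\<^sup>+ u. \<integral>\<^sup>+ y. ennreal (f u y) * indicator B y \<partial>lborel \<partial>\<mu>)"
      using main[of "\<lambda>z. indicator B (snd z)"] by simp
    also have "\<dots> = (\<integral>\<^sup>+ u. \<integral>\<^sup>+ x. \<integral>\<^sup>+ y. ennreal (gaussian_density (y - A *v x)) * indicator B y \<partial>lborel \<partial>k u \<partial>\<mu>)"
      by (intro nn_integral_cong) (simp add: f_def nn_integral_output_density kl)
    also have "\<dots> = (\<integral>\<^sup>+ x. \<integral>\<^sup>+ y. ennreal (gaussian_density (y - A *v x)) * indicator B y \<partial>lborel \<partial>(\<mu> \<bind> k))"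
      by (rule nn_integral_bind[symmetric, OF _ measurable_prob_algebraD[OF k]]) measurable
    also have "\<dots> = (\<integral>\<^sup>+ y. ennreal (g y) * indicator B y \<partial>lborel)"
      unfolding g_def by (rule nn_integral_output_density[symmetric, OF bl]) measurable
    also have "\<dots> = emeasure (density lborel (\<lambda>y. ennreal (g y))) B"
      by (subst emeasure_density) simp_all
    finally show "emeasure (distr (p \<Otimes>\<^sub>M N) borel Y) B = \<dots>" .
  qed simp
  define PQ where "PQ = \<mu> \<Otimes>\<^sub>M density lborel (\<lambda>y. ennreal (g y))"
  have g1: "(\<integral>\<^sup>+ y. ennreal (g y) \<partial>lborel) = 1"
    unfolding g_def by (rule nn_integral_output_density_1[OF bl])
  interpret G: prob_space "density lborel (\<lambda>y. ennreal (g y))"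
    by standard (simp add: emeasure_density g1)
  interpret PQ: pair_prob_space \<mu> "density lborel (\<lambda>y. ennreal (g y))" ..
  have PQ: "PQ = density (\<mu> \<Otimes>\<^sub>M lborel) (\<lambda>z. ennreal (g (snd z)))"
  proof -
    have "density \<mu> (\<lambda>_. 1) \<Otimes>\<^sub>M density lborel (\<lambda>y. ennreal (g y)) =
        density (\<mu> \<Otimes>\<^sub>M lborel) (\<lambda>(u, y). 1 * ennreal (g y))"
      by (rule pair_measure_density) (simp_all add: G.sigma_finite_measure_axioms lborel.sigma_finite_measure_axioms)
    then show ?thesis by (simp add: PQ_def density_1 split_def)
  qed
  have sets_PQ[measurable_cong]: "sets PQ = sets (\<mu> \<Otimes>\<^sub>M borel)"
    unfolding PQ_def by (intro sets_pair_measure_cong) simp_all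
  have sp: "space PQ = space \<mu> \<times> UNIV"
    by (simp add: PQ_def space_pair_measure)
  \<comment> \<open>The likelihood ratio of the joint law to the product of the marginals. As
    \<open>kl_term\<close> is homogeneous, weighting \<open>kl_term r 1\<close> by \<open>g\<close>
    gives \<open>kl_term f g\<close>.\<close>
  define r where "r z = f (fst z) (snd z) / g (snd z)" for z
  have r[measurable]: "r \<in> borel_measurable (\<mu> \<Otimes>\<^sub>M borel)"
    unfolding r_def by measurable
  have gr: "ennreal (g (snd z)) * ennreal (r z) = ennreal (f (fst z) (snd z))" if "z \<in> space (\<mu> \<Otimes>\<^sub>M lborel)" for z
    using that gpos[of "snd z"] fpos[of "fst z" "snd z"]
    by (simp add: r_def space_pair_measure less_imp_le mem_Times_iff flip: ennreal_mult')
  have J': "J = density PQ (\<lambda>z. ennreal (r z))"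
    unfolding J PQ using gr by (subst density_density_eq) (auto intro!: density_cong AE_I2)
  have J1: "emeasure J (space J) = 1"
  proof -
    interpret PN: pair_prob_space p N ..
    have "prob_space J" unfolding J_def by (rule PN.prob_space_distr) measurable
    then show ?thesis by (rule prob_space.emeasure_space_1)
  qed
  have "extended_KL_divergence 2 PQ J = enn2ereal (\<integral>\<^sup>+ z. ennreal (kl_term (r z) 1) \<partial>PQ)"
    unfolding J'
  proof (rule extended_KL_divergence_density)
    show "prob_space PQ" unfolding PQ_def by (rule PQ.prob_space_axioms)
    show "r \<in> borel_measurable PQ" by measurable
    show "0 < r z" if "z \<in> space PQ" for z
      using that gpos fpos by (auto simp: r_def sp)
    have "(\<integral>\<^sup>+ z. ennreal (r z) \<partial>PQ) = emeasure J (space J)"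
      unfolding J' by (simp add: emeasure_density cong: nn_integral_cong)
    then show "(\<integral>\<^sup>+ z. ennreal (r z) \<partial>PQ) = 1" using J1 by simp
  qed
  also have "(\<integral>\<^sup>+ z. ennreal (kl_term (r z) 1) \<partial>PQ) =
     (\<integral>\<^sup>+ z. ennreal (g (snd z)) * ennreal (kl_term (r z) 1) \<partial>(\<mu> \<Otimes>\<^sub>M lborel))"
    unfolding PQ by (rule nn_integral_density) measurable
  also have "\<dots> = (\<integral>\<^sup>+ z. ennreal (kl_term (f (fst z) (snd z)) (g (snd z))) \<partial>(\<mu> \<Otimes>\<^sub>M lborel))"
  proof (intro nn_integral_cong)
    fix z assume "z \<in> space (\<mu> \<Otimes>\<^sub>M (lborel :: (complex ^ 'm) measure))"
    have "ennreal (g (snd z)) * ennreal (kl_term (r z) 1) = ennreal (g (snd z) * kl_term (r z) 1)"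
      using gpos[of "snd z"] by (simp add: ennreal_mult')
    then show "ennreal (g (snd z)) * ennreal (kl_term (r z) 1) = ennreal (kl_term (f (fst z) (snd z)) (g (snd z)))"
      using gpos[of "snd z"] by (simp add: r_def kl_term_scale)
  qed
  also have "\<dots> = (\<integral>\<^sup>+ u. output_divergence A (k u) (\<mu> \<bind> k) \<partial>\<mu>)"
    unfolding output_divergence_def by (subst lborel.nn_integral_fst[symmetric]) (simp_all add: f_def g_def)
  finally have "extended_KL_divergence 2 PQ J = enn2ereal (\<integral>\<^sup>+ u. output_divergence A (k u) (\<mu> \<bind> k) \<partial>\<mu>)" .
  moreover have "instantaneous_information S p A = extended_KL_divergence 2 PQ J"
  proof -
    \<comment> \<open>\<open>S\<close> serves only as a target space, so it may be replaced by
      \<mu>, which has the same measurable sets.\<close>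
    have "distr (p \<Otimes>\<^sub>M N) S X = distr (p \<Otimes>\<^sub>M N) \<mu> X"
      by (rule distr_cong[OF refl S[symmetric] refl])
    then have "distr (p \<Otimes>\<^sub>M N) S X = \<mu>" unfolding PX .
    moreover have "distr (p \<Otimes>\<^sub>M N) (S \<Otimes>\<^sub>M borel) (\<lambda>z. (X z, Y z)) = J"
      unfolding J_def by (rule distr_cong[OF refl sets_pair_measure_cong[OF S[symmetric] refl] refl])
    ultimately show ?thesis
      by (simp add: instantaneous_information_def extended_mutual_information_def PQ_def N_def[symmetric]
          split_def X_def[symmetric] Y_def[symmetric] PY)
  qed
  ultimately show ?thesis by (simp add: p_def)
qed

section \<open>Disintegration\<close>

text \<open>A second countable space embeds into the reals: the membership bits of a point in the members of a
  countable base are stored as base-4 digits. The base-4 expansion leaves room, so that the digits can be read off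
  without ambiguity.\<close>

definition bits_real :: "(nat \<Rightarrow> bool) \<Rightarrow> real" where
  "bits_real s = (\<Sum>n. of_bool (s n) * (1 / 4) ^ Suc n)"

definition bit_shift :: "real \<Rightarrow> real" where
  "bit_shift r = 4 * r - of_int \<lfloor>4 * r\<rfloor>"

definition bit_of :: "real \<Rightarrow> nat \<Rightarrow> bool" where
  "bit_of r n \<longleftrightarrow> \<lfloor>4 * (bit_shift ^^ n) r\<rfloor> = 1"

lemma summable_bits_real: "summable (\<lambda>n. of_bool (s n) * (1 / 4 :: real) ^ Suc n)"
  by (rule summable_comparison_test'[where g="\<lambda>n. (1 / 4) ^ Suc n" and N=0])
    (auto simp: summable_geometric)

text \<open>The digits are 0 or 1, so the sum is at most 1/3. The strict bound by 1 keeps a tail of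
  ones from carrying into the leading digit, as it would in base 2.\<close>

lemma bits_real_bounds: "0 \<le> bits_real s" "bits_real s < 1"
proof -
  show "0 \<le> bits_real s"
    unfolding bits_real_def by (rule suminf_nonneg[OF summable_bits_real]) simp
  have "summable (\<lambda>n. (1 / 4 :: real) ^ Suc n)"
    by (simp add: summable_geometric)
  then have "bits_real s \<le> (\<Sum>n. (1 / 4) ^ Suc n)"
    unfolding bits_real_def by (intro suminf_le summable_bits_real) auto
  also have "(\<Sum>n. (1 / 4 :: real) ^ Suc n) = 1 / 3"
    using suminf_mult[of "\<lambda>n. (1 / 4 :: real) ^ n" "1 / 4"] by (simp add: suminf_geometric summable_geometric)
  finally show "bits_real s < 1" by simp
qed

lemma bits_real_unfold: "4 * bits_real s = of_bool (s 0) + bits_real (\<lambda>n. s (Suc n))"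
proof -
  have "bits_real s = (\<Sum>n. of_bool (s (Suc n)) * (1 / 4) ^ Suc (Suc n)) + of_bool (s 0) * (1 / 4) ^ Suc 0"
    unfolding bits_real_def by (subst suminf_split_head[OF summable_bits_real]) simp
  also have "(\<Sum>n. of_bool (s (Suc n)) * (1 / 4 :: real) ^ Suc (Suc n)) = (1 / 4) * bits_real (\<lambda>n. s (Suc n))"
    unfolding bits_real_def by (subst suminf_mult[OF summable_bits_real, symmetric]) (simp add: mult_ac)
  finally show ?thesis by simp
qed

lemma floor_bits_real: "\<lfloor>4 * bits_real s\<rfloor> = of_bool (s 0)"
  and bit_shift_bits_real: "bit_shift (bits_real s) = bits_real (\<lambda>n. s (Suc n))"
proof -
  show "\<lfloor>4 * bits_real s\<rfloor> = of_bool (s 0)"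
    unfolding bits_real_unfold using bits_real_bounds[of "\<lambda>n. s (Suc n)"]
    by (intro floor_unique) auto
  then show "bit_shift (bits_real s) = bits_real (\<lambda>n. s (Suc n))"
    unfolding bit_shift_def by (simp add: bits_real_unfold)
qed

lemma bit_of_bits_real: "bit_of (bits_real s) n = s n"
proof -
  have "(bit_shift ^^ n) (bits_real s) = bits_real (\<lambda>i. s (i + n))" for n
    by (induction n) (simp_all add: bit_shift_bits_real)
  then show ?thesis
    by (simp add: bit_of_def floor_bits_real)
qed

lemma measurable_bit_of[measurable]: "Measurable.pred borel (\<lambda>r. bit_of r n)"
proof -
  have [measurable]: "bit_shift \<in> borel_measurable borel"
    unfolding bit_shift_def[abs_def] by measurable
  have "(\<lambda>r. (bit_shift ^^ n) r) \<in> borel_measurable borel"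
    by (induction n) (simp_all add: measurable_compose[of _ borel borel bit_shift])
  then show ?thesis
    unfolding bit_of_def by measurable
qed

text \<open>A point is the limit of any sequence whose \<open>n\<close>-th member lies in the same
  ones among the first \<open>n\<close> base sets as the point does. The bits therefore suffice for
  decoding.\<close>

lemma borel_embedding_real:
  obtains e :: "'b::{banach, second_countable_topology} \<Rightarrow> real" and d :: "real \<Rightarrow> 'b"
  where "e \<in> borel_measurable borel" "d \<in> borel_measurable borel"
    "\<And>x. d (e x) = x" "\<And>x. 0 \<le> e x" "\<And>x. e x < 1"
proof -
  obtain B :: "'b set set" where B: "countable B" "topological_basis B"
    using ex_countable_basis by blast
  have "B \<noteq> {}"
    using topological_basisE[OF B(2) open_UNIV] by blast
  define b where "b = from_nat_into B"
  have bB: "range b = B" unfolding b_def by (rule range_from_nat_into[OF \<open>B \<noteq> {}\<close> B(1)])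
  have b_open: "open (b n)" for n
    using topological_basis_open[OF B(2)] bB by blast
  define e where "e x = bits_real (\<lambda>n. x \<in> b n)" for x
  \<comment> \<open>An arbitrary point for each finite membership pattern. For fixed
    \<open>n\<close> only finitely many patterns occur, so composing with this choice preserves
    measurability whatever points are chosen.\<close>
  define g where "g n A = (SOME x. \<forall>i<n. x \<in> b i \<longleftrightarrow> i \<in> A)" for n :: nat and A :: "nat set"
  define d where "d r = lim (\<lambda>n. g n {i. i < n \<and> bit_of r i})" for r
  have [measurable]: "b n \<in> sets borel" for n using b_open by simp
  have e: "e \<in> borel_measurable borel"
    unfolding e_def[abs_def] bits_real_def by measurable
  have d: "d \<in> borel_measurable borel"
    unfolding d_def[abs_def]
  proof (rule borel_measurable_lim_metric)
    fix n
    have "(\<lambda>r. {i. i < n \<and> bit_of r i}) \<in> measurable borel (count_space (Pow {..<n}))"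
    proof (subst measurable_count_space_eq2; safe)
      fix A assume "A \<subseteq> {..<n}"
      then have "(\<lambda>r. {i. i < n \<and> bit_of r i}) -` {A} \<inter> space borel = {r\<in>space borel. \<forall>i\<in>{..<n}. bit_of r i \<longleftrightarrow> i \<in> A}"
        by auto
      also have "\<dots> \<in> sets borel" by measurable
      finally show "(\<lambda>r. {i. i < n \<and> bit_of r i}) -` {A} \<inter> space borel \<in> sets borel" .
    qed
    then show "(\<lambda>r. g n {i. i < n \<and> bit_of r i}) \<in> borel_measurable borel"
      by (rule measurable_compose) simp
  qed
  have "d (e x) = x" for x
  proof -
    have g: "\<forall>i<n. g n {i. i < n \<and> bit_of (e x) i} \<in> b i \<longleftrightarrow> x \<in> b i" for n
      unfolding g_def e_def bit_of_bits_real by (rule someI2[of _ x]) auto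
    have "(\<lambda>n. g n {i. i < n \<and> bit_of (e x) i}) \<longlonglongrightarrow> x"
    proof (rule topological_tendstoI)
      fix U assume "open U" "x \<in> U"
      then obtain V where "V \<in> B" "x \<in> V" "V \<subseteq> U"
        using topological_basisE[OF B(2)] by metis
      then obtain i where i: "x \<in> b i" "b i \<subseteq> U" using bB by blast
      show "\<forall>\<^sub>F n in sequentially. g n {i. i < n \<and> bit_of (e x) i} \<in> U"
        using eventually_gt_at_top[of i] by eventually_elim (use g i in blast)
    qed
    then show ?thesis unfolding d_def by (rule limI)
  qed
  then show ?thesis
    using that[of e d] e d bits_real_bounds by (simp add: e_def)
qed

text \<open>Integrate over the set where the inequality fails; the finite integral of
  \<open>f\<close> makes the subtraction legitimate. It serves to turn inclusions of events into
  inequalities between conditional probabilities.\<close>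

lemma AE_le_of_set_nn_integral_le:
  fixes f g :: "'s \<Rightarrow> ennreal"
  assumes [measurable]: "f \<in> borel_measurable M" "g \<in> borel_measurable M"
    and fin: "(\<integral>\<^sup>+ x. f x \<partial>M) < \<infinity>"
    and le: "\<And>B. B \<in> sets M \<Longrightarrow> (\<integral>\<^sup>+ x. f x * indicator B x \<partial>M) \<le> (\<integral>\<^sup>+ x. g x * indicator B x \<partial>M)"
  shows "AE x in M. f x \<le> g x"
proof -
  define B where "B = {x \<in> space M. g x < f x}"
  have [measurable]: "B \<in> sets M" unfolding B_def by measurable
  have gf: "g x * indicator B x \<le> f x * indicator B x" for x
    by (auto simp: B_def indicator_def less_imp_le)
  have fB: "(\<integral>\<^sup>+ x. f x * indicator B x \<partial>M) < \<infinity>"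
    by (rule le_less_trans[OF _ fin]) (auto intro!: nn_integral_mono simp: indicator_def)
  have gB: "(\<integral>\<^sup>+ x. g x * indicator B x \<partial>M) < \<infinity>"
    by (rule le_less_trans[OF _ fB]) (auto intro!: nn_integral_mono gf)
  have "(\<integral>\<^sup>+ x. f x * indicator B x - g x * indicator B x \<partial>M) =
      (\<integral>\<^sup>+ x. f x * indicator B x \<partial>M) - (\<integral>\<^sup>+ x. g x * indicator B x \<partial>M)"
    using gB gf by (intro nn_integral_diff) auto
  also have "\<dots> = 0"
    using le[of B] fB by (simp add: diff_eq_0_iff_ennreal)
  finally have "AE x in M. f x * indicator B x - g x * indicator B x = 0"
    by (subst (asm) nn_integral_0_iff_AE) auto
  then show ?thesis
  proof (rule AE_mp, intro AE_I2 impI)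
    fix x assume x: "x \<in> space M" and 0: "f x * indicator B x - g x * indicator B x = 0"
    show "f x \<le> g x"
    proof (rule ccontr)
      assume n: "\<not> f x \<le> g x"
      then have "x \<in> B" using x by (simp add: B_def)
      with 0 have "f x - g x = 0" by simp
      with n show False by (simp add: diff_eq_0_iff_ennreal)
    qed
  qed
qed

text \<open>The conditional distribution function is built from Radon--Nikodym derivatives at rational thresholds.
  The infimum over the larger rational thresholds makes it right continuous and monotone at every point of the
  message space; by the almost everywhere monotonicity of the derivatives it keeps the right integrals.\<close>

lemma real_disintegration:
  fixes p :: "('u \<times> 'x) measure" and \<mu> :: "'u measure"
  assumes p: "prob_space p" and fst[measurable]: "fst \<in> measurable p \<mu>" and \<mu>: "distr p \<mu> fst = \<mu>"
    and e[measurable]: "e \<in> borel_measurable p" and e01: "\<And>z. 0 \<le> e z" "\<And>z. e z < (1 :: real)"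
  shows "\<exists>k \<in> measurable \<mu> (prob_algebra borel). \<forall>B\<in>sets \<mu>. \<forall>C\<in>sets borel.
    emeasure p {z \<in> space p. fst z \<in> B \<and> e z \<in> C} = (\<integral>\<^sup>+ u\<in>B. emeasure (k u) C \<partial>\<mu>)"
proof -
  interpret p: prob_space p by fact
  interpret \<mu>: prob_space \<mu> using p.prob_space_distr[OF fst] by (simp only: \<mu>)
  \<comment> \<open>The message law restricted to the event that \<open>e\<close> is at most
    \<open>t\<close>. Its derivative \<open>F t\<close> is the conditional probability of this
    event, determined only up to null sets.\<close>
  define \<nu> where "\<nu> t = distr (density p (\<lambda>z. indicator {..t} (e z))) \<mu> fst" for t
  have \<nu>_eq: "emeasure (\<nu> t) B = emeasure p {z \<in> space p. fst z \<in> B \<and> e z \<le> t}" if [measurable]: "B \<in> sets \<mu>" for t B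
  proof -
    have "emeasure (\<nu> t) B = (\<integral>\<^sup>+ z. indicator {..t} (e z) * indicator (fst -` B \<inter> space p) z \<partial>p)"
      unfolding \<nu>_def by (simp add: emeasure_distr emeasure_density)
    also have "\<dots> = (\<integral>\<^sup>+ z. indicator {z \<in> space p. fst z \<in> B \<and> e z \<le> t} z \<partial>p)"
      by (intro nn_integral_cong) (auto simp: indicator_def)
    finally show ?thesis by simp
  qed
  have \<mu>_eq: "emeasure p {z \<in> space p. fst z \<in> B} = emeasure \<mu> B" if [measurable]: "B \<in> sets \<mu>" for B
  proof -
    have "emeasure \<mu> B = emeasure (distr p \<mu> fst) B" by (simp only: \<mu>)
    also have "\<dots> = emeasure p (fst -` B \<inter> space p)" by (rule emeasure_distr) measurable
    also have "fst -` B \<inter> space p = {z \<in> space p. fst z \<in> B}" by auto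
    finally show ?thesis ..
  qed
  define F where "F t = RN_deriv \<mu> (\<nu> t)" for t
  have [measurable]: "F t \<in> borel_measurable \<mu>" for t by (simp add: F_def)
  have F_int: "(\<integral>\<^sup>+ u. F t u * indicator B u \<partial>\<mu>) = emeasure p {z \<in> space p. fst z \<in> B \<and> e z \<le> t}"
    if B[measurable]: "B \<in> sets \<mu>" for t B
  proof -
    have "absolutely_continuous \<mu> (\<nu> t)"
      unfolding absolutely_continuous_def
    proof
      fix A assume A: "A \<in> null_sets \<mu>"
      then have [measurable]: "A \<in> sets \<mu>" by auto
      have "emeasure (\<nu> t) A \<le> emeasure p {z \<in> space p. fst z \<in> A}"
        by (auto simp: \<nu>_eq intro!: emeasure_mono)
      then show "A \<in> null_sets (\<nu> t)"
        using A \<mu>_eq[of A] by (auto simp: null_sets_def \<nu>_def)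
    qed
    then have "density \<mu> (F t) = \<nu> t"
      unfolding F_def by (rule \<mu>.density_RN_deriv) (simp add: \<nu>_def)
    then show ?thesis
      using \<nu>_eq[OF B] by (simp flip: emeasure_density add: \<nu>_eq)
  qed
  have F_fin: "(\<integral>\<^sup>+ u. F t u \<partial>\<mu>) < \<infinity>" for t
  proof -
    have "(\<integral>\<^sup>+ u. F t u \<partial>\<mu>) = (\<integral>\<^sup>+ u. F t u * indicator (space \<mu>) u \<partial>\<mu>)"
      by (intro nn_integral_cong) simp
    also have "\<dots> = emeasure p {z \<in> space p. fst z \<in> space \<mu> \<and> e z \<le> t}"
      by (rule F_int) simp
    also have "\<dots> < \<infinity>" by (simp add: p.emeasure_eq_measure)
    finally show ?thesis .
  qed
  have F_mono: "AE u in \<mu>. F s u \<le> F t u" if "s \<le> t" for s t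
  proof (rule AE_le_of_set_nn_integral_le[OF _ _ F_fin])
    show "(\<integral>\<^sup>+ u. F s u * indicator B u \<partial>\<mu>) \<le> (\<integral>\<^sup>+ u. F t u * indicator B u \<partial>\<mu>)" if [measurable]: "B \<in> sets \<mu>" for B
      unfolding F_int[OF that] using \<open>s \<le> t\<close> by (intro emeasure_mono) auto
  qed simp_all
  have F_le1: "AE u in \<mu>. F t u \<le> 1" for t
  proof (rule AE_le_of_set_nn_integral_le[OF _ _ F_fin])
    fix B assume B[measurable]: "B \<in> sets \<mu>"
    have "(\<integral>\<^sup>+ u. F t u * indicator B u \<partial>\<mu>) \<le> emeasure p {z \<in> space p. fst z \<in> B}"
      unfolding F_int[OF B] by (intro emeasure_mono) auto
    then show "(\<integral>\<^sup>+ u. F t u * indicator B u \<partial>\<mu>) \<le> (\<integral>\<^sup>+ u. 1 * indicator B u \<partial>\<mu>)"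
      by (simp add: \<mu>_eq)
  qed simp_all
  \<comment> \<open>Clipping makes the bounds hold at every \<open>u\<close>; for the derivatives
    themselves they hold only almost everywhere.\<close>
  define f where "f t u = enn2real (min 1 (F t u))" for t u
  have f01: "0 \<le> f t u" "f t u \<le> 1" for t u
    unfolding f_def by (auto intro!: enn2real_leI)
  have [measurable]: "f t \<in> borel_measurable \<mu>" for t unfolding f_def[abs_def] by measurable
  have f_F: "AE u in \<mu>. ennreal (f t u) = F t u" for t
    using F_le1[of t]
  proof eventually_elim
    case (elim u)
    then have "F t u < top" by (rule le_less_trans) simp
    with elim show ?case by (simp add: f_def min_absorb2 ennreal_enn2real)
  qed
  have f_int: "(\<integral>\<^sup>+ u. ennreal (f t u) * indicator B u \<partial>\<mu>) = emeasure p {z \<in> space p. fst z \<in> B \<and> e z \<le> t}"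
    if "B \<in> sets \<mu>" for t B
    using f_F[of t] by (subst F_int[OF that, symmetric]) (intro nn_integral_cong_AE, auto)
  \<comment> \<open>Since \<open>e\<close> lies in the half-open unit interval, the values 0 below 0
    and 1 from 1 on are correct. They give the limits at both infinities for every \<open>u\<close>,
    without an exceptional null set.\<close>
  define c where "c u t = (if t < 0 then 0 else if 1 \<le> t then 1 else (INF q\<in>{q\<in>\<rat>. t < q}. f q u))" for u t
  have ne: "{q\<in>\<rat>. t < q} \<noteq> {}" for t :: real
    using Rats_dense_in_real[of t "t + 1"] by auto
  have bdd: "bdd_below ((\<lambda>q. f q u) ` Q)" for u Q
    using f01 by (auto intro!: bdd_belowI2)
  have c01: "0 \<le> c u t" "c u t \<le> 1" for u t
  proof -
    obtain q where q: "q \<in> {q\<in>\<rat>. t < q}" using ne[of t] by blast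
    show "0 \<le> c u t" using f01 ne[of t] by (auto simp: c_def intro!: cINF_greatest)
    have "(INF q\<in>{q\<in>\<rat>. t < q}. f q u) \<le> f q u" by (rule cINF_lower[OF bdd q])
    then show "c u t \<le> 1" using f01(2)[of q u] by (auto simp: c_def)
  qed
  have c_mono: "c u s \<le> c u t" if "s \<le> t" for u s t
  proof (cases "s < 0 \<or> 1 \<le> t")
    case True
    then show ?thesis using c01[of u t] c01[of u s] that by (auto simp: c_def)
  next
    case False
    then show ?thesis
      unfolding c_def using that by (auto intro!: cINF_superset_mono[OF ne bdd])
  qed
  have c_rc: "continuous (at_right t) (c u)" for u t
  proof -
    have rc: "\<exists>b>t. \<forall>y. t < y \<and> y < b \<longrightarrow> c u y < c u t + \<epsilon>" if "0 < \<epsilon>" for \<epsilon>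
    proof (cases "t < 0 \<or> 1 \<le> t")
      case True
      show ?thesis
      proof (cases "t < 0")
        case True
        then show ?thesis using that by (intro exI[of _ 0]) (auto simp: c_def)
      next
        case False
        then show ?thesis using True that by (intro exI[of _ "t + 1"]) (auto simp: c_def)
      qed
    next
      case False
      then have "(INF q\<in>{q\<in>\<rat>. t < q}. f q u) < c u t + \<epsilon>" using that by (simp add: c_def)
      then obtain q where q: "q \<in> \<rat>" "t < q" "f q u < c u t + \<epsilon>"
        using cINF_less_iff[OF ne bdd] by auto
      show ?thesis
      proof (intro exI[of _ "min q 1"] conjI allI impI)
        fix y assume "t < y \<and> y < min q 1"
        then have "c u y = (INF q\<in>{q\<in>\<rat>. y < q}. f q u)" "y < q" using False by (auto simp: c_def)
        then have "c u y \<le> f q u" using q by (auto intro!: cINF_lower bdd)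
        then show "c u y < c u t + \<epsilon>" using q by simp
      qed (use False q in auto)
    qed
    have "\<forall>\<^sub>F y in at_right t. c u y < a" if "c u t < a" for a
      using rc[of "a - c u t"] that by (auto simp: eventually_at_right_field)
    moreover have "\<forall>\<^sub>F y in at_right t. a < c u y" if "a < c u t" for a
      using eventually_at_right_less[of t] by eventually_elim (use that c_mono[of t _ u] in \<open>force intro: less_le_trans\<close>)
    ultimately show ?thesis
      unfolding continuous_within by (intro order_tendstoI)
  qed
  have c_bot: "(c u \<longlongrightarrow> 0) at_bot" for u
    using eventually_le_at_bot[of "- 1 :: real"]
    by (intro tendsto_eventually, eventually_elim) (simp add: c_def)
  have c_top: "(c u \<longlongrightarrow> 1) at_top" for u
    using eventually_ge_at_top[of "1::real"]
    by (intro tendsto_eventually, eventually_elim) (simp add: c_def)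
  have [measurable]: "(\<lambda>u. c u t) \<in> borel_measurable \<mu>" for t
  proof -
    have "(\<lambda>u. INF q\<in>{q\<in>\<rat>. t < q}. f q u) \<in> borel_measurable \<mu>"
      by (rule borel_measurable_cINF) (auto intro!: bdd countable_subset[OF _ countable_rat])
    then show ?thesis unfolding c_def by simp
  qed
  define k where "k u = interval_measure (c u)" for u
  have k_Iic: "emeasure (k u) {..t} = ennreal (c u t)" for u t
    unfolding k_def by (rule emeasure_interval_measure_Iic[OF c_mono c_rc c_bot])
  have k_prob: "prob_space (k u)" for u
  proof -
    interpret real_distribution "k u"
      unfolding k_def by (rule real_distribution_interval_measure[OF c_mono c_rc c_bot c_top])
    show ?thesis by (rule prob_space_axioms)
  qed
  have k[measurable]: "k \<in> measurable \<mu> (prob_algebra borel)"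
  proof (rule measurable_prob_algebra_generated[where \<Omega>=UNIV and G="range atMost"])
    show "sets borel = sigma_sets UNIV (range (atMost :: real \<Rightarrow> _))"
      by (subst borel_eq_atMost) simp
    show "Int_stable (range (atMost :: real \<Rightarrow> _))"
      by (auto simp: Int_stable_def)
    show "(\<lambda>u. emeasure (k u) A) \<in> borel_measurable \<mu>" if "A \<in> range atMost" for A
      using that by (auto simp: k_Iic)
  qed (auto simp: k_prob, auto simp: k_def)
  have c_int: "(\<integral>\<^sup>+ u. ennreal (c u t) * indicator B u \<partial>\<mu>) = emeasure p {z \<in> space p. fst z \<in> B \<and> e z \<le> t}"
    if B[measurable]: "B \<in> sets \<mu>" for t B
  proof (cases "t < 0 \<or> 1 \<le> t")
    case True
    show ?thesis
    proof (cases "t < 0")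
      case True
      then have none: "\<not> e z \<le> t" for z using e01(1)[of z] by linarith
      show ?thesis using True by (simp add: c_def none)
    next
      case False
      then have all: "e z \<le> t" for z using True e01(2)[of z] by linarith
      show ?thesis using False True by (simp add: c_def all \<mu>_eq)
    qed
  next
    case False
    then have c: "c u t = (INF q\<in>{q\<in>\<rat>. t < q}. f q u)" for u by (simp add: c_def)
    show ?thesis
    \<comment> \<open>Upper bound: rational thresholds just above \<open>t\<close>, and continuity
      of \<open>p\<close> from above. Lower bound: there are countably many rationals
      \<open>q > t\<close>, so almost surely \<open>F t\<close> is below all \<open>F q\<close> at
      once.\<close>
    proof (rule antisym)
      have up: "(\<integral>\<^sup>+ u. ennreal (c u t) * indicator B u \<partial>\<mu>) \<le>
          emeasure p {z \<in> space p. fst z \<in> B \<and> e z \<le> t + 1 / Suc n}" for n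
      proof -
        obtain q where q: "q \<in> \<rat>" "t < q" "q < t + 1 / Suc n"
          using Rats_dense_in_real[of t "t + 1 / Suc n"] by auto
        have "c u t \<le> f q u" for u
          unfolding c using q by (intro cINF_lower bdd) auto
        then have "(\<integral>\<^sup>+ u. ennreal (c u t) * indicator B u \<partial>\<mu>) \<le> (\<integral>\<^sup>+ u. ennreal (f q u) * indicator B u \<partial>\<mu>)"
          by (intro nn_integral_mono mult_right_mono ennreal_leI) auto
        also have "\<dots> = emeasure p {z \<in> space p. fst z \<in> B \<and> e z \<le> q}" by (rule f_int[OF B])
        also have "\<dots> \<le> emeasure p {z \<in> space p. fst z \<in> B \<and> e z \<le> t + 1 / Suc n}"
          using q by (intro emeasure_mono) auto
        finally show ?thesis .
      qed
      define D where "D n = {z \<in> space p. fst z \<in> B \<and> e z \<le> t + 1 / Suc n}" for n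
      have [measurable]: "D n \<in> sets p" for n unfolding D_def by measurable
      have "decseq D"
      proof (rule decseq_SucI)
        fix n
        have "1 / real (Suc (Suc n)) \<le> 1 / real (Suc n)" by (intro divide_left_mono) auto
        then show "D (Suc n) \<subseteq> D n" unfolding D_def by auto
      qed
      then have "(\<lambda>n. emeasure p (D n)) \<longlonglongrightarrow> emeasure p (\<Inter>n. D n)"
        by (intro Lim_emeasure_decseq) (auto simp: p.emeasure_eq_measure)
      also have "(\<Inter>n. D n) = {z \<in> space p. fst z \<in> B \<and> e z \<le> t}"
      proof -
        have "e z \<le> t" if "\<And>n. e z \<le> t + 1 / Suc n" for z
        proof -
          have "(\<lambda>n. t + 1 / real (Suc n)) \<longlonglongrightarrow> t + 0"
            using lim_inverse_n' by (intro tendsto_intros LIMSEQ_Suc[OF lim_1_over_n])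
          then show ?thesis using that by (intro LIMSEQ_le_const[of _ t]) auto
        qed
        moreover have "e z \<le> t + 1 / Suc n" if "e z \<le> t" for z n
          using that by (simp add: add_increasing2)
        ultimately show ?thesis unfolding D_def by blast
      qed
      finally show "(\<integral>\<^sup>+ u. ennreal (c u t) * indicator B u \<partial>\<mu>) \<le> emeasure p {z \<in> space p. fst z \<in> B \<and> e z \<le> t}"
        using up by (intro LIMSEQ_le_const) (auto simp: D_def)
    next
      have "AE u in \<mu>. \<forall>q\<in>{q\<in>\<rat>. t < q}. F t u \<le> F q u"
        by (subst AE_ball_countable) (auto intro!: F_mono countable_subset[OF _ countable_rat])
      then have "AE u in \<mu>. f t u \<le> c u t"
      proof eventually_elim
        case (elim u)
        then show ?case
          unfolding c f_def
          by (intro cINF_greatest[OF ne] enn2real_mono min.mono) (auto simp: min_less_iff_disj)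
      qed
      then have "(\<integral>\<^sup>+ u. ennreal (f t u) * indicator B u \<partial>\<mu>) \<le> (\<integral>\<^sup>+ u. ennreal (c u t) * indicator B u \<partial>\<mu>)"
        by (intro nn_integral_mono_AE) (auto simp: indicator_def ennreal_leI)
      then show "emeasure p {z \<in> space p. fst z \<in> B \<and> e z \<le> t} \<le> (\<integral>\<^sup>+ u. ennreal (c u t) * indicator B u \<partial>\<mu>)"
        by (simp add: f_int)
    qed
  qed
  have "emeasure p {z \<in> space p. fst z \<in> B \<and> e z \<in> C} = (\<integral>\<^sup>+ u\<in>B. emeasure (k u) C \<partial>\<mu>)"
    if B[measurable]: "B \<in> sets \<mu>" and C[measurable]: "C \<in> sets borel" for B C
  proof -
    \<comment> \<open>For fixed \<open>B\<close> both sides are finite measures in \<open>C\<close>.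
      They agree on closed lower half-lines and on the whole line, hence on open upper half-lines,
      which determine them.\<close>
    define N1 where "N1 = distr (density p (\<lambda>z. indicator B (fst z))) borel e"
    define N2 where "N2 = density \<mu> (indicator B) \<bind> k"
    have ne: "space \<mu> \<noteq> {}" by (rule \<mu>.not_empty)
    have k': "k \<in> measurable (density \<mu> (indicator B)) (subprob_algebra borel)"
      using measurable_prob_algebraD[OF k] by simp
    have N1: "emeasure N1 C = emeasure p {z \<in> space p. fst z \<in> B \<and> e z \<in> C}" if [measurable]: "C \<in> sets borel" for C
    proof -
      have "emeasure N1 C = (\<integral>\<^sup>+ z. indicator B (fst z) * indicator (e -` C \<inter> space p) z \<partial>p)"
        unfolding N1_def by (simp add: emeasure_distr emeasure_density)
      also have "\<dots> = (\<integral>\<^sup>+ z. indicator {z \<in> space p. fst z \<in> B \<and> e z \<in> C} z \<partial>p)"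
        by (intro nn_integral_cong) (auto simp: indicator_def)
      finally show ?thesis by simp
    qed
    have N2: "emeasure N2 C = (\<integral>\<^sup>+ u. emeasure (k u) C * indicator B u \<partial>\<mu>)" if [measurable]: "C \<in> sets borel" for C
    proof -
      have [measurable]: "(\<lambda>u. emeasure (k u) C) \<in> borel_measurable \<mu>"
        by (rule measurable_compose[OF measurable_prob_algebraD[OF k]]) measurable
      show ?thesis
        unfolding N2_def using ne
        by (subst emeasure_bind[OF _ k' that]) (simp_all add: nn_integral_density mult.commute)
    qed
    have sets: "sets N1 = sets borel" "sets N2 = sets borel"
      by (auto simp: N1_def N2_def ne intro!: sets_bind[OF sets_kernel[OF k']])
    have Iic: "emeasure N1 {..t} = emeasure N2 {..t}" for t
      by (simp add: N1 N2 k_Iic c_int)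
    have UN: "emeasure N1 UNIV = emeasure N2 UNIV"
    proof -
      have "emeasure (k u) UNIV = 1" for u
        using prob_space.emeasure_space_1[OF k_prob, of u] by (simp add: k_def)
      then show ?thesis by (simp add: N1 N2 \<mu>_eq)
    qed
    have fin: "emeasure N1 D < \<infinity>" for D
    proof -
      have "emeasure N1 D \<le> emeasure N1 (space N1)" by (rule emeasure_space)
      also have "space N1 = UNIV" by (simp add: N1_def)
      also have "emeasure N1 UNIV < \<infinity>" by (simp add: N1 p.emeasure_eq_measure)
      finally show ?thesis .
    qed
    have "N1 = N2"
    proof (rule measure_eqI_lessThan[OF sets fin])
      fix x :: real
      have x: "{x<..} = UNIV - {..x}" by auto
      have "emeasure N1 {x<..} = emeasure N1 UNIV - emeasure N1 {..x}"
        unfolding x using fin[of "{..x}"] by (intro emeasure_Diff) (auto simp: sets)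
      also have "\<dots> = emeasure N2 UNIV - emeasure N2 {..x}"
        by (simp add: Iic UN)
      also have "\<dots> = emeasure N2 {x<..}"
        unfolding x using fin[of "{..x}"] by (intro emeasure_Diff[symmetric]) (auto simp: sets Iic)
      finally show "emeasure N1 {x<..} = emeasure N2 {x<..}" .
    qed
    then show ?thesis using N1[OF C] N2[OF C] by simp
  qed
  then show ?thesis using k by blast
qed

text \<open>The second component is encoded as a real number, its conditional law is found on the
  real line, and that law is pushed back by the decoder \<open>d\<close>. The message space enters
  only as a measurable space.\<close>

lemma disintegration:
  fixes p :: "('u \<times> 'x::{banach, second_countable_topology}) measure"
  assumes p: "prob_space p" and sets: "sets p = sets (S \<Otimes>\<^sub>M borel)"
  shows "\<exists>k \<in> measurable (distr p S fst) (prob_algebra borel). p = joint_law (distr p S fst) k"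
proof -
  note [measurable_cong] = sets
  interpret p: prob_space p by fact
  define \<mu> where "\<mu> = distr p S fst"
  have [measurable_cong]: "sets \<mu> = sets S" by (simp add: \<mu>_def)
  interpret \<mu>: prob_space \<mu> unfolding \<mu>_def by (rule p.prob_space_distr) measurable
  obtain e :: "'x \<Rightarrow> real" and d where e[measurable]: "e \<in> borel_measurable borel"
    and d[measurable]: "d \<in> borel_measurable borel"
    and de: "\<And>x. d (e x) = x" and e01: "\<And>x. 0 \<le> e x" "\<And>x. e x < 1"
    using borel_embedding_real by blast
  have "\<exists>k \<in> measurable \<mu> (prob_algebra borel). \<forall>B\<in>sets \<mu>. \<forall>C\<in>sets borel.
    emeasure p {z \<in> space p. fst z \<in> B \<and> e (snd z) \<in> C} = (\<integral>\<^sup>+ u\<in>B. emeasure (k u) C \<partial>\<mu>)"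
  proof (rule real_disintegration[OF p])
    show "fst \<in> measurable p \<mu>" by measurable
    show "distr p \<mu> fst = \<mu>" unfolding \<mu>_def by (rule distr_cong) simp_all
    show "(\<lambda>z. e (snd z)) \<in> borel_measurable p" by measurable
  qed (use e01 in auto)
  then obtain k where k[measurable]: "k \<in> measurable \<mu> (prob_algebra borel)" and
    kp: "\<And>B C. B \<in> sets \<mu> \<Longrightarrow> C \<in> sets borel \<Longrightarrow>
      emeasure p {z \<in> space p. fst z \<in> B \<and> e (snd z) \<in> C} = (\<integral>\<^sup>+ u\<in>B. emeasure (k u) C \<partial>\<mu>)"
    by blast
  define k' where "k' u = distr (k u) borel d" for u
  have k'[measurable]: "k' \<in> measurable \<mu> (prob_algebra borel)"
    unfolding k'_def by (rule measurable_distr_prob_space2[where M=borel]) measurable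
  note J = sets_joint_law[OF \<mu>.prob_space_axioms k'] prob_space_joint_law[OF \<mu>.prob_space_axioms k']
  have "p = joint_law \<mu> k'"
  proof (rule measure_eqI_generator_eq[OF Int_stable_pair_measure_generator[of S borel],
        where \<Omega>="space S \<times> space borel" and A="\<lambda>_. space S \<times> UNIV"])
    show "{a \<times> b |a b. a \<in> sets S \<and> b \<in> sets borel} \<subseteq> Pow (space S \<times> space borel)"
      using sets.space_closed by fastforce
    show "sets p = sigma_sets (space S \<times> space borel) {a \<times> b |a b. a \<in> sets S \<and> b \<in> sets borel}"
      unfolding sets by (rule sets_pair_measure)
    show "sets (joint_law \<mu> k') = sigma_sets (space S \<times> space borel) {a \<times> b |a b. a \<in> sets S \<and> b \<in> sets borel}"
      unfolding J(1) by (subst sets_pair_measure_cong[of \<mu> S borel borel]) (simp_all add: \<mu>_def sets_pair_measure)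
    show "emeasure p X = emeasure (joint_law \<mu> k') X" if "X \<in> {a \<times> b |a b. a \<in> sets S \<and> b \<in> sets borel}" for X
    proof -
      from that obtain B C where X: "X = B \<times> C" and B[measurable]: "B \<in> sets S" and C[measurable]: "C \<in> sets borel"
        by auto
      have Xp: "X \<in> sets p" by (simp add: sets X)
      \<comment> \<open>Since \<open>d (e x) = x\<close>, membership in \<open>C\<close> is an event
        about the code of \<open>x\<close>.\<close>
      have "X = {z \<in> space p. fst z \<in> B \<and> e (snd z) \<in> d -` C}"
        using sets.sets_into_space[OF Xp] by (auto simp: X de)
      then have "emeasure p X = (\<integral>\<^sup>+ u\<in>B. emeasure (k u) (d -` C) \<partial>\<mu>)"
        using kp[of B "d -` C"] measurable_sets[OF d C] by (simp add: \<mu>_def)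
      also have "\<dots> = (\<integral>\<^sup>+ u. \<integral>\<^sup>+ x. indicator X (u, x) \<partial>k' u \<partial>\<mu>)"
      proof (intro nn_integral_cong)
        fix u assume u: "u \<in> space \<mu>"
        have ku: "sets (k u) = sets borel" and k'u: "sets (k' u) = sets borel"
          using measurable_space[OF k u] by (auto simp: space_prob_algebra k'_def)
        have "(\<integral>\<^sup>+ x. indicator X (u, x) \<partial>k' u) = (\<integral>\<^sup>+ x. indicator B u * indicator C x \<partial>k' u)"
          by (intro nn_integral_cong) (simp add: X indicator_times)
        also have "\<dots> = indicator B u * emeasure (k' u) C"
          using k'u by (subst nn_integral_cmult) (auto cong: measurable_cong_sets)
        also have "emeasure (k' u) C = emeasure (k u) (d -` C)"
          unfolding k'_def using ku d by (subst emeasure_distr) (auto simp: sets_eq_imp_space_eq[OF ku] cong: measurable_cong_sets)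
        finally show "emeasure (k u) (d -` C) * indicator B u = (\<integral>\<^sup>+ x. indicator X (u, x) \<partial>k' u)"
          by (simp add: mult.commute)
      qed
      also have "\<dots> = (\<integral>\<^sup>+ z. indicator X z \<partial>joint_law \<mu> k')"
        by (rule nn_integral_joint_law[symmetric, OF \<mu>.prob_space_axioms k']) (simp add: X)
      also have "\<dots> = emeasure (joint_law \<mu> k') X"
        by (intro nn_integral_indicator) (simp add: J X)
      finally show ?thesis .
    qed
    show "range (\<lambda>_::nat. space S \<times> UNIV) \<subseteq> {a \<times> b |a b. a \<in> sets S \<and> b \<in> sets (borel :: 'x measure)}"
      by (intro image_subsetI CollectI exI[of _ "space S"] exI[of _ "UNIV :: 'x set"]) simp
  qed (auto simp: p.emeasure_eq_measure)
  then show ?thesis using k' unfolding \<mu>_def by blast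
qed

section \<open>Comparison of channels\<close>

lemma extended_expectation_enn2ereal:
  "extended_expectation M (\<lambda>\<omega>. enn2ereal (f \<omega>)) = enn2ereal (\<integral>\<^sup>+ \<omega>. f \<omega> \<partial>M)"
  by (simp add: extended_expectation_def e2ennreal_neg zero_ennreal.rep_eq)

abbreviation input_information :: "'u measure \<Rightarrow> ('u \<Rightarrow> (complex ^ 'n) measure) \<Rightarrow> complex ^ 'n ^ 'm \<Rightarrow> ennreal" where
  "input_information \<mu> k A \<equiv> \<integral>\<^sup>+ u. output_divergence A (k u) (\<mu> \<bind> k) \<partial>\<mu>"

lemma input_distribution_joint_law:
  assumes "prob_space \<mu>" "k \<in> measurable \<mu> laws"
  shows "input_distribution \<mu> (joint_law \<mu> k)"
  unfolding input_distribution_def using prob_space_joint_law[OF assms] sets_joint_law[OF assms] by simp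

text \<open>Informations are nonnegative, so both expectations in the hypothesis are plain integrals
  in \<open>ennreal\<close>. The \<sigma>-algebra on the message type is chosen as that of
  \<mu>.\<close>

lemma less_noisy_on_averageD:
  fixes \<mu> :: "'u measure" and k :: "'u \<Rightarrow> (complex ^ 'n) measure"
  assumes "less_noisy_on_average TYPE('u) M H G" and "prob_space \<mu>" "k \<in> measurable \<mu> laws"
  shows "(\<integral>\<^sup>+ \<omega>. input_information \<mu> k (G \<omega>) \<partial>M) \<le> (\<integral>\<^sup>+ \<omega>. input_information \<mu> k (H \<omega>) \<partial>M)"
proof -
  have "extended_expectation M (\<lambda>\<omega>. instantaneous_information \<mu> (joint_law \<mu> k) (G \<omega>)) \<le>
      extended_expectation M (\<lambda>\<omega>. instantaneous_information \<mu> (joint_law \<mu> k) (H \<omega>))"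
    using assms(1) input_distribution_joint_law[OF assms(2,3)] unfolding less_noisy_on_average_def by blast
  then show ?thesis
    by (simp add: instantaneous_information_joint_law[OF assms(2) refl assms(3)] extended_expectation_enn2ereal
        less_eq_ennreal.rep_eq)
qed

text \<open>A message that equals \<open>a\<close> with small probability \<open>\<lambda>\<close> and \<open>b\<close> otherwise, with input law \<open>P\<close> given \<open>a\<close>
  and \<open>Q\<close> given \<open>b\<close>, carries information about \<open>\<lambda>\<close> times the divergence of the two output laws.\<close>

lemma binary_input_information:
  fixes A :: "complex ^ 'n ^ 'm" and a b :: 'u
  assumes "a \<noteq> b" and P: "P \<in> space laws" and Q: "Q \<in> space laws" and l: "0 < l" "l < 1"
    and \<mu>_def: "\<mu> = measure_pmf (map_pmf (\<lambda>t. if t then a else b) (bernoulli_pmf l))"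
    and k_def: "k = (\<lambda>u. if u = a then P else Q)"
  shows "input_information \<mu> k A \<le> ennreal l * output_divergence A P Q"
    and "ennreal l * output_divergence A P (\<mu> \<bind> k) \<le> input_information \<mu> k A"
    and "output_density A (\<mu> \<bind> k) y = l * output_density A P y + (1 - l) * output_density A Q y"
proof -
  have prob: "prob_space \<mu>" unfolding \<mu>_def by (rule prob_space_measure_pmf)
  have k: "k \<in> measurable \<mu> laws"
    unfolding \<mu>_def k_def using P Q by (auto simp: measurable_def space_prob_algebra)
  have nn: "(\<integral>\<^sup>+ u. f u \<partial>\<mu>) = f a * ennreal l + f b * ennreal (1 - l)" for f :: "'u \<Rightarrow> ennreal"
    unfolding \<mu>_def using l by simp
  have k': "k a = P" "k b = Q" using \<open>a \<noteq> b\<close> by (auto simp: k_def)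
  \<comment> \<open>The compensation identity with reference \<open>Q\<close>: the message
    \<open>b\<close> contributes nothing on the left, since its input law is \<open>Q\<close>
    itself.\<close>
  have "ennreal l * output_divergence A P Q =
      input_information \<mu> k A + output_divergence A (\<mu> \<bind> k) Q"
    using output_divergence_compensation[OF prob k Q, of A] by (simp add: nn k' Q mult.commute)
  then show "input_information \<mu> k A \<le> ennreal l * output_divergence A P Q"
    by simp
  \<comment> \<open>Only the contribution of \<open>b\<close>, which is nonnegative, is
    dropped.\<close>
  show "ennreal l * output_divergence A P (\<mu> \<bind> k) \<le> input_information \<mu> k A"
    by (simp add: nn k' mult.commute)
  show "output_density A (\<mu> \<bind> k) y = l * output_density A P y + (1 - l) * output_density A Q y"
    unfolding output_density_bind[OF prob k] unfolding \<mu>_def using l by (simp add: k' mult.commute)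
qed

text \<open>The information of the binary message is bounded above for \<open>H\<close> by
  \<open>l\<close> times the divergence from \<open>Q\<close>, and below for \<open>G\<close> by
  \<open>l\<close> times the divergence from the mixture. After division by \<open>l\<close>, the
  mixture tends to \<open>Q\<close>, and lower semicontinuity on the side of \<open>G\<close> is
  enough, also for infinite values.\<close>

lemma less_noisy_output_divergence:
  fixes H :: "'w \<Rightarrow> complex ^ 'n ^ 'b" and G :: "'w \<Rightarrow> complex ^ 'n ^ 'e" and a b :: 'u
  assumes ln: "less_noisy_on_average TYPE('u) M H G" and "a \<noteq> b"
    and [measurable]: "H \<in> borel_measurable M" "G \<in> borel_measurable M"
    and P[measurable]: "P \<in> space laws" and Q[measurable]: "Q \<in> space laws"
  shows "(\<integral>\<^sup>+ \<omega>. output_divergence (G \<omega>) P Q \<partial>M) \<le> (\<integral>\<^sup>+ \<omega>. output_divergence (H \<omega>) P Q \<partial>M)"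
proof -
  \<comment> \<open>The shift by 2 keeps every \<open>l n\<close> strictly between 0 and 1.\<close>
  define l where "l n = 1 / real (n + 2)" for n
  have l: "0 < l n" "l n < 1" for n by (auto simp: l_def)
  have l0: "l \<longlonglongrightarrow> 0"
    unfolding l_def using LIMSEQ_ignore_initial_segment[OF lim_1_over_n, of 2] by simp
  define \<mu> where "\<mu> n = measure_pmf (map_pmf (\<lambda>t. if t then a else b) (bernoulli_pmf (l n)))" for n
  define k where "k = (\<lambda>u. if u = a then P else Q)"
  note B = binary_input_information[OF \<open>a \<noteq> b\<close> P Q l \<mu>_def k_def]
  have prob: "prob_space (\<mu> n)" for n unfolding \<mu>_def by (rule prob_space_measure_pmf)
  have k: "k \<in> measurable (\<mu> n) laws" for n
    unfolding \<mu>_def k_def using P Q by (auto simp: measurable_def space_prob_algebra)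
  define mix where "mix n = \<mu> n \<bind> k" for n
  have mix[measurable]: "mix n \<in> space laws" for n unfolding mix_def by (rule bind_in_laws[OF prob k])
  \<comment> \<open>The mixture densities converge pointwise to a positive limit, so the nonnegative
    integrands converge. Fatou's lemma is used here over outputs and once more below over
    channels.\<close>
  have Fatou: "output_divergence A P Q \<le> liminf (\<lambda>n. output_divergence A P (mix n))" for A :: "complex ^ 'n ^ 'e"
  proof -
    have "output_divergence A P Q =
      (\<integral>\<^sup>+ y. liminf (\<lambda>n. ennreal (kl_term (output_density A P y) (output_density A (mix n) y))) \<partial>lborel)"
      unfolding output_divergence_def
    proof (intro nn_integral_cong)
      fix y
      have "(\<lambda>n. output_density A (mix n) y) \<longlonglongrightarrow> 0 * output_density A P y + (1 - 0) * output_density A Q y"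
        unfolding mix_def B(3) by (intro tendsto_intros l0)
      then have "(\<lambda>n. kl_term (output_density A P y) (output_density A (mix n) y)) \<longlonglongrightarrow>
          kl_term (output_density A P y) (output_density A Q y)"
        unfolding kl_term_def using output_density_pos[OF P, of A y] output_density_pos[OF Q, of A y]
        by (intro tendsto_intros) auto
      then have "(\<lambda>n. ennreal (kl_term (output_density A P y) (output_density A (mix n) y))) \<longlonglongrightarrow>
          ennreal (kl_term (output_density A P y) (output_density A Q y))"
        by (rule tendsto_ennrealI)
      then show "ennreal (kl_term (output_density A P y) (output_density A Q y)) =
          liminf (\<lambda>n. ennreal (kl_term (output_density A P y) (output_density A (mix n) y)))"
        by (intro lim_imp_Liminf[symmetric]) simp_all
    qed
    also have "\<dots> \<le> liminf (\<lambda>n. output_divergence A P (mix n))"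
      unfolding output_divergence_def by (rule nn_integral_liminf) measurable
    finally show ?thesis .
  qed
  have bound: "(\<integral>\<^sup>+ \<omega>. output_divergence (G \<omega>) P (mix n) \<partial>M) \<le> (\<integral>\<^sup>+ \<omega>. output_divergence (H \<omega>) P Q \<partial>M)" for n
  proof -
    have "ennreal (l n) * (\<integral>\<^sup>+ \<omega>. output_divergence (G \<omega>) P (mix n) \<partial>M) =
        (\<integral>\<^sup>+ \<omega>. ennreal (l n) * output_divergence (G \<omega>) P (mix n) \<partial>M)"
      by (rule nn_integral_cmult[symmetric]) measurable
    also have "\<dots> \<le> (\<integral>\<^sup>+ \<omega>. input_information (\<mu> n) k (G \<omega>) \<partial>M)"
      unfolding mix_def by (intro nn_integral_mono B)
    also have "\<dots> \<le> (\<integral>\<^sup>+ \<omega>. input_information (\<mu> n) k (H \<omega>) \<partial>M)"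
      by (rule less_noisy_on_averageD[OF ln prob k])
    also have "\<dots> \<le> (\<integral>\<^sup>+ \<omega>. ennreal (l n) * output_divergence (H \<omega>) P Q \<partial>M)"
      by (intro nn_integral_mono B)
    also have "\<dots> = ennreal (l n) * (\<integral>\<^sup>+ \<omega>. output_divergence (H \<omega>) P Q \<partial>M)"
      by (rule nn_integral_cmult) measurable
    finally show ?thesis
      using l[of n] by (subst (asm) ennreal_mult_le_mult_iff) auto
  qed
  have "(\<integral>\<^sup>+ \<omega>. output_divergence (G \<omega>) P Q \<partial>M) \<le>
      (\<integral>\<^sup>+ \<omega>. liminf (\<lambda>n. output_divergence (G \<omega>) P (mix n)) \<partial>M)"
    by (intro nn_integral_mono Fatou)
  also have "\<dots> \<le> liminf (\<lambda>n. \<integral>\<^sup>+ \<omega>. output_divergence (G \<omega>) P (mix n) \<partial>M)"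
    by (rule nn_integral_liminf) measurable
  also have "\<dots> \<le> liminf (\<lambda>n. \<integral>\<^sup>+ \<omega>. output_divergence (H \<omega>) P Q \<partial>M)"
    by (intro Liminf_mono always_eventually allI bound)
  finally show ?thesis by (simp add: Liminf_const)
qed

section \<open>Gaussian inputs\<close>

lemma standard_complex_gaussian_shifted:
  "distr (standard_complex_gaussian :: (complex ^ 'm) measure) borel ((+) c) =
    density lborel (\<lambda>y. ennreal (gaussian_density (y - c)))"
proof (rule measure_eqI)
  fix B assume "B \<in> sets (distr (standard_complex_gaussian :: (complex ^ 'm) measure) borel ((+) c))"
  then have [measurable]: "B \<in> sets borel" by simp
  have "emeasure (distr standard_complex_gaussian borel ((+) c)) B = (\<integral>\<^sup>+ w. indicator B (c + w) \<partial>standard_complex_gaussian)"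
    by (subst nn_integral_distr[symmetric, of "(+) c" _ borel]) simp_all
  also have "\<dots> = emeasure (density lborel (\<lambda>y. ennreal (gaussian_density (y - c)))) B"
    by (simp add: nn_integral_standard_complex_gaussian_shift emeasure_density)
  finally show "emeasure (distr standard_complex_gaussian borel ((+) c)) B = \<dots>" .
qed simp

text \<open>Up to a constant, this difference is the log-ratio of the noise density to a Gaussian
  output density. The term linear in the noise has mean 0, and the identity covariance turns the
  quadratic terms into traces.\<close>

lemma expectation_quad_shift:
  fixes R :: "complex ^ 'm ^ 'm"
  assumes R: "R\<^sup>\<dagger> = R"
  shows "integrable standard_complex_gaussian (\<lambda>w. quad R (z + w) - (norm w)\<^sup>2)"
    and "(\<integral>w. quad R (z + w) - (norm w)\<^sup>2 \<partial>standard_complex_gaussian) = quad R z + Re (trace R) - CARD('m)"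
proof -
  let ?N = "standard_complex_gaussian :: (complex ^ 'm) measure"
  have V: "(\<integral>w. w $ a * cnj (w $ b) \<partial>?N) = (mat 1 :: complex ^ 'm ^ 'm) $ a $ b" for a b
    by (simp add: integral_standard_complex_gaussian_mult mat_def)
  note Q = integral_quad[where Q="?N" and v="\<lambda>w. w", OF integrable_standard_complex_gaussian_mult V]
  have n: "(norm w)\<^sup>2 = quad (mat 1) w" for w :: "complex ^ 'm"
    by (simp add: quad_def herm_self del: of_real_power)
  have lin: "integrable ?N (\<lambda>w. Re (herm w (R *v z)))" "(\<integral>w. Re (herm w (R *v z)) \<partial>?N) = 0"
  proof -
    have i: "integrable ?N (\<lambda>w. cnj (w $ i) * (R *v z) $ i)" for i
      by (intro integrable_mult_left integrable_cnj integrable_standard_complex_gaussian)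
    have h: "integrable ?N (\<lambda>w. herm w (R *v z))"
      unfolding herm_def by (intro Bochner_Integration.integrable_sum i)
    then show "integrable ?N (\<lambda>w. Re (herm w (R *v z)))" by (rule integrable_Re)
    have "(\<integral>w. Re (herm w (R *v z)) \<partial>?N) = Re (\<integral>w. herm w (R *v z) \<partial>?N)"
      using h by (rule integral_Re)
    also have "(\<integral>w. herm w (R *v z) \<partial>?N) = 0"
      unfolding herm_def using i
      by (simp add: Bochner_Integration.integral_sum integral_standard_complex_gaussian integrable_cnj
          integrable_standard_complex_gaussian)
    finally show "(\<integral>w. Re (herm w (R *v z)) \<partial>?N) = 0" by simp
  qed
  have e: "quad R (z + w) - (norm w)\<^sup>2 = quad R z + 2 * Re (herm w (R *v z)) + quad R w - quad (mat 1) w" for w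
    using quad_expand[OF R, of z 1 w] by (simp add: n)
  show "integrable ?N (\<lambda>w. quad R (z + w) - (norm w)\<^sup>2)"
    unfolding e by (intro Bochner_Integration.integrable_diff Bochner_Integration.integrable_add
        integrable_mult_right lin Q standard_complex_gaussian.integrable_const)
  have "(\<integral>w. quad R (z + w) - (norm w)\<^sup>2 \<partial>?N) = quad R z + Re (trace (R ** mat 1)) - Re (trace (mat 1 ** mat 1 :: complex ^ 'm ^ 'm))"
    unfolding e using lin Q standard_complex_gaussian.prob_space[where 'n='m] by simp
  then show "(\<integral>w. quad R (z + w) - (norm w)\<^sup>2 \<partial>?N) = quad R z + Re (trace R) - CARD('m)"
    by (simp add: trace_I)
qed

definition shifted_gaussian :: "complex ^ 'n \<Rightarrow> complex ^ 'n ^ 'n \<Rightarrow> (complex ^ 'n) measure" where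
  "shifted_gaussian m K = distr (complex_gaussian K) borel ((+) m)"

lemma shifted_gaussian_in_laws: "shifted_gaussian m K \<in> space laws"
proof -
  interpret prob_space "complex_gaussian K" by (rule prob_space_complex_gaussian)
  show ?thesis
    unfolding shifted_gaussian_def by (simp add: space_prob_algebra prob_space_distr)
qed

lemma shifted_gaussian_0: "shifted_gaussian 0 K = complex_gaussian K" for K :: "complex ^ 'a ^ 'a"
proof -
  have "(+) 0 = (\<lambda>x :: complex ^ 'a. x)" by (simp add: fun_eq_iff)
  then show ?thesis unfolding shifted_gaussian_def by (simp add: distr_id2)
qed

text \<open>The divergence of the noise shifted to \<open>A x\<close> from the Gaussian output law is quadratic in \<open>x\<close>.
  Its expectation therefore depends on the covariance of the input only.\<close>

lemma gaussian_output_divergence: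
  fixes K :: "complex ^ 'n ^ 'n" and A :: "complex ^ 'n ^ 'm"
  assumes P: "P \<in> space laws" and K: "hermitian_psd K"
    and int: "\<And>i j. integrable P (\<lambda>x. (x - m) $ i * cnj ((x - m) $ j))"
    and cov: "\<And>i j. (\<integral>x. (x - m) $ i * cnj ((x - m) $ j) \<partial>P) = K $ i $ j"
  shows "0 < gram_det K A" and "0 \<le> log 2 (gram_det K A)"
    and "(\<integral>\<^sup>+ x. output_divergence A (return borel x) (shifted_gaussian m K) \<partial>P) = ennreal (log 2 (gram_det K A))"
proof -
  interpret P: prob_space P by (rule lawsD[OF P])
  obtain R where RH: "R\<^sup>\<dagger> = R" and RS: "R ** (mat 1 + A ** K ** A\<^sup>\<dagger>) = mat 1" and pos: "0 < gram_det K A"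
    and I: "\<And>y. (\<integral>\<^sup>+ x. ennreal (gaussian_density (y - A *v x)) \<partial>complex_gaussian K) =
      ennreal (exp (- quad R y) / (pi ^ CARD('m) * gram_det K A))"
    using complex_gaussian_output_density[OF K, of A] by blast
  show "0 < gram_det K A" by (rule pos)
  define \<delta> where "\<delta> = gram_det K A"
  have \<delta>: "0 < \<delta>" using pos by (simp add: \<delta>_def)
  note sl = shifted_gaussian_in_laws[of m K]
  define q where "q y = exp (- quad R (y - A *v m)) / (pi ^ CARD('m) * \<delta>)" for y
  have qpos: "0 < q y" for y unfolding q_def using \<delta> by simp
  have od: "output_density A (shifted_gaussian m K) y = q y" for y
  proof -
    have "ennreal (output_density A (shifted_gaussian m K) y) =
        (\<integral>\<^sup>+ x. ennreal (gaussian_density (y - A *v (m + x))) \<partial>complex_gaussian K)"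
      unfolding ennreal_output_density[OF sl] by (subst shifted_gaussian_def, rule nn_integral_distr) measurable
    also have "\<dots> = ennreal (q y)"
      using I[of "y - A *v m"] by (simp add: q_def \<delta>_def matrix_vector_right_distrib diff_diff_eq)
    finally show ?thesis
      using qpos[of y] output_density_pos[OF sl, of A y] by simp
  qed
  have [measurable]: "q \<in> borel_measurable borel" unfolding q_def[abs_def] by measurable
  \<comment> \<open>The closed form, in bits, of the divergence of the noise law around
    \<open>A *v x\<close> from the Gaussian output law. \<open>R\<close> is the inverse of the
    output covariance and \<delta> is the determinant of that covariance.\<close>
  define L where "L x = (ln \<delta> + (quad R (A *v (x - m)) + Re (trace R) - CARD('m))) / ln 2" for x
  have D: "output_divergence A (return borel x) (shifted_gaussian m K) = ennreal (L x)" and L0: "0 \<le> L x" for x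
  proof -
    define c where "c = A *v x"
    define g where "g y = gaussian_density (y - c)" for y
    have gpos: "0 < g y" for y by (simp add: g_def gaussian_density_pos)
    have [measurable]: "g \<in> borel_measurable borel" unfolding g_def[abs_def] by measurable
    define h where "h y = ln \<delta> + (quad R (y - A *v m) - (norm (y - c))\<^sup>2)" for y
    have [measurable]: "h \<in> borel_measurable borel" unfolding h_def[abs_def] by measurable
    have lng: "ln (g y / q y) = h y" for y
    proof -
      have "g y / q y = exp (- (norm (y - c))\<^sup>2) / exp (- quad R (y - A *v m)) * \<delta>"
        using \<delta> by (simp add: g_def q_def gaussian_density_def)
      also have "\<dots> = exp (h y)"
        using \<delta> by (simp add: h_def exp_add exp_diff exp_minus field_simps)
      finally show ?thesis by simp
    qed
    have g1: "has_bochner_integral lborel g 1"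
      unfolding g_def by (rule has_bochner_integral_nn_integral)
        (simp_all add: nn_integral_gaussian_density_shift)
    have q1: "has_bochner_integral lborel q 1"
      using nn_integral_output_density_1[OF sl, of A] qpos
      by (intro has_bochner_integral_nn_integral) (simp_all add: od less_imp_le)
    have sh: "distr standard_complex_gaussian borel ((+) c) = density lborel (\<lambda>y. ennreal (g y))"
      unfolding g_def by (rule standard_complex_gaussian_shifted)
    have hw: "h (c + w) = ln \<delta> + (quad R (A *v (x - m) + w) - (norm w)\<^sup>2)" for w
      by (simp add: h_def c_def matrix_vector_mult_diff_distrib algebra_simps)
    note E = expectation_quad_shift[OF RH, of "A *v (x - m)"]
    have ih: "integrable standard_complex_gaussian (\<lambda>w. h (c + w))"
      unfolding hw using E(1) by simp
    have vh: "(\<integral>w. h (c + w) \<partial>standard_complex_gaussian) = L x * ln 2"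
      unfolding hw using E standard_complex_gaussian.prob_space[where 'n='m]
      by (simp add: L_def)
    have "integrable (density lborel (\<lambda>y. ennreal (g y))) h"
      unfolding sh[symmetric] by (subst integrable_distr_eq) (simp_all add: ih)
    then have igh: "integrable lborel (\<lambda>y. g y * h y)"
      by (subst (asm) integrable_real_density) (simp_all add: less_imp_le gpos)
    have "(\<integral>y. h y \<partial>density lborel (\<lambda>y. ennreal (g y))) = L x * ln 2"
      unfolding sh[symmetric] by (subst integral_distr) (simp_all add: vh)
    then have vgh: "(\<integral>y. g y * h y \<partial>lborel) = L x * ln 2"
      by (subst (asm) integral_real_density) (simp_all add: less_imp_le gpos)
    have r: "kl_term (g y) (q y) = (g y * h y - g y + q y) / ln 2" for y
      by (simp add: kl_term_def lng)
    have ir: "integrable lborel (\<lambda>y. kl_term (g y) (q y))"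
      unfolding r using igh g1 q1 by (simp add: has_bochner_integral_iff)
    have vr: "(\<integral>y. kl_term (g y) (q y) \<partial>lborel) = L x"
      unfolding r using igh g1 q1 vgh by (simp add: has_bochner_integral_iff)
    show "0 \<le> L x"
      unfolding vr[symmetric] by (intro integral_nonneg_AE AE_I2 kl_term_nonneg gpos qpos)
    show "output_divergence A (return borel x) (shifted_gaussian m K) = ennreal (L x)"
      unfolding output_divergence_def od output_density_return c_def[symmetric] g_def[symmetric]
      using nn_integral_eq_integral[OF ir] by (simp add: vr kl_term_nonneg gpos qpos)
  qed
  note lin = moments_linear_image[OF int cov, of A]
  note QL = integral_quad[OF lin, of R]
  have iL: "integrable P L"
    unfolding L_def[abs_def] using QL(1) by simp
  \<comment> \<open>Averaging \<open>L\<close> produces the first trace. As \<open>R\<close> inverts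
    the output covariance, the two traces add up to the dimension and cancel
    \<open>CARD('m)\<close>, leaving only the logarithm of \<delta>.\<close>
  have tr: "Re (trace (R ** (A ** K ** A\<^sup>\<dagger>))) + Re (trace R) = CARD('m)"
  proof -
    have "trace (R ** (A ** K ** A\<^sup>\<dagger>)) + trace R = trace (R ** (mat 1 + A ** K ** A\<^sup>\<dagger>))"
      by (simp add: matrix_add_ldistrib trace_add)
    also have "\<dots> = of_nat CARD('m)" by (simp add: RS trace_I)
    finally show ?thesis by (metis plus_complex.sel(1) complex_Re_of_nat)
  qed
  have vL: "(\<integral>x. L x \<partial>P) = log 2 \<delta>"
    unfolding L_def using QL tr by (simp add: P.prob_space log_def)
  show "0 \<le> log 2 (gram_det K A)"
    using integral_nonneg_AE[OF AE_I2, of P L] L0 vL by (simp add: \<delta>_def)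
  show "(\<integral>\<^sup>+ x. output_divergence A (return borel x) (shifted_gaussian m K) \<partial>P) = ennreal (log 2 (gram_det K A))"
    unfolding D using nn_integral_eq_integral[OF iL] L0 by (simp add: vL \<delta>_def)
qed

text \<open>Coordinates and their mixed products are dominated by constants plus squared moduli, so
  second moments exist around any centre \<open>m\<close>.\<close>

lemma integrable_covariance:
  fixes P :: "(complex ^ 'n) measure"
  assumes P: "P \<in> space laws"
    and sq: "\<And>i. integrable P (\<lambda>x. (cmod (x $ i))\<^sup>2)"
  shows "integrable P (\<lambda>x. (x - m) $ i * cnj ((x - m) $ j))"
proof -
  interpret prob_space P by (rule lawsD[OF P])
  note [measurable_cong] = lawsD(2)[OF P]
  have lin: "integrable P (\<lambda>x. x $ i)" for i
  proof (rule Bochner_Integration.integrable_bound[of P "\<lambda>x. 1 + (cmod (x $ i))\<^sup>2"])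
    show "AE x in P. norm (x $ i) \<le> norm (1 + (cmod (x $ i))\<^sup>2)"
    proof (rule AE_I2)
      fix x
      have "0 \<le> (cmod (x $ i) - 1 / 2)\<^sup>2" by simp
      then show "norm (x $ i) \<le> norm (1 + (cmod (x $ i))\<^sup>2)"
        by (simp add: power2_eq_square algebra_simps)
    qed
  qed (use sq in auto)
  have prod: "integrable P (\<lambda>x. x $ i * cnj (x $ j))" for i j
  proof (rule Bochner_Integration.integrable_bound[of P "\<lambda>x. (cmod (x $ i))\<^sup>2 + (cmod (x $ j))\<^sup>2"])
    show "AE x in P. norm (x $ i * cnj (x $ j)) \<le> norm ((cmod (x $ i))\<^sup>2 + (cmod (x $ j))\<^sup>2)"
    proof (rule AE_I2)
      fix x
      have "0 \<le> cmod (x $ i) * cmod (x $ j)" by simp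
      with sum_squares_bound[of "cmod (x $ i)" "cmod (x $ j)"]
      have "cmod (x $ i) * cmod (x $ j) \<le> (cmod (x $ i))\<^sup>2 + (cmod (x $ j))\<^sup>2" by linarith
      then show "norm (x $ i * cnj (x $ j)) \<le> norm ((cmod (x $ i))\<^sup>2 + (cmod (x $ j))\<^sup>2)"
        by (simp add: norm_mult)
    qed
  qed (use sq in auto)
  have "(x - m) $ i * cnj ((x - m) $ j) =
      x $ i * cnj (x $ j) - x $ i * cnj (m $ j) - m $ i * cnj (x $ j) + m $ i * cnj (m $ j)" for x
    by (simp add: algebra_simps)
  then show ?thesis
    using prod[of i j] lin by (simp add: integrable_cnj)
qed

text \<open>After disintegration the mixture \<open>\<mu> \<bind> k\<close> is the marginal law of
  \<open>x\<close>, so the covariance condition passes to it, with \<open>m\<close> the mean of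
  \<open>x\<close>.\<close>

lemma input_law_decomposition:
  fixes S :: "'u measure" and p :: "('u \<times> (complex ^ 'n)) measure"
  assumes "p \<in> inputs_with_covariance S K"
  obtains \<mu> k m where "prob_space \<mu>" "sets \<mu> = sets S" "k \<in> measurable \<mu> laws" "p = joint_law \<mu> k"
    "\<And>i j. integrable (\<mu> \<bind> k) (\<lambda>x. (x - m) $ i * cnj ((x - m) $ j))"
    "\<And>i j. (\<integral>x. (x - m) $ i * cnj ((x - m) $ j) \<partial>(\<mu> \<bind> k)) = K $ i $ j"
proof -
  have p: "prob_space p" and sets: "sets p = sets (S \<Otimes>\<^sub>M borel)"
    and sq: "\<And>i. integrable p (\<lambda>(u, x). (cmod (x $ i))\<^sup>2)"
    and cov: "\<And>i j. (\<integral>(u, x). (x $ i - (\<integral>(u', x'). x' $ i \<partial>p)) * cnj (x $ j - (\<integral>(u', x'). x' $ j \<partial>p)) \<partial>p) = K $ i $ j"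
    using assms by (auto simp: inputs_with_covariance_def input_distribution_def has_input_covariance_def)
  note [measurable_cong] = sets
  define \<mu> where "\<mu> = distr p S fst"
  have \<mu>: "prob_space \<mu>"
    unfolding \<mu>_def by (rule prob_space.prob_space_distr[OF p]) measurable
  obtain k where k[measurable]: "k \<in> measurable \<mu> laws" and pk: "p = joint_law \<mu> k"
    using disintegration[OF p sets] unfolding \<mu>_def by blast
  have snd: "distr p borel snd = \<mu> \<bind> k"
  proof (rule measure_eqI)
    show "sets (distr p borel snd) = sets (\<mu> \<bind> k)"
      using lawsD(2)[OF bind_in_laws[OF \<mu> k]] by simp
    fix C assume "C \<in> sets (distr p borel (snd :: 'u \<times> (complex ^ 'n) \<Rightarrow> _))"
    then have C[measurable]: "C \<in> sets borel" by simp
    have "emeasure (distr p borel snd) C = (\<integral>\<^sup>+ z. indicator C (snd z) \<partial>p)"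
      by (subst nn_integral_distr[symmetric, of snd _ borel]) simp_all
    also have "\<dots> = (\<integral>\<^sup>+ u. \<integral>\<^sup>+ x. indicator C x \<partial>k u \<partial>\<mu>)"
      unfolding pk by (subst nn_integral_joint_law[OF \<mu> k]) simp_all
    also have "\<dots> = (\<integral>\<^sup>+ x. indicator C x \<partial>(\<mu> \<bind> k))"
      by (rule nn_integral_bind[symmetric, OF _ measurable_prob_algebraD[OF k]]) simp
    also have "\<dots> = emeasure (\<mu> \<bind> k) C"
      using C lawsD(2)[OF bind_in_laws[OF \<mu> k]] by (intro nn_integral_indicator) simp
    finally show "emeasure (distr p borel snd) C = \<dots>" .
  qed
  define m where "m = (\<chi> i. \<integral>(u', x'). x' $ i \<partial>p)"
  have sq': "integrable (\<mu> \<bind> k) (\<lambda>x. (cmod (x $ i))\<^sup>2)" for i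
    unfolding snd[symmetric] using sq[of i] by (subst integrable_distr_eq) (simp_all add: split_def)
  have cv: "(\<integral>x. (x - m) $ i * cnj ((x - m) $ j) \<partial>(\<mu> \<bind> k)) = K $ i $ j" for i j
    unfolding snd[symmetric] using cov[of i j] by (subst integral_distr) (simp_all add: split_def m_def)
  show ?thesis
    by (rule that[OF \<mu> _ k pk integrable_covariance[OF bind_in_laws[OF \<mu> k] sq'] cv]) (simp add: \<mu>_def)
qed

text \<open>Identifying \<open>u\<close> with \<open>x\<close> makes the conditional law of the
  input a point mass.\<close>

lemma nonprecoded_gaussian_input_eq:
  "nonprecoded_gaussian_input K = joint_law (complex_gaussian K) (return borel)"
proof (rule measure_eqI)
  let ?G = "complex_gaussian K"
  have k: "return borel \<in> measurable ?G laws" by measurable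
  note J = sets_joint_law[OF prob_space_complex_gaussian k]
  show s: "sets (nonprecoded_gaussian_input K) = sets (joint_law ?G (return borel))"
    unfolding J nonprecoded_gaussian_input_def sets_distr by (rule sets_pair_measure_cong) simp_all
  fix E assume "E \<in> sets (nonprecoded_gaussian_input K)"
  then have E: "E \<in> sets (borel \<Otimes>\<^sub>M borel)" and E'[measurable]: "E \<in> sets (?G \<Otimes>\<^sub>M borel)"
    using s J by (auto simp: nonprecoded_gaussian_input_def)
  have "emeasure (joint_law ?G (return borel)) E = (\<integral>\<^sup>+ z. indicator E z \<partial>joint_law ?G (return borel))"
    using E' J by (intro nn_integral_indicator[symmetric]) simp
  also have "\<dots> = (\<integral>\<^sup>+ u. \<integral>\<^sup>+ x. indicator E (u, x) \<partial>return borel u \<partial>?G)"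
    by (rule nn_integral_joint_law[OF prob_space_complex_gaussian k]) measurable
  also have "\<dots> = (\<integral>\<^sup>+ u. indicator E (u, u) \<partial>?G)"
    using E by (intro nn_integral_cong nn_integral_return) measurable
  also have "\<dots> = emeasure (nonprecoded_gaussian_input K) E"
    unfolding nonprecoded_gaussian_input_def using E
    by (subst nn_integral_distr[symmetric, of "\<lambda>x. (x, x)" _ "borel \<Otimes>\<^sub>M borel"]) simp_all
  finally show "emeasure (nonprecoded_gaussian_input K) E = emeasure (joint_law ?G (return borel)) E" ..
qed

lemma nonprecoded_gaussian_input_in_inputs_with_covariance:
  assumes K: "hermitian_psd K"
  shows "nonprecoded_gaussian_input K \<in> inputs_with_covariance borel K"
proof -
  interpret prob_space "complex_gaussian K" by (rule prob_space_complex_gaussian)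
  note M = complex_gaussian_moments[OF K]
  have d: "(\<lambda>x. (x, x)) \<in> measurable (complex_gaussian K) (borel \<Otimes>\<^sub>M borel)" by measurable
  have mean: "(\<integral>(u', x'). x' $ i \<partial>nonprecoded_gaussian_input K) = 0" for i
    unfolding nonprecoded_gaussian_input_def by (subst integral_distr[OF d]) (simp_all add: M split_def)
  have "integrable (complex_gaussian K) (\<lambda>x. (cmod (x $ i))\<^sup>2)" for i
    using integrable_norm[OF M(2)[of i i]] by (simp add: norm_mult power2_eq_square)
  then have "integrable (nonprecoded_gaussian_input K) (\<lambda>(u, x). (cmod (x $ i))\<^sup>2)" for i
    unfolding nonprecoded_gaussian_input_def by (subst integrable_distr_eq[OF d]) (simp_all add: split_def)
  moreover have "(\<integral>(u, x). x $ i * cnj (x $ j) \<partial>nonprecoded_gaussian_input K) = K $ i $ j" for i j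
    unfolding nonprecoded_gaussian_input_def by (subst integral_distr[OF d]) (simp_all add: M split_def)
  ultimately have "has_input_covariance (nonprecoded_gaussian_input K) K"
    by (simp add: has_input_covariance_def mean)
  moreover have "input_distribution borel (nonprecoded_gaussian_input K)"
    unfolding input_distribution_def nonprecoded_gaussian_input_def using prob_space_distr[OF d] by simp
  ultimately show ?thesis by (simp add: inputs_with_covariance_def)
qed

text \<open>The compensation identity used twice: for each \<open>u\<close> with point masses mixed
  to \<open>k u\<close>, and over \<open>u\<close> with the laws \<open>k u\<close> mixed to the
  input law. The terms on the right are I(u; y), I(x; y | u) and the divergence of the output law
  from the reference.\<close>

lemma input_information_complement:
  fixes A :: "complex ^ 'n ^ 'm"
  assumes \<mu>: "prob_space \<mu>" and k: "k \<in> measurable \<mu> laws" and Q: "Q \<in> space laws"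
  shows "(\<integral>\<^sup>+ x. output_divergence A (return borel x) Q \<partial>(\<mu> \<bind> k)) =
    input_information \<mu> k A +
      ((\<integral>\<^sup>+ u. input_information (k u) (return borel) A \<partial>\<mu>) + output_divergence A (\<mu> \<bind> k) Q)"
proof -
  note [measurable] = k Q
  have kl: "k u \<in> space laws" if "u \<in> space \<mu>" for u
    using k that by (rule measurable_space)
  have ret: "return borel \<in> measurable (k u) laws" "k u \<bind> return borel = k u" if "u \<in> space \<mu>" for u
    using lawsD(2)[OF kl[OF that]] by (auto simp: bind_return'' cong: measurable_cong_sets)
  have [measurable]: "(\<lambda>u. input_information (k u) (return borel) A) \<in> borel_measurable \<mu>"
  proof -
    have "(\<lambda>u. \<integral>\<^sup>+ x. output_divergence A (return borel x) (k u) \<partial>k u) \<in> borel_measurable \<mu>"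
      by (rule nn_integral_measurable_subprob_algebra2[OF _ measurable_prob_algebraD[OF k]]) measurable
    then show ?thesis by (subst measurable_cong[where g="\<lambda>u. \<integral>\<^sup>+ x. output_divergence A (return borel x) (k u) \<partial>k u"]) (simp_all add: ret)
  qed
  have "(\<integral>\<^sup>+ x. output_divergence A (return borel x) Q \<partial>(\<mu> \<bind> k)) =
      (\<integral>\<^sup>+ u. \<integral>\<^sup>+ x. output_divergence A (return borel x) Q \<partial>k u \<partial>\<mu>)"
    by (rule nn_integral_bind[OF _ measurable_prob_algebraD[OF k]]) measurable
  also have "\<dots> = (\<integral>\<^sup>+ u. input_information (k u) (return borel) A + output_divergence A (k u) Q \<partial>\<mu>)"
    using output_divergence_compensation[OF lawsD(1)[OF kl] ret(1) Q]
    by (intro nn_integral_cong) (simp add: ret)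
  also have "\<dots> = (\<integral>\<^sup>+ u. input_information (k u) (return borel) A \<partial>\<mu>) + (\<integral>\<^sup>+ u. output_divergence A (k u) Q \<partial>\<mu>)"
    by (rule nn_integral_add) measurable
  finally show ?thesis
    by (simp add: output_divergence_compensation[OF \<mu> k Q] add_ac)
qed

text \<open>For fixed \<open>u\<close> the hypothesis is applied to \<open>x\<close> as its own
  message with law \<open>k u\<close>, so only vector-valued messages occur. Exchanging the
  integrals over channels and messages reduces the claim to these inequalities.\<close>

lemma less_noisy_conditional_information:
  fixes H :: "'w \<Rightarrow> complex ^ 'n ^ 'b" and G :: "'w \<Rightarrow> complex ^ 'n ^ 'e"
  assumes ln: "less_noisy_on_average TYPE(complex ^ 'n) M H G" and "prob_space M"
    and [measurable]: "H \<in> borel_measurable M" "G \<in> borel_measurable M"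
    and \<mu>: "prob_space \<mu>" and k[measurable]: "k \<in> measurable \<mu> laws"
  shows "(\<integral>\<^sup>+ \<omega>. \<integral>\<^sup>+ u. input_information (k u) (return borel) (G \<omega>) \<partial>\<mu> \<partial>M) \<le>
    (\<integral>\<^sup>+ \<omega>. \<integral>\<^sup>+ u. input_information (k u) (return borel) (H \<omega>) \<partial>\<mu> \<partial>M)"
proof -
  interpret M: prob_space M by fact
  interpret \<mu>: prob_space \<mu> by fact
  interpret pair_sigma_finite \<mu> M ..
  have kl: "k u \<in> space laws" if "u \<in> space \<mu>" for u
    using k that by (rule measurable_space)
  have ret: "return borel \<in> measurable (k u) laws" "k u \<bind> return borel = k u" if "u \<in> space \<mu>" for u
    using lawsD(2)[OF kl[OF that]] by (auto simp: bind_return'' cong: measurable_cong_sets)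
  have swap: "(\<integral>\<^sup>+ \<omega>. \<integral>\<^sup>+ u. input_information (k u) (return borel) (F \<omega>) \<partial>\<mu> \<partial>M) =
      (\<integral>\<^sup>+ u. \<integral>\<^sup>+ \<omega>. input_information (k u) (return borel) (F \<omega>) \<partial>M \<partial>\<mu>)"
    if F[measurable]: "F \<in> borel_measurable M" for F :: "'w \<Rightarrow> complex ^ 'n ^ 'c"
  proof (rule Fubini')
    \<comment> \<open>\<open>k u \<bind> return borel\<close> is replaced by \<open>k u\<close>,
      whose measurability in \<open>u\<close> is given.\<close>
    have "(\<lambda>z. \<integral>\<^sup>+ x. output_divergence (F (snd z)) (return borel x) (k (fst z)) \<partial>k (fst z)) \<in> borel_measurable (\<mu> \<Otimes>\<^sub>M M)"
      by (rule nn_integral_measurable_subprob_algebra2[where N=borel])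
        (measurable, rule measurable_prob_algebraD, measurable)
    then show "(\<lambda>(u, \<omega>). input_information (k u) (return borel) (F \<omega>)) \<in> borel_measurable (\<mu> \<Otimes>\<^sub>M M)"
      by (subst measurable_cong[where g="\<lambda>z. \<integral>\<^sup>+ x. output_divergence (F (snd z)) (return borel x) (k (fst z)) \<partial>k (fst z)"])
        (auto simp: space_pair_measure ret)
  qed
  show ?thesis
    unfolding swap[OF assms(3)] swap[OF assms(4)]
    by (intro nn_integral_mono less_noisy_on_averageD[OF ln] lawsD(1)[OF kl] ret)
qed

text \<open>Here \<open>i\<close> is an information, \<open>c\<close> the Gaussian total and
  \<open>t\<close> what the information lacks. If \<open>cH\<close> has a finite integral, all terms
  do and can be subtracted. Otherwise the right side is \<infinity>, since the finite integral of
  \<open>cG\<close> cannot offset it.\<close>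

lemma extended_expectation_difference_mono:
  fixes iH tH cH iG tG cG :: "'w \<Rightarrow> ennreal"
  assumes [measurable]: "iH \<in> borel_measurable M" "tH \<in> borel_measurable M" "cH \<in> borel_measurable M"
      "iG \<in> borel_measurable M" "tG \<in> borel_measurable M" "cG \<in> borel_measurable M"
    and cH: "\<And>\<omega>. cH \<omega> = iH \<omega> + tH \<omega>" "\<And>\<omega>. cH \<omega> < top"
    and cG: "\<And>\<omega>. cG \<omega> = iG \<omega> + tG \<omega>" "\<And>\<omega>. cG \<omega> < top"
    and fin: "(\<integral>\<^sup>+ \<omega>. cG \<omega> \<partial>M) < top"
    and le: "(\<integral>\<^sup>+ \<omega>. tG \<omega> \<partial>M) \<le> (\<integral>\<^sup>+ \<omega>. tH \<omega> \<partial>M)"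
  shows "extended_expectation M (\<lambda>\<omega>. enn2ereal (iH \<omega>) - enn2ereal (iG \<omega>)) \<le>
    extended_expectation M (\<lambda>\<omega>. enn2ereal (cH \<omega>) - enn2ereal (cG \<omega>))"
proof -
  have enn: "enn2ereal x = ereal (enn2real x)" if "x < top" for x
    using that by (cases x) (simp_all add: enn2ereal_ennreal)
  have fins: "iH \<omega> < top" "tH \<omega> < top" "iG \<omega> < top" "tG \<omega> < top" for \<omega>
    using cH[of \<omega>] cG[of \<omega>] by auto
  have int: "integrable M (\<lambda>\<omega>. enn2real (f \<omega>))" "(\<integral>\<omega>. enn2real (f \<omega>) \<partial>M) = enn2real (\<integral>\<^sup>+ \<omega>. f \<omega> \<partial>M)"
    if [measurable]: "f \<in> borel_measurable M" and f: "\<And>\<omega>. f \<omega> < top" and "(\<integral>\<^sup>+ \<omega>. f \<omega> \<partial>M) < top"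
    for f :: "'w \<Rightarrow> ennreal"
  proof -
    have e: "ennreal (enn2real (f \<omega>)) = f \<omega>" for \<omega> using f by (intro ennreal_enn2real)
    show "integrable M (\<lambda>\<omega>. enn2real (f \<omega>))"
      using that by (intro integrableI_nonneg) (auto simp: e)
    show "(\<integral>\<omega>. enn2real (f \<omega>) \<partial>M) = enn2real (\<integral>\<^sup>+ \<omega>. f \<omega> \<partial>M)"
      by (subst integral_eq_nn_integral) (auto simp: e)
  qed
  have sum_G: "(\<integral>\<^sup>+ \<omega>. cG \<omega> \<partial>M) = (\<integral>\<^sup>+ \<omega>. iG \<omega> \<partial>M) + (\<integral>\<^sup>+ \<omega>. tG \<omega> \<partial>M)"
    unfolding cG(1) by (rule nn_integral_add) measurable
  have sum_H: "(\<integral>\<^sup>+ \<omega>. cH \<omega> \<partial>M) = (\<integral>\<^sup>+ \<omega>. iH \<omega> \<partial>M) + (\<integral>\<^sup>+ \<omega>. tH \<omega> \<partial>M)"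
    unfolding cH(1) by (rule nn_integral_add) measurable
  show ?thesis
  proof (cases "(\<integral>\<^sup>+ \<omega>. cH \<omega> \<partial>M) = top")
    case True
    have d: "enn2ereal (cH \<omega>) - enn2ereal (cG \<omega>) = ereal (enn2real (cH \<omega>) - enn2real (cG \<omega>))" for \<omega>
      by (simp add: enn cH(2) cG(2))
    \<comment> \<open>\<open>cH\<close> is at most \<open>cG\<close> plus the positive part of the
      difference, so that part has an infinite integral; the negative part stays below
      \<open>cG\<close>.\<close>
    have "(\<integral>\<^sup>+ \<omega>. cH \<omega> \<partial>M) \<le> (\<integral>\<^sup>+ \<omega>. ennreal (enn2real (cH \<omega>) - enn2real (cG \<omega>)) + cG \<omega> \<partial>M)"
    proof (intro nn_integral_mono)
      fix \<omega>
      have "cH \<omega> = ennreal (enn2real (cH \<omega>))" "cG \<omega> = ennreal (enn2real (cG \<omega>))"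
        using cH(2)[of \<omega>] cG(2)[of \<omega>] by simp_all
      moreover have "ennreal a \<le> ennreal (a - b) + ennreal b" if "0 \<le> b" for a b :: real
      proof (cases "b \<le> a")
        case False
        then show ?thesis by (simp add: ennreal_leI add_increasing)
      qed (use that in \<open>simp flip: ennreal_plus\<close>)
      ultimately show "cH \<omega> \<le> ennreal (enn2real (cH \<omega>) - enn2real (cG \<omega>)) + cG \<omega>"
        by (metis enn2real_nonneg)
    qed
    also have "\<dots> = (\<integral>\<^sup>+ \<omega>. ennreal (enn2real (cH \<omega>) - enn2real (cG \<omega>)) \<partial>M) + (\<integral>\<^sup>+ \<omega>. cG \<omega> \<partial>M)"
      by (rule nn_integral_add) measurable
    finally have inf: "(\<integral>\<^sup>+ \<omega>. ennreal (enn2real (cH \<omega>) - enn2real (cG \<omega>)) \<partial>M) = top"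
      using True fin by (auto simp: top_unique)
    have "(\<integral>\<^sup>+ \<omega>. ennreal (- (enn2real (cH \<omega>) - enn2real (cG \<omega>))) \<partial>M) \<le> (\<integral>\<^sup>+ \<omega>. cG \<omega> \<partial>M)"
    proof (intro nn_integral_mono)
      fix \<omega>
      have "ennreal (- (enn2real (cH \<omega>) - enn2real (cG \<omega>))) \<le> ennreal (enn2real (cG \<omega>))"
        by (intro ennreal_leI) simp
      then show "ennreal (- (enn2real (cH \<omega>) - enn2real (cG \<omega>))) \<le> cG \<omega>"
        using cG(2)[of \<omega>] by simp
    qed
    then have "(\<integral>\<^sup>+ \<omega>. ennreal (- (enn2real (cH \<omega>) - enn2real (cG \<omega>))) \<partial>M) < top"
      using fin by (rule le_less_trans)
    then have "extended_expectation M (\<lambda>\<omega>. enn2ereal (cH \<omega>) - enn2ereal (cG \<omega>)) = \<infinity>"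
      unfolding extended_expectation_def d uminus_ereal.simps e2ennreal_ereal inf
      by (simp add: enn)
    then show ?thesis by simp
  next
    case False
    then have fH: "(\<integral>\<^sup>+ \<omega>. iH \<omega> \<partial>M) < top" "(\<integral>\<^sup>+ \<omega>. tH \<omega> \<partial>M) < top" "(\<integral>\<^sup>+ \<omega>. cH \<omega> \<partial>M) < top"
      using sum_H by (auto simp: less_top)
    have fG: "(\<integral>\<^sup>+ \<omega>. iG \<omega> \<partial>M) < top" "(\<integral>\<^sup>+ \<omega>. tG \<omega> \<partial>M) < top"
      using sum_G fin by auto
    have E: "extended_expectation M (\<lambda>\<omega>. enn2ereal (f \<omega>) - enn2ereal (g \<omega>)) =
        ereal (enn2real (\<integral>\<^sup>+ \<omega>. f \<omega> \<partial>M) - enn2real (\<integral>\<^sup>+ \<omega>. g \<omega> \<partial>M))"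
      if "f \<in> borel_measurable M" "\<And>\<omega>. f \<omega> < top" "(\<integral>\<^sup>+ \<omega>. f \<omega> \<partial>M) < top"
        "g \<in> borel_measurable M" "\<And>\<omega>. g \<omega> < top" "(\<integral>\<^sup>+ \<omega>. g \<omega> \<partial>M) < top" for f g
    proof -
      have "extended_expectation M (\<lambda>\<omega>. enn2ereal (f \<omega>) - enn2ereal (g \<omega>)) =
          extended_expectation M (\<lambda>\<omega>. ereal (enn2real (f \<omega>) - enn2real (g \<omega>)))"
        by (simp add: enn that)
      also have "\<dots> = ereal (\<integral>\<omega>. enn2real (f \<omega>) - enn2real (g \<omega>) \<partial>M)"
        by (intro extended_expectation_integrable Bochner_Integration.integrable_diff int that)
      also have "\<dots> = ereal (enn2real (\<integral>\<^sup>+ \<omega>. f \<omega> \<partial>M) - enn2real (\<integral>\<^sup>+ \<omega>. g \<omega> \<partial>M))"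
        using int[of f] int[of g] that by simp
      finally show ?thesis .
    qed
    have "enn2real (\<integral>\<^sup>+ \<omega>. tG \<omega> \<partial>M) \<le> enn2real (\<integral>\<^sup>+ \<omega>. tH \<omega> \<partial>M)"
      using le fH by (intro enn2real_mono)
    then show ?thesis
      using fH fG fin fins cH(2) cG(2)
      by (simp add: E) (simp add: sum_H sum_G enn2real_plus)
  qed
qed

theorem theorem5:
  fixes M :: "'w measure"
    and H :: "'w \<Rightarrow> complex ^ 'a ^ 'b"
    and G :: "'w \<Rightarrow> complex ^ 'a ^ 'e"
    and K :: "complex ^ 'a ^ 'a"
  assumes "prob_space M"
    and "H \<in> borel_measurable M" and "G \<in> borel_measurable M"
    and "hermitian_psd K"
    and "integrable M (\<lambda>\<omega>. log 2 (gram_det K (G \<omega>)))"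
    and "less_noisy_on_average TYPE(complex ^ 'a) M H G"
  shows "nonprecoded_gaussian_input K \<in> inputs_with_covariance borel K \<and>
    (\<forall>(S :: 'u measure). \<forall>p \<in> inputs_with_covariance S K.
       ergodic_secrecy_rate M H G S p
         \<le> ergodic_secrecy_rate M H G borel (nonprecoded_gaussian_input K)) \<and>
    ergodic_secrecy_rate M H G borel (nonprecoded_gaussian_input K) =
      extended_expectation M (\<lambda>\<omega>. ereal (log 2 (gram_det K (H \<omega>) / gram_det K (G \<omega>))))"
proof -
  note [measurable] = assms(2,3)
  note K = \<open>hermitian_psd K\<close>
  interpret M: prob_space M by fact
  define \<Gamma> where "\<Gamma> = complex_gaussian K"
  have \<Gamma>: "prob_space \<Gamma>" "\<Gamma> \<in> space laws" "return borel \<in> measurable \<Gamma> laws" "\<Gamma> \<bind> return borel = \<Gamma>"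
    using prob_space_complex_gaussian
    by (auto simp: \<Gamma>_def space_prob_algebra bind_return'' cong: measurable_cong_sets)
  have m0: "integrable \<Gamma> (\<lambda>x. (x - 0) $ i * cnj ((x - 0) $ j))"
    "(\<integral>x. (x - 0) $ i * cnj ((x - 0) $ j) \<partial>\<Gamma>) = K $ i $ j" for i j
    using complex_gaussian_moments[OF K] by (simp_all add: \<Gamma>_def)
  \<comment> \<open>The Gaussian law has mean 0, so its own mixture of point masses is also the
    reference law. Nothing is missing from its information, which is the full log
    determinant.\<close>
  have gd: "0 < gram_det K A" "0 \<le> log 2 (gram_det K A)"
    and cap: "input_information \<Gamma> (return borel) A = ennreal (log 2 (gram_det K A))" for A :: "complex ^ 'a ^ 'm"
    using gaussian_output_divergence[OF \<Gamma>(2) K m0, of A]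
    by (simp_all add: shifted_gaussian_0 \<Gamma>(4)) (simp add: \<Gamma>_def)
  have gauss: "instantaneous_information borel (nonprecoded_gaussian_input K) A = enn2ereal (ennreal (log 2 (gram_det K A)))"
    for A :: "complex ^ 'a ^ 'm"
    unfolding nonprecoded_gaussian_input_eq \<Gamma>_def[symmetric]
    by (subst instantaneous_information_joint_law[OF \<Gamma>(1) _ \<Gamma>(3)]) (simp_all add: cap, simp add: \<Gamma>_def)
  have "ergodic_secrecy_rate M H G borel (nonprecoded_gaussian_input K) =
      extended_expectation M (\<lambda>\<omega>. ereal (log 2 (gram_det K (H \<omega>) / gram_det K (G \<omega>))))"
    unfolding ergodic_secrecy_rate_def gauss by (simp add: enn2ereal_ennreal gd log_divide gd(1)[THEN less_imp_neq, THEN not_sym])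
  moreover have "ergodic_secrecy_rate M H G S p \<le> ergodic_secrecy_rate M H G borel (nonprecoded_gaussian_input K)"
    if p_in: "p \<in> inputs_with_covariance S K" for S :: "'u measure" and p
  proof -
    obtain \<mu> k m where \<mu>: "prob_space \<mu>" and S: "sets \<mu> = sets S" and k[measurable]: "k \<in> measurable \<mu> laws"
      and p: "p = joint_law \<mu> k"
      and cov: "\<And>i j. integrable (\<mu> \<bind> k) (\<lambda>x. (x - m) $ i * cnj ((x - m) $ j))"
        "\<And>i j. (\<integral>x. (x - m) $ i * cnj ((x - m) $ j) \<partial>(\<mu> \<bind> k)) = K $ i $ j"
    proof (rule input_law_decomposition[OF p_in], goal_cases)
      case (1 \<mu> k m)
      show ?case by (rule 1(1)[OF 1(2-7)])
    qed
    interpret \<mu>: prob_space \<mu> by fact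
    define P where "P = \<mu> \<bind> k"
    define Q where "Q = shifted_gaussian m K"
    have P[measurable]: "P \<in> space laws" unfolding P_def by (rule bind_in_laws[OF \<mu> k])
    have Q[measurable]: "Q \<in> space laws" unfolding Q_def by (rule shifted_gaussian_in_laws)
    have c: "ennreal (log 2 (gram_det K A)) = input_information \<mu> k A +
        ((\<integral>\<^sup>+ u. input_information (k u) (return borel) A \<partial>\<mu>) + output_divergence A P Q)"
      for A :: "complex ^ 'a ^ 'm"
      using input_information_complement[OF \<mu> k Q, of A]
        gaussian_output_divergence(3)[OF bind_in_laws[OF \<mu> k] K cov, of A]
      unfolding P_def Q_def by (simp only:)
    have i: "instantaneous_information S p A = enn2ereal (input_information \<mu> k A)" for A :: "complex ^ 'a ^ 'm"
      unfolding p by (rule instantaneous_information_joint_law[OF \<mu> S k])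
    have kl: "k u \<in> space laws" if "u \<in> space \<mu>" for u
      using k that by (rule measurable_space)
    have ret: "k u \<bind> return borel = k u" if "u \<in> space \<mu>" for u
      using lawsD(2)[OF kl[OF that]] by (simp add: bind_return'')
    have meas[measurable]: "(\<lambda>\<omega>. input_information \<mu> k (F \<omega>)) \<in> borel_measurable M"
      "(\<lambda>\<omega>. \<integral>\<^sup>+ u. input_information (k u) (return borel) (F \<omega>) \<partial>\<mu>) \<in> borel_measurable M"
      if [measurable]: "F \<in> borel_measurable M" for F :: "'w \<Rightarrow> complex ^ 'a ^ 'm"
    proof -
      have [measurable]: "\<mu> \<bind> k \<in> space laws" by (rule bind_in_laws[OF \<mu> k])
      show "(\<lambda>\<omega>. input_information \<mu> k (F \<omega>)) \<in> borel_measurable M" by measurable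
      have "(\<lambda>z. \<integral>\<^sup>+ x. output_divergence (F (fst z)) (return borel x) (k (snd z)) \<partial>k (snd z)) \<in> borel_measurable (M \<Otimes>\<^sub>M \<mu>)"
        by (rule nn_integral_measurable_subprob_algebra2[where N=borel])
          (measurable, rule measurable_prob_algebraD, measurable)
      then have "(\<lambda>\<omega>. \<integral>\<^sup>+ u. \<integral>\<^sup>+ x. output_divergence (F \<omega>) (return borel x) (k u) \<partial>k u \<partial>\<mu>) \<in> borel_measurable M"
        using \<mu>.borel_measurable_nn_integral_fst by fastforce
      then show "(\<lambda>\<omega>. \<integral>\<^sup>+ u. input_information (k u) (return borel) (F \<omega>) \<partial>\<mu>) \<in> borel_measurable M"
        by (simp add: ret cong: nn_integral_cong)
    qed
    \<comment> \<open>The hypothesis concerns vector-valued messages, so two distinct vectors serve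
      as the values of the binary message.\<close>
    define a b :: "complex ^ 'a" where "a = 0" and "b = vec 1"
    have "a \<noteq> b" by (simp add: a_def b_def vec_eq_iff)
    note D = less_noisy_output_divergence[OF assms(6) this assms(2,3) P Q]
    show ?thesis
      unfolding ergodic_secrecy_rate_def i gauss
    \<comment> \<open>The terms \<open>t\<close> of the rule are the conditional information of
      \<open>x\<close> given \<open>u\<close> plus the divergence of the output law from the
      Gaussian one.\<close>
    proof (rule extended_expectation_difference_mono[OF meas(1)[OF assms(2)] _ _ meas(1)[OF assms(3)] _ _ c _ c])
      show "(\<integral>\<^sup>+ \<omega>. ennreal (log 2 (gram_det K (G \<omega>))) \<partial>M) < top"
        by (subst nn_integral_eq_integral[OF assms(5) AE_I2[OF gd(2)]]) simp
      show "(\<integral>\<^sup>+ \<omega>. (\<integral>\<^sup>+ u. input_information (k u) (return borel) (G \<omega>) \<partial>\<mu>) + output_divergence (G \<omega>) P Q \<partial>M) \<le>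
          (\<integral>\<^sup>+ \<omega>. (\<integral>\<^sup>+ u. input_information (k u) (return borel) (H \<omega>) \<partial>\<mu>) + output_divergence (H \<omega>) P Q \<partial>M)"
        using D less_noisy_conditional_information[OF assms(6,1,2,3) \<mu> k]
        by (simp add: nn_integral_add meas add_mono)
      \<comment> \<open>The log determinant is measurable in the channel because \<open>c\<close>
        writes it as a sum of measurable terms.\<close>
      show "(\<lambda>\<omega>. ennreal (log 2 (gram_det K (H \<omega>)))) \<in> borel_measurable M"
        "(\<lambda>\<omega>. ennreal (log 2 (gram_det K (G \<omega>)))) \<in> borel_measurable M"
        unfolding c by measurable
    qed (simp_all add: meas)
  qed
  ultimately show ?thesis
    using nonprecoded_gaussian_input_in_inputs_with_covariance[OF K] by blast
qed

end
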